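(* Let $\ell$ be an odd prime and $G$ a closed subgroup of $\operatorname{GL}_2(\mathbb{Z}_\ell)$. (i) Suppose that (a) $\det(g)$ is a square in $\mathbb{Z}_\ell^\times$ for every $g\in G$, and (b) the group $G_0:=\operatorname{Sat}(G)^{\det=1}$ has the property that $G_0(\ell)$ is contained in a (split or nonsplit) Cartan subgroup or in a Borel subgroup of $\operatorname{GL}_2(\mathbb{F}_\ell)$ and $|G_0/N(G_0)|\ne 4$. Then for every positive integer $s$: if $L(G)$ contains $\ell^s\mathfrak{sl}_2(\mathbb{Z}_\ell)$, then the derived subgroup $G'$ contains $\mathcal{B}_\ell(4s)$. (ii) Without any assumption on $G$, either $G'=\operatorname{SL}_2(\mathbb{Z}_\ell)$, or there is a closed subgroup $H$ of $G$ with $[G:H]\le 24$ satisfying conditions (a) and (b) of (i) (with $H$ in place of $G$).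
   Context: $\operatorname{Sat}(G)$ is the subgroup of $\operatorname{GL}_2(\mathbb{Z}_\ell)$ generated by $G$ and the scalars $\mathbb{Z}_\ell^\times\cdot\operatorname{Id}$; for a subgroup $X$, $X^{\det=1}=X\cap\operatorname{SL}_2(\mathbb{Z}_\ell)$. $X(\ell)$ is the image of $X$ in $\operatorname{GL}_2(\mathbb{F}_\ell)$. For a closed subgroup $X$ of $\operatorname{SL}_2(\mathbb{Z}_\ell)$, $N(X)$ is its unique maximal normal pro-$\ell$ subgroup. $\Theta(g)=g-\frac{\operatorname{tr}(g)}{2}\operatorname{Id}$ and $L(G)$ is the closed subgroup of $\mathfrak{sl}_2(\mathbb{Z}_\ell)$ (trace-zero matrices) topologically generated by $\Theta(G)$. $\mathcal{B}_\ell(n)=\{g\in\operatorname{SL}_2(\mathbb{Z}_\ell):g\equiv\operatorname{Id}\pmod{\ell^n}\}$. Split Cartan: conjugate to the diagonal invertible matrices; nonsplit Cartan: $A^\times$ for a subalgebra $A\subseteq M_2(\mathbb{F}_\ell)$ which is a field; Borel: conjugate to the invertible upper-triangular matrices. *)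

theory Defs
  imports
    "HOL-Analysis.Analysis"
    "HOL-Algebra.Generated_Groups"
    "HOL-Algebra.Subrings"
    "Berlekamp_Zassenhaus.Finite_Field"
begin

section \<open>The ring of \<open>\<ell>\<close>-adic integers\<close>

text \<open>
  The prime \<open>\<ell>\<close> is the cardinality of a type \<open>'p\<close> of class \<^class>\<open>prime_card\<close>, so
  that \<^typ>\<open>'p mod_ring\<close> is the field with \<open>\<ell>\<close> elements. The \<open>\<ell>\<close>-adic integers are the
  inverse limit of the rings \<open>\<int>/\<ell>\<^sup>n\<close>: an element \<open>x\<close> is the sequence of its residues
  \<open>padic_res x n\<close> modulo \<open>\<ell>\<^sup>n\<close>, each taken in \<open>{0..<\<ell>\<^sup>n}\<close> (the defining equation forces
  this range).
\<close>

typedef (overloaded) ('p::prime_card) padic_int =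
    "{x :: nat \<Rightarrow> int. \<forall>n. x n = x (Suc n) mod int CARD('p) ^ n}"
  morphisms padic_res Abs_padic_int
  by (rule exI[of _ "\<lambda>_. 0"]) simp

setup_lifting type_definition_padic_int

lemma mod_power_Suc_mod_power:
  "(a :: int) mod m ^ Suc n mod m ^ n = a mod m ^ n"
  by (simp add: mod_mod_cancel)

lemma padic_res_mod_self: "padic_res (x :: 'p::prime_card padic_int) n mod int CARD('p) ^ n = padic_res x n"
proof -
  have "padic_res x n = padic_res x (Suc n) mod int CARD('p) ^ n"
    using padic_res[of x] by blast
  then show ?thesis by simp
qed

lemma padic_res_le:
  assumes "n \<le> m"
  shows "padic_res (x :: 'p::prime_card padic_int) n = padic_res x m mod int CARD('p) ^ n"
  using assms
proof (induction m rule: dec_induct)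
  case base
  show ?case by (simp add: padic_res_mod_self)
next
  case (step m)
  have "padic_res x m = padic_res x (Suc m) mod int CARD('p) ^ m"
    using padic_res[of x] by blast
  with step show ?case
    by (metis le_imp_power_dvd mod_mod_cancel)
qed

instantiation padic_int :: (prime_card) comm_ring_1
begin

lift_definition zero_padic_int :: "'a padic_int" is "\<lambda>_. 0" by simp

lift_definition one_padic_int :: "'a padic_int" is "\<lambda>n. 1 mod int CARD('a) ^ n"
  by (simp only: mod_power_Suc_mod_power)

lift_definition plus_padic_int :: "'a padic_int \<Rightarrow> 'a padic_int \<Rightarrow> 'a padic_int"
  is "\<lambda>x y n. (x n + y n) mod int CARD('a) ^ n"
proof -
  fix x y :: "nat \<Rightarrow> int" and n
  let ?m = "int CARD('a)"
  assume "\<And>n. x n = x (Suc n) mod ?m ^ n" and "\<And>n. y n = y (Suc n) mod ?m ^ n"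
  from this[of n] have "(x n + y n) mod ?m ^ n = (x (Suc n) + y (Suc n)) mod ?m ^ n"
    by (simp add: mod_simps)
  then show "(x n + y n) mod ?m ^ n = (x (Suc n) + y (Suc n)) mod ?m ^ Suc n mod ?m ^ n"
    by (simp only: mod_power_Suc_mod_power)
qed

lift_definition minus_padic_int :: "'a padic_int \<Rightarrow> 'a padic_int \<Rightarrow> 'a padic_int"
  is "\<lambda>x y n. (x n - y n) mod int CARD('a) ^ n"
proof -
  fix x y :: "nat \<Rightarrow> int" and n
  let ?m = "int CARD('a)"
  assume "\<And>n. x n = x (Suc n) mod ?m ^ n" and "\<And>n. y n = y (Suc n) mod ?m ^ n"
  from this[of n] have "(x n - y n) mod ?m ^ n = (x (Suc n) - y (Suc n)) mod ?m ^ n"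
    by (simp add: mod_simps)
  then show "(x n - y n) mod ?m ^ n = (x (Suc n) - y (Suc n)) mod ?m ^ Suc n mod ?m ^ n"
    by (simp only: mod_power_Suc_mod_power)
qed

lift_definition uminus_padic_int :: "'a padic_int \<Rightarrow> 'a padic_int"
  is "\<lambda>x n. (- x n) mod int CARD('a) ^ n"
proof -
  fix x :: "nat \<Rightarrow> int" and n
  let ?m = "int CARD('a)"
  assume "\<And>n. x n = x (Suc n) mod ?m ^ n"
  from this[of n] have "(- x n) mod ?m ^ n = (- x (Suc n)) mod ?m ^ n"
    by (simp add: mod_simps)
  then show "(- x n) mod ?m ^ n = (- x (Suc n)) mod ?m ^ Suc n mod ?m ^ n"
    by (simp only: mod_power_Suc_mod_power)
qed

lift_definition times_padic_int :: "'a padic_int \<Rightarrow> 'a padic_int \<Rightarrow> 'a padic_int"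
  is "\<lambda>x y n. (x n * y n) mod int CARD('a) ^ n"
proof -
  fix x y :: "nat \<Rightarrow> int" and n
  let ?m = "int CARD('a)"
  assume "\<And>n. x n = x (Suc n) mod ?m ^ n" and "\<And>n. y n = y (Suc n) mod ?m ^ n"
  from this[of n] have "(x n * y n) mod ?m ^ n = (x (Suc n) * y (Suc n)) mod ?m ^ n"
    by (simp add: mod_simps)
  then show "(x n * y n) mod ?m ^ n = (x (Suc n) * y (Suc n)) mod ?m ^ Suc n mod ?m ^ n"
    by (simp only: mod_power_Suc_mod_power)
qed

instance
proof
  fix a b c :: "'a padic_int"
  note rep_eqs = padic_res_inject[symmetric] fun_eq_iff plus_padic_int.rep_eq
    minus_padic_int.rep_eq uminus_padic_int.rep_eq times_padic_int.rep_eq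
    zero_padic_int.rep_eq one_padic_int.rep_eq padic_res_mod_self mod_simps
  show "a * b * c = a * (b * c)"
    by (simp add: rep_eqs mult.assoc)
  show "a * b = b * a"
    by (simp add: rep_eqs mult.commute)
  show "1 * a = a"
    by (simp add: rep_eqs)
  show "a + b + c = a + (b + c)"
    by (simp add: rep_eqs add.assoc)
  show "a + b = b + a"
    by (simp add: rep_eqs add.commute)
  show "0 + a = a"
    by (simp add: rep_eqs)
  show "- a + a = 0"
    by (simp add: rep_eqs)
  show "a - b = a + - b"
    by (simp add: rep_eqs)
  show "(a + b) * c = a * c + b * c"
    by (simp add: rep_eqs distrib_right)
  have "(1 :: int) < int CARD('a)"
    using prime_gt_1_nat[OF prime_card[where 'a = 'a]] by simp
  then show "(0 :: 'a padic_int) \<noteq> 1"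
    by (auto simp: rep_eqs intro!: exI[of _ 1])
qed

end

text \<open>The \<open>\<ell>\<close>-adic topology: the sets \<open>{y. y \<equiv> x (mod \<ell>\<^sup>n)}\<close> are a basis of neighbourhoods of \<open>x\<close>.\<close>

instantiation padic_int :: (prime_card) topological_space
begin

definition open_padic_int :: "'a padic_int set \<Rightarrow> bool" where
  "open_padic_int U \<longleftrightarrow> (\<forall>x\<in>U. \<exists>n. \<forall>y. padic_res y n = padic_res x n \<longrightarrow> y \<in> U)"

instance
proof
  show "open (UNIV :: 'a padic_int set)"
    by (simp add: open_padic_int_def)
next
  fix S T :: "'a padic_int set"
  assume S: "open S" and T: "open T"
  show "open (S \<inter> T)"
    unfolding open_padic_int_def
  proof
    fix x assume "x \<in> S \<inter> T"
    then obtain m n where m: "\<And>y. padic_res y m = padic_res x m \<Longrightarrow> y \<in> S"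
      and n: "\<And>y. padic_res y n = padic_res x n \<Longrightarrow> y \<in> T"
      using S T unfolding open_padic_int_def by blast
    have "y \<in> S \<inter> T" if "padic_res y (max m n) = padic_res x (max m n)" for y
    proof -
      have "padic_res y k = padic_res x k" if "k \<le> max m n" for k
        using padic_res_le[OF that, of x] padic_res_le[OF that, of y]
        by (simp add: \<open>padic_res y (max m n) = padic_res x (max m n)\<close>)
      then show ?thesis
        using m n by simp
    qed
    then show "\<exists>k. \<forall>y. padic_res y k = padic_res x k \<longrightarrow> y \<in> S \<inter> T"
      by blast
  qed
next
  fix K :: "'a padic_int set set"
  assume "\<forall>S\<in>K. open S"
  then show "open (\<Union>K)"
    unfolding open_padic_int_def by (meson Union_iff)
qed

end

definition padic_residue :: "'p::prime_card padic_int \<Rightarrow> 'p mod_ring" where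
  "padic_residue x = of_int (padic_res x 1)"

section \<open>Matrix groups\<close>

definition GL2 :: "('a::comm_ring_1 ^ 2 ^ 2) monoid" where
  "GL2 = \<lparr>carrier = {g. invertible g}, monoid.mult = (**), one = mat 1\<rparr>"

definition SL2 :: "('a::comm_ring_1 ^ 2 ^ 2) set" where
  "SL2 = {g. det g = 1}"

definition sl2 :: "('a::comm_ring_1 ^ 2 ^ 2) monoid" where
  "sl2 = \<lparr>carrier = {A. trace A = 0}, monoid.mult = (+), one = 0\<rparr>"

definition closed_subgroup :: "'a::topological_space set \<Rightarrow> 'a monoid \<Rightarrow> bool" where
  "closed_subgroup H G \<longleftrightarrow> subgroup H G \<and> closedin (top_of_set (carrier G)) H"

text \<open>In HOL-Analysis, \<^term>\<open>mat c\<close> is the scalar matrix \<open>c \<cdot> Id\<close>.\<close>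

definition Sat :: "('a::comm_ring_1 ^ 2 ^ 2) set \<Rightarrow> ('a ^ 2 ^ 2) set" where
  "Sat G = generate GL2 (G \<union> mat ` {c. c dvd 1})"

text \<open>The image \<open>X(\<ell>)\<close> in \<open>GL\<^sub>2(\<bbbF>\<^sub>\<ell>)\<close>.\<close>

definition reduction :: "('p::prime_card padic_int ^ 2 ^ 2) set \<Rightarrow> ('p mod_ring ^ 2 ^ 2) set" where
  "reduction X = map_matrix padic_residue ` X"

text \<open>
  A closed subgroup of the profinite group \<open>GL\<^sub>2(\<int>\<^sub>\<ell>)\<close> is profinite, hence it is pro-\<open>\<ell>\<close> iff
  all its open normal subgroups have \<open>\<ell>\<close>-power index. Conversely a subgroup that is
  pro-\<open>\<ell>\<close> in the subspace topology is compact, hence closed. An infinite quotient has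
  \<^const>\<open>order\<close> 0, which is not a power of \<open>\<ell>\<close>.
\<close>

definition pro_l_subgroup :: "('p::prime_card padic_int ^ 2 ^ 2) set \<Rightarrow> bool" where
  "pro_l_subgroup P \<longleftrightarrow> closed_subgroup P GL2 \<and>
     (\<forall>U. U \<lhd> GL2\<lparr>carrier := P\<rparr> \<and> openin (top_of_set P) U \<longrightarrow>
        (\<exists>k. order (GL2\<lparr>carrier := P\<rparr> Mod U) = CARD('p) ^ k))"

definition normal_pro_l :: "('p::prime_card padic_int ^ 2 ^ 2) set \<Rightarrow> ('p padic_int ^ 2 ^ 2) set \<Rightarrow> bool" where
  "normal_pro_l N X \<longleftrightarrow> N \<lhd> GL2\<lparr>carrier := X\<rparr> \<and> pro_l_subgroup N"

definition max_normal_pro_l :: "('p::prime_card padic_int ^ 2 ^ 2) set \<Rightarrow> ('p padic_int ^ 2 ^ 2) set" where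
  "max_normal_pro_l X =
     (THE N. normal_pro_l N X \<and> (\<forall>M. normal_pro_l M X \<and> N \<subseteq> M \<longrightarrow> M = N))"

text \<open>Division by 2, meaningful for odd \<open>\<ell>\<close>, where 2 is a unit.\<close>

definition half :: "'p::prime_card padic_int \<Rightarrow> 'p padic_int" where
  "half x = (THE y. 2 * y = x)"

definition Theta :: "'p::prime_card padic_int ^ 2 ^ 2 \<Rightarrow> 'p padic_int ^ 2 ^ 2" where
  "Theta g = g - mat (half (trace g))"

text \<open>
  \<open>L(G)\<close>, the closed additive subgroup topologically generated by \<open>\<Theta>(G)\<close>; no closure under
  brackets is imposed.
\<close>

definition Lie :: "('p::prime_card padic_int ^ 2 ^ 2) set \<Rightarrow> ('p padic_int ^ 2 ^ 2) set" where
  "Lie G = (\<lambda>S. closed_subgroup S sl2) hull (Theta ` G)"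

definition l_power_sl2 :: "nat \<Rightarrow> ('p::prime_card padic_int ^ 2 ^ 2) set" where
  "l_power_sl2 s = (\<lambda>A. mat (of_nat CARD('p) ^ s) ** A) ` carrier sl2"

definition congruence_subgroup :: "nat \<Rightarrow> ('p::prime_card padic_int ^ 2 ^ 2) set" where
  "congruence_subgroup n = {g \<in> SL2. \<forall>i j. of_nat CARD('p) ^ n dvd (g - mat 1) $ i $ j}"

section \<open>Cartan and Borel subgroups\<close>

definition conjugate_by :: "'a::field ^ 2 ^ 2 \<Rightarrow> ('a ^ 2 ^ 2) set \<Rightarrow> ('a ^ 2 ^ 2) set" where
  "conjugate_by P S = (\<lambda>g. P ** g ** matrix_inv P) ` S"

definition split_cartan :: "('a::field ^ 2 ^ 2) set \<Rightarrow> bool" where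
  "split_cartan C \<longleftrightarrow> (\<exists>P. invertible P \<and>
     C = conjugate_by P {g. invertible g \<and> g $ 1 $ 2 = 0 \<and> g $ 2 $ 1 = 0})"

definition borel_subgroup :: "('a::field ^ 2 ^ 2) set \<Rightarrow> bool" where
  "borel_subgroup B \<longleftrightarrow> (\<exists>P. invertible P \<and>
     B = conjugate_by P {g. invertible g \<and> g $ 2 $ 1 = 0})"

definition M2 :: "('a::comm_ring_1 ^ 2 ^ 2) ring" where
  "M2 = \<lparr>carrier = UNIV, monoid.mult = (**), one = mat 1, zero = 0, add = (+)\<rparr>"

text \<open>
  The algebra \<open>A\<close> is not required to have dimension 2. The additional case of the scalars is
  harmless: they lie in every split Cartan subgroup.
\<close>

definition nonsplit_cartan :: "('a::field ^ 2 ^ 2) set \<Rightarrow> bool" where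
  "nonsplit_cartan C \<longleftrightarrow> (\<exists>A. subfield A M2 \<and> (\<forall>c. \<forall>X\<in>A. mat c ** X \<in> A) \<and>
     C = Units (M2\<lparr>carrier := A\<rparr>))"

section \<open>The two conditions on \<open>G\<close>\<close>

definition square_determinants :: "('a::comm_ring_1 ^ 2 ^ 2) set \<Rightarrow> bool" where
  "square_determinants G \<longleftrightarrow> (\<forall>g\<in>G. \<exists>u. u dvd 1 \<and> det g = u ^ 2)"

definition cartan_or_borel_type :: "('p::prime_card padic_int ^ 2 ^ 2) set \<Rightarrow> bool" where
  "cartan_or_borel_type G \<longleftrightarrow> (let G0 = Sat G \<inter> SL2 in
     (\<exists>C. (split_cartan C \<or> nonsplit_cartan C \<or> borel_subgroup C) \<and> reduction G0 \<subseteq> C) \<and>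
     order (GL2\<lparr>carrier := G0\<rparr> Mod max_normal_pro_l G0) \<noteq> 4)"

end

(*
  Scalars do not change commutators, so G' contains the commutators of the group X = Sat(G)^{det=1}
  in SL_2.  If X(l) lies in a Cartan or Borel subgroup, the elements of X with unipotent reduction
  form its maximal normal pro-l subgroup U, and X/U is abelian; unless |X/U| = 4, either X = +-U or
  some x in X has a trace different from 0 and +-2 modulo l.  The action of such an x shows that
  the span of the matrices u - u^{-1} with u in U contains l^{2s} sl_2 whenever L(G) contains
  l^s sl_2.  Following Pink, the commutator filtration of the pro-l group U then approximates every
  element of B(4s) by elements of G'.  Hence B(4s) lies in the closed group G, and commutators of
  elementary matrices show that G' is open, so that it contains B(4s) as well.

  For (ii), the class equation (Dickson) gives in every subgroup of SL_2(F_l) that contains -1,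
  except in SL_2(F_l) itself for l >= 5, a subgroup of index at most 12 satisfying condition (b);
  its preimage in G, cut down to square determinants, has index at most 24.  If
  X(l) = SL_2(F_l) and l >= 5, then Serre's lifting argument shows that G' is SL_2(Z_l).
*)
theory Submission
  imports Defs "HOL-Algebra.Sylow" "HOL-Number_Theory.Number_Theory"
begin

section \<open>Arithmetic of the \<open>\<ell>\<close>-adic integers\<close>

text \<open>The exponent 4s is 2 * 2s. Passing from X to U costs l^(2s), because the line spanned by
  the trace-free part of a generic element is recovered only as a bracket of two elements known up
  to a factor l^s; the first step of the commutator filtration is a bracket again and doubles the
  exponent once more. Square determinants let every g in G be written as c x with c a unit and x in
  X, so that Theta(g) = c Theta(x) and L(G) is controlled by X. G' is the abstract derived subgroup,
  so approximation by its elements does not yet give membership; this is why openness of G' needs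
  its own argument with explicit matrices. Divisions by 2 are avoided by working with x - x^(-1),
  which is twice Theta(x) for x in SL_2. Conditions modulo l are phrased by traces, so that Borel,
  split and nonsplit cases are treated alike and no quadratic extension is needed. The index 12
  comes from the binary icosahedral group, of order 120 with cyclic subgroups of order 10, and from
  groups of order 24 with the subgroup of order two; restricting to square determinants contributes
  the factor 2.\<close>

abbreviation ell :: "'p::prime_card padic_int" where
  "ell \<equiv> of_nat CARD('p)"

lemma padic_eqI: "(\<And>n. padic_res x n = padic_res y n) \<Longrightarrow> x = y"
  by (simp add: padic_res_inject[symmetric] fun_eq_iff)

lemma padic_res_of_nat: "padic_res (of_nat k :: 'p::prime_card padic_int) n = int k mod int CARD('p) ^ n"
  by (induction k)
     (simp_all add: zero_padic_int.rep_eq one_padic_int.rep_eq plus_padic_int.rep_eq mod_simps add.commute)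

lemma padic_res_ell_power: "padic_res (ell ^ k :: 'p::prime_card padic_int) n = int CARD('p) ^ k mod int CARD('p) ^ n"
  using padic_res_of_nat[of "CARD('p) ^ k" n] by simp

lemma padic_res_range: "0 \<le> padic_res (x :: 'p::prime_card padic_int) n"
    "padic_res x n < int CARD('p) ^ n"
  using padic_res_mod_self[of x n] pos_mod_sign[of "int CARD('p) ^ n" "padic_res x n"]
    pos_mod_bound[of "int CARD('p) ^ n" "padic_res x n"] by simp_all

text \<open>The nontrivial direction builds the quotient: its residue at level k is the residue of x
  at level k + n divided by l^n, so the sequence is shifted by n.\<close>

lemma ell_pow_dvd_iff: "(ell :: 'p::prime_card padic_int) ^ n dvd x \<longleftrightarrow> padic_res x n = 0"
proof
  assume "ell ^ n dvd x"
  then obtain y where "x = ell ^ n * y" by (auto simp: dvd_def)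
  then show "padic_res x n = 0"
    by (simp add: times_padic_int.rep_eq padic_res_ell_power)
next
  assume *: "padic_res x n = 0"
  let ?l = "int CARD('p)"
  define f where "f k = padic_res x (k + n) div ?l ^ n" for k
  have l: "?l > 0" by simp
  have div: "?l ^ n dvd padic_res x (k + n)" for k
    using padic_res_le[of n "k + n" x] * by auto
  have fm: "padic_res x (k + n) = ?l ^ n * f k" for k
    using div[of k] by (simp add: f_def)
  have "f k = f (Suc k) mod ?l ^ k" for k
  proof -
    have "padic_res x (k + n) = padic_res x (Suc k + n) mod ?l ^ (k + n)"
      by (rule padic_res_le) simp
    then have "?l ^ n * f k = ?l ^ n * (f (Suc k) mod ?l ^ k)"
      unfolding fm by (simp only: power_add mult.commute[of "?l ^ k"] mult_mod_right)
    then show ?thesis by simp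
  qed
  then have f: "padic_res (Abs_padic_int f :: 'p padic_int) = f"
    by (intro Abs_padic_int_inverse CollectI allI)
  have "x = ell ^ n * Abs_padic_int f"
  proof (rule padic_eqI)
    fix k
    have "padic_res x k = padic_res x (k + n) mod ?l ^ k" by (rule padic_res_le) simp
    also have "\<dots> = (?l ^ n mod ?l ^ k * f k) mod ?l ^ k" unfolding fm by (simp add: mod_simps)
    also have "\<dots> = padic_res (ell ^ n * Abs_padic_int f :: 'p padic_int) k"
      by (simp only: times_padic_int.rep_eq padic_res_ell_power f)
    finally show "padic_res x k = padic_res (ell ^ n * Abs_padic_int f :: 'p padic_int) k" .
  qed
  then show "ell ^ n dvd x" by simp
qed

lemma ell_pow_dvd_diff_iff:
  "(ell :: 'p::prime_card padic_int) ^ n dvd x - y \<longleftrightarrow> padic_res x n = padic_res y n"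
proof -
  let ?m = "int CARD('p) ^ n"
  have "padic_res (x - y) n = 0 \<longleftrightarrow> ?m dvd padic_res x n - padic_res y n"
    by (simp add: minus_padic_int.rep_eq mod_eq_0_iff_dvd)
  also have "\<dots> \<longleftrightarrow> padic_res x n mod ?m = padic_res y n mod ?m"
    by (rule mod_eq_dvd_iff[symmetric])
  finally show ?thesis by (simp only: ell_pow_dvd_iff padic_res_mod_self)
qed

lemma padic_eq_0I: "(\<And>n. (ell :: 'p::prime_card padic_int) ^ n dvd x) \<Longrightarrow> x = 0"
  by (rule padic_eqI) (simp add: ell_pow_dvd_iff zero_padic_int.rep_eq)

lemma padic_approx_nat: "\<exists>k::nat. (ell :: 'p::prime_card padic_int) ^ n dvd x - of_nat k"
proof
  show "(ell :: 'p padic_int) ^ n dvd x - of_nat (nat (padic_res x n))"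
    unfolding ell_pow_dvd_diff_iff padic_res_of_nat by (simp add: padic_res_range padic_res_mod_self)
qed

text \<open>The factor l^n costs n digits, so level k of x is read off from level k + n of the
  product.\<close>

lemma ell_cancel:
  assumes "(ell :: 'p::prime_card padic_int) ^ n * x = 0" shows "x = 0"
proof (rule padic_eqI)
  fix k
  let ?l = "int CARD('p)"
  have "padic_res (ell ^ n * x) (k + n) = 0" using assms by (simp add: zero_padic_int.rep_eq)
  then have "?l ^ (k + n) dvd ?l ^ n * padic_res x (k + n)"
    by (simp add: times_padic_int.rep_eq padic_res_ell_power mod_simps mod_eq_0_iff_dvd)
  then have "?l ^ k dvd padic_res x (k + n)" by (simp add: power_add mult.commute)
  then show "padic_res x k = padic_res 0 k"
    using padic_res_le[of k "k + n" x] by (simp add: zero_padic_int.rep_eq)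
qed

text \<open>Sequential compactness by a Koenig argument: there are finitely many residues at each
  level, so compatible residues can be chosen that are hit infinitely often. Stating it as a cluster
  point spares the choice of a subsequence.\<close>

lemma padic_compact:
  fixes f :: "nat \<Rightarrow> 'p::prime_card padic_int"
  shows "\<exists>x. \<forall>n. \<exists>k\<ge>n. ell ^ n dvd f k - x"
proof -
  let ?l = "int CARD('p)"
  let ?P = "\<lambda>n r. infinite {k. padic_res (f k) n = r}"
  have "\<exists>r. \<forall>n. ?P n (r n) \<and> r n = r (Suc n) mod ?l ^ n"
  proof (rule dependent_nat_choice)
    have "padic_res (f k) 0 = 0" for k using padic_res_mod_self[of "f k" 0] by simp
    then show "\<exists>r. ?P 0 r" by (intro exI[of _ 0]) simp
  next
    fix r n assume P: "?P n r"
    let ?A = "{k. padic_res (f k) n = r}"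
    have "(\<lambda>k. padic_res (f k) (Suc n)) ` ?A \<subseteq> {0..<?l ^ Suc n}"
      using padic_res_range by (auto simp del: power_Suc)
    then have "finite ((\<lambda>k. padic_res (f k) (Suc n)) ` ?A)" by (rule finite_subset) simp
    from pigeonhole_infinite[OF P this] obtain a where
      a: "a \<in> ?A" "infinite {b \<in> ?A. padic_res (f b) (Suc n) = padic_res (f a) (Suc n)}" by blast
    have "?P (Suc n) (padic_res (f a) (Suc n))"
      using a(2) by (rule contrapos_nn) (erule finite_subset[rotated], auto)
    moreover have "r = padic_res (f a) (Suc n) mod ?l ^ n"
      using a(1) padic_res_le[of n "Suc n" "f a"] by simp
    ultimately show "\<exists>s. ?P (Suc n) s \<and> r = s mod ?l ^ n" by blast
  qed
  then obtain r where r: "\<And>n. ?P n (r n)" "\<And>n. r n = r (Suc n) mod ?l ^ n" by blast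
  have res: "padic_res (Abs_padic_int r :: 'p padic_int) = r"
    by (intro Abs_padic_int_inverse CollectI allI r(2))
  show ?thesis
  proof (rule exI[of _ "Abs_padic_int r"], rule allI)
    fix n
    have "\<exists>k\<ge>n. padic_res (f k) n = r n"
      using r(1)[of n] unfolding infinite_nat_iff_unbounded_le by blast
    then show "\<exists>k\<ge>n. ell ^ n dvd f k - Abs_padic_int r"
      by (simp add: ell_pow_dvd_diff_iff res)
  qed
qed

lemma ell_dvd_mult_iff: "(ell :: 'p::prime_card padic_int) dvd x * y \<longleftrightarrow> ell dvd x \<or> ell dvd y"
proof -
  have p: "prime (int CARD('p))" using prime_card[where 'a='p] by simp
  have e: "(ell :: 'p padic_int) dvd z \<longleftrightarrow> int CARD('p) dvd padic_res z 1" for z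
    using ell_pow_dvd_iff[of 1 z] padic_res_mod_self[of z 1] by (auto simp: mod_eq_0_iff_dvd)
  have "int CARD('p) dvd padic_res (x * y) 1 \<longleftrightarrow> int CARD('p) dvd padic_res x 1 * padic_res y 1"
    by (simp add: times_padic_int.rep_eq dvd_mod_iff)
  then show ?thesis using e prime_dvd_mult_iff[OF p] by blast
qed

text \<open>A cluster point of approximate zeros is a zero. The first hypothesis is the Lipschitz
  property of polynomials, so inverses and square roots can be obtained by solving modulo every
  l^n.\<close>

lemma padic_solve_limit:
  fixes F :: "'p::prime_card padic_int \<Rightarrow> 'p padic_int"
  assumes F: "\<And>x y. x - y dvd F x - F y" and ex: "\<And>n. \<exists>x. ell ^ n dvd F x"
  shows "\<exists>x. F x = 0"
proof -
  obtain f where f: "\<And>n. ell ^ n dvd F (f n)" using ex by metis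
  obtain x where x: "\<And>n. \<exists>k\<ge>n. ell ^ n dvd f k - x" using padic_compact by metis
  have "ell ^ n dvd F x" for n
  proof -
    obtain k where k: "k \<ge> n" "ell ^ n dvd f k - x" using x by blast
    have "ell ^ n dvd F (f k)" using f[of k] k(1) by (meson dvd_trans le_imp_power_dvd)
    moreover have "ell ^ n dvd F (f k) - F x" using F k(2) by (meson dvd_trans)
    ultimately have "ell ^ n dvd F (f k) - (F (f k) - F x)" by (rule dvd_diff)
    then show ?thesis by simp
  qed
  then show ?thesis using padic_eq_0I by blast
qed

lemma padic_unit_iff: "(x :: 'p::prime_card padic_int) dvd 1 \<longleftrightarrow> \<not> ell dvd x"
proof
  assume "x dvd 1"
  then obtain y where y: "1 = x * y" by (auto simp: dvd_def)
  show "\<not> ell dvd x"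
  proof
    assume "ell dvd x"
    then have "ell ^ 1 dvd (1 :: 'p padic_int)" unfolding y by simp
    then show False
      using prime_gt_1_nat[OF prime_card[where 'a='p]]
      by (simp only: ell_pow_dvd_iff one_padic_int.rep_eq) simp
  qed
next
  let ?l = "int CARD('p)"
  assume "\<not> ell dvd x"
  then have nz: "padic_res x 1 \<noteq> 0" using ell_pow_dvd_iff[of 1 x] by simp
  have p: "prime ?l" using prime_card[where 'a='p] by simp
  have "\<exists>y. x * y - 1 = 0"
  proof (rule padic_solve_limit)
    fix n
    have "coprime (padic_res x n) (?l ^ n)"
    proof (cases n)
      case (Suc m)
      have "\<not> ?l dvd padic_res x n"
        using nz padic_res_le[of 1 n x] Suc by auto
      then have "coprime ?l (padic_res x n)" using p by (rule prime_imp_coprime[rotated])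
      then show ?thesis by (simp add: coprime_commute)
    qed simp
    then obtain k where k: "[padic_res x n * k = 1] (mod ?l ^ n)" using cong_solve_coprime_int by blast
    define j where "j = nat (k mod ?l ^ n)"
    have j: "int j = k mod ?l ^ n" by (simp add: j_def)
    have "ell ^ n dvd x * of_nat j - 1"
      unfolding ell_pow_dvd_diff_iff times_padic_int.rep_eq padic_res_of_nat one_padic_int.rep_eq j
      using k by (simp add: cong_def mod_simps)
    then show "\<exists>y. ell ^ n dvd x * y - 1" by blast
  qed (auto simp: dvd_def algebra_simps intro: exI[of _ x])
  then show "x dvd 1" by (metis dvd_triv_left right_minus_eq)
qed

lemma padic_unit_mult_iff: "(x * y :: 'p::prime_card padic_int) dvd 1 \<longleftrightarrow> x dvd 1 \<and> y dvd 1"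
  by (simp add: padic_unit_iff ell_dvd_mult_iff)

section \<open>Reduction to the residue field, units and squares\<close>

lemma of_int_mod_ring_eq_iff:
  "(of_int a :: 'p::prime_card mod_ring) = of_int b \<longleftrightarrow> a mod int CARD('p) = b mod int CARD('p)"
  unfolding of_int_of_int_mod_ring by transfer auto

lemma padic_residue_eq_iff:
  "padic_residue x = padic_residue y \<longleftrightarrow> (ell :: 'p::prime_card padic_int) dvd x - y"
  using ell_pow_dvd_diff_iff[of 1 x y] padic_res_mod_self[of x 1] padic_res_mod_self[of y 1]
  by (simp add: padic_residue_def of_int_mod_ring_eq_iff)

lemma padic_residue_0 [simp]: "padic_residue 0 = 0"
  by (simp add: padic_residue_def zero_padic_int.rep_eq)

lemma padic_residue_eq_0_iff: "padic_residue x = 0 \<longleftrightarrow> (ell :: 'p::prime_card padic_int) dvd x"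
  using padic_residue_eq_iff[of x 0] by simp

lemma of_int_mod_card: "(of_int (a mod int CARD('p)) :: 'p::prime_card mod_ring) = of_int a"
  by (simp add: of_int_mod_ring_eq_iff)

lemma padic_residue_1 [simp]: "padic_residue 1 = 1"
  using of_int_mod_card[of 1] by (simp add: padic_residue_def one_padic_int.rep_eq)

lemma padic_residue_add [simp]: "padic_residue (x + y) = padic_residue x + padic_residue y"
  using of_int_mod_card[of "padic_res x 1 + padic_res y 1"]
  by (simp add: padic_residue_def plus_padic_int.rep_eq)

lemma padic_residue_mult [simp]: "padic_residue (x * y) = padic_residue x * padic_residue y"
  using of_int_mod_card[of "padic_res x 1 * padic_res y 1"]
  by (simp add: padic_residue_def times_padic_int.rep_eq)

lemma padic_residue_minus [simp]: "padic_residue (- x) = - padic_residue x"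
  using padic_residue_add[of x "- x"] by (simp add: minus_unique[symmetric])

lemma padic_residue_diff [simp]: "padic_residue (x - y) = padic_residue x - padic_residue y"
  using padic_residue_add[of x "- y"] by simp

lemma padic_residue_of_nat [simp]: "padic_residue (of_nat k) = of_nat k"
  by (induction k) simp_all

lemma padic_residue_numeral [simp]: "padic_residue (numeral k) = numeral k"
  using padic_residue_of_nat[of "numeral k"] by simp

lemma padic_residue_power [simp]: "padic_residue (x ^ k) = padic_residue x ^ k"
  by (induction k) simp_all

lemma padic_residue_surj: "\<exists>x. padic_residue x = y"
  using surj_of_nat_mod_ring by (metis padic_residue_of_nat)

lemma padic_unit_iff_residue: "x dvd 1 \<longleftrightarrow> padic_residue x \<noteq> 0"
  by (simp add: padic_unit_iff padic_residue_eq_0_iff)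

definition padic_inverse :: "'p::prime_card padic_int \<Rightarrow> 'p padic_int" where
  "padic_inverse x = (SOME y. x * y = 1)"

lemma padic_inverse: "x dvd 1 \<Longrightarrow> x * padic_inverse x = 1" "x dvd 1 \<Longrightarrow> padic_inverse x * x = 1"
proof -
  show *: "x * padic_inverse x = 1" if "x dvd 1"
    unfolding padic_inverse_def using that by (intro someI_ex[of "\<lambda>y. x * y = 1"]) (auto simp: dvd_def)
  show "padic_inverse x * x = 1" if "x dvd 1" using *[OF that] by (simp add: mult.commute)
qed

lemma two_mod_ring_nonzero:
  assumes "odd CARD('p::prime_card)" shows "(2 :: 'p mod_ring) \<noteq> 0"
proof
  assume "(2 :: 'p mod_ring) = 0"
  then have "(of_nat 2 :: 'p mod_ring) = 0" by simp
  then have "CARD('p) dvd 2" by (rule of_nat_0_mod_ring_dvd)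
  then show False using assms prime_gt_1_nat[OF prime_card[where 'a='p]]
    using dvd_imp_le[of "CARD('p)" 2] by (cases "CARD('p) = 2") auto
qed

lemma two_padic_unit: "odd CARD('p::prime_card) \<Longrightarrow> (2 :: 'p padic_int) dvd 1"
  by (simp add: padic_unit_iff_residue two_mod_ring_nonzero)

lemma padic_square_unit_iff:
  fixes x :: "'p::prime_card padic_int"
  assumes odd: "odd CARD('p)" and x: "x dvd 1"
  shows "(\<exists>u. u dvd 1 \<and> x = u ^ 2) \<longleftrightarrow> (\<exists>v. padic_residue x = v ^ 2)"
proof
  assume "\<exists>v. padic_residue x = v ^ 2"
  then obtain y where y: "padic_residue x = padic_residue y ^ 2" using padic_residue_surj by metis
  then have yu: "y dvd 1" using x by (auto simp: padic_unit_iff_residue)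
  have "\<exists>u. u ^ 2 - x = 0"
  proof (rule padic_solve_limit)
    fix n
    have "\<exists>z. ell ^ Suc n dvd z ^ 2 - x \<and> padic_residue z = padic_residue y"
    proof (induction n)
      case 0
      have "ell dvd y ^ 2 - x" using y by (simp flip: padic_residue_eq_iff)
      then show ?case by auto
    next
      case (Suc n)
      then obtain z w where z: "z ^ 2 - x = ell ^ Suc n * w" "padic_residue z = padic_residue y"
        by (auto simp: dvd_def)
      have "2 * z dvd 1" using yu z(2) two_padic_unit[OF odd] by (simp only: padic_unit_mult_iff) (simp add: padic_unit_iff_residue)
      note inv = padic_inverse(1)[OF this]
      \<comment> \<open>Newton's step: dividing w by 2 z cancels the error l^(n+1) w to first order,
        and what remains is a square of something divisible by l^(n+1).\<close>
      let ?v = "padic_inverse (2 * z) * w"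
      let ?z = "z - ell ^ Suc n * ?v"
      have "?z ^ 2 - x = ell ^ Suc n * w - ell ^ Suc n * ((2 * z * padic_inverse (2 * z)) * w) + ell ^ Suc n * ell ^ Suc n * ?v ^ 2"
        using z(1) by (simp add: power2_eq_square algebra_simps)
      then have "?z ^ 2 - x = ell ^ Suc n * ell ^ Suc n * ?v ^ 2" unfolding inv by simp
      moreover have "ell ^ Suc (Suc n) dvd ell ^ Suc n * ell ^ Suc n * ?v ^ 2"
        by (rule dvd_mult2, subst power_add[symmetric], rule le_imp_power_dvd) simp
      ultimately have "ell ^ Suc (Suc n) dvd ?z ^ 2 - x" by (simp only:)
      moreover have "padic_residue ?z = padic_residue y" using z(2) by simp
      ultimately show ?case by blast
    qed
    then obtain z where "ell ^ Suc n dvd z ^ 2 - x" by blast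
    moreover have "ell ^ n dvd ell ^ Suc n" by simp
    ultimately show "\<exists>z. ell ^ n dvd z ^ 2 - x" using dvd_trans by blast
  qed (simp add: power2_eq_square square_diff_square_factored)
  then obtain u where "x = u ^ 2" by auto
  moreover from this have "u dvd 1" using x by (simp add: power2_eq_square padic_unit_mult_iff)
  ultimately show "\<exists>u. u dvd 1 \<and> x = u ^ 2" by blast
qed (metis padic_residue_power)

text \<open>Euler's criterion: two Legendre symbols -1 multiply to 1. This is what bounds by two the
  index of the elements with square determinant.\<close>

lemma mod_ring_nonsquare_mult:
  fixes a b :: "'p::prime_card mod_ring"
  assumes odd: "odd CARD('p)" and a: "\<nexists>v. a = v ^ 2" and b: "\<nexists>v. b = v ^ 2"
  shows "\<exists>v. a * b = v ^ 2"
proof -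
  let ?p = "CARD('p)"
  have p: "prime ?p" by (rule prime_card)
  have p2: "2 < ?p" using prime_gt_1_nat[OF p] odd by (cases "?p = 2") auto
  have sq: "(\<exists>v. (of_int k :: 'p mod_ring) = v ^ 2) \<longleftrightarrow> QuadRes (int ?p) k" for k
  proof -
    have "(\<exists>v. (of_int k :: 'p mod_ring) = v ^ 2) \<longleftrightarrow> (\<exists>y. (of_int k :: 'p mod_ring) = of_int (y ^ 2))"
      by (metis of_int_power of_int_of_nat_eq surj_of_nat_mod_ring)
    also have "\<dots> \<longleftrightarrow> QuadRes (int ?p) k"
      unfolding of_int_mod_ring_eq_iff QuadRes_def cong_def by (metis power2_eq_square)
    finally show ?thesis .
  qed
  obtain m n where mn: "a = of_int m" "b = of_int n"
    by (metis of_int_of_nat_eq surj_of_nat_mod_ring)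
  have "a \<noteq> 0" "b \<noteq> 0" using a b by auto
  then have nz: "\<not> [m = 0] (mod int ?p)" "\<not> [n = 0] (mod int ?p)"
    using of_int_mod_ring_eq_iff[of m 0, where 'p='p] of_int_mod_ring_eq_iff[of n 0, where 'p='p]
    by (auto simp: mn cong_def)
  have "Legendre m ?p = -1" "Legendre n ?p = -1"
    using a b sq nz by (auto simp: Legendre_def mn)
  then have "[m ^ ((?p - 1) div 2) = -1] (mod int ?p)" "[n ^ ((?p - 1) div 2) = -1] (mod int ?p)"
    using euler_criterion[OF p p2] by (metis cong_sym)+
  from cong_mult[OF this] have "[(m * n) ^ ((?p - 1) div 2) = 1] (mod int ?p)"
    by (simp add: power_mult_distrib)
  then have "[Legendre (m * n) ?p = 1] (mod int ?p)"
    using euler_criterion[OF p p2] by (metis cong_trans)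
  moreover have "\<not> [0 = 1] (mod int ?p)" "\<not> [-1 = 1] (mod int ?p)"
    using p2 by (auto simp: cong_iff_dvd_diff dest!: zdvd_imp_le)
  ultimately have "QuadRes (int ?p) (m * n)"
    by (auto simp: Legendre_def split: if_splits)
  then show ?thesis using sq[of "m * n"] by (simp add: mn)
qed

section \<open>Two-by-two matrices\<close>

definition mat2 :: "'a \<Rightarrow> 'a \<Rightarrow> 'a \<Rightarrow> 'a::comm_ring_1 \<Rightarrow> 'a ^ 2 ^ 2" where
  "mat2 a b c d = vector [vector [a, b], vector [c, d]]"

text \<open>The adjugate: it is the inverse on matrices of determinant 1, but linear and defined
  over any commutative ring, so that identities involving inverses become polynomial identities in
  the entries.\<close>

definition adj :: "'a::comm_ring_1 ^ 2 ^ 2 \<Rightarrow> 'a ^ 2 ^ 2" where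
  "adj A = mat2 (A$2$2) (- A$1$2) (- A$2$1) (A$1$1)"

definition smul :: "'a::comm_ring_1 \<Rightarrow> 'a ^ 2 ^ 2 \<Rightarrow> 'a ^ 2 ^ 2" where
  "smul c A = mat c ** A"

definition bracket :: "'a::comm_ring_1 ^ 2 ^ 2 \<Rightarrow> 'a ^ 2 ^ 2 \<Rightarrow> 'a ^ 2 ^ 2" where
  "bracket A B = A ** B - B ** A"

text \<open>Applied to a difference this is congruence of matrices, and for powers of
  \<open>ell\<close> these congruences describe the l-adic topology.\<close>

definition mdvd :: "'a::comm_ring_1 \<Rightarrow> 'a ^ 2 ^ 2 \<Rightarrow> bool" where
  "mdvd m A \<longleftrightarrow> (\<forall>i j. m dvd A $ i $ j)"

primrec mpow :: "'a::comm_ring_1 ^ 2 ^ 2 \<Rightarrow> nat \<Rightarrow> 'a ^ 2 ^ 2" where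
  "mpow A 0 = mat 1"
| "mpow A (Suc n) = A ** mpow A n"

lemma mat2_nth [simp]:
  "mat2 a b c d $ 1 $ 1 = a" "mat2 a b c d $ 1 $ 2 = b" "mat2 a b c d $ 2 $ 1 = c" "mat2 a b c d $ 2 $ 2 = d"
  by (simp_all add: mat2_def)

lemma mat_nth [simp]:
  "(mat c :: 'a::comm_ring_1 ^ 2 ^ 2) $ 1 $ 1 = c" "(mat c :: 'a ^ 2 ^ 2) $ 1 $ 2 = 0"
  "(mat c :: 'a ^ 2 ^ 2) $ 2 $ 1 = 0" "(mat c :: 'a ^ 2 ^ 2) $ 2 $ 2 = c"
  by (simp_all add: mat_def)

lemma mult_nth: "((A :: 'a::comm_ring_1 ^ 2 ^ 2) ** B) $ i $ j = A$i$1 * B$1$j + A$i$2 * B$2$j"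
  by (simp add: matrix_matrix_mult_def sum_2)

lemma mat2_eq_iff:
  "(A :: 'a ^ 2 ^ 2) = B \<longleftrightarrow> A$1$1 = B$1$1 \<and> A$1$2 = B$1$2 \<and> A$2$1 = B$2$1 \<and> A$2$2 = B$2$2"
  by (simp add: vec_eq_iff forall_2)

lemma trace_2: "trace (A :: 'a::comm_ring_1 ^ 2 ^ 2) = A$1$1 + A$2$2"
  by (simp add: trace_def sum_2)

lemma smul_nth [simp]: "smul c A $ 1 $ j = c * A$1$j" "smul c A $ 2 $ j = c * A$2$j"
  by (simp_all add: smul_def mult_nth)

lemma adj_nth [simp]:
  "adj A $ 1 $ 1 = A$2$2" "adj A $ 1 $ 2 = - A$1$2" "adj A $ 2 $ 1 = - A$2$1" "adj A $ 2 $ 2 = A$1$1"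
  by (simp_all add: adj_def)

lemmas mat2_simps = mat2_eq_iff mult_nth trace_2 det_2 bracket_def

lemma mult_adj: "A ** adj A = mat (det A)" "adj A ** A = mat (det A)"
  by (simp_all add: mat2_simps algebra_simps)

lemma adj_mult: "adj (A ** B) = adj B ** adj A"
  by (simp add: mat2_simps algebra_simps)

lemma adj_adj [simp]: "adj (adj A) = A"
  by (simp add: mat2_simps)

lemma det_adj [simp]: "det (adj A) = det A"
  by (simp add: mat2_simps algebra_simps)

lemma trace_adj [simp]: "trace (adj A) = trace A"
  by (simp add: mat2_simps algebra_simps)

lemma det_mat_2 [simp]: "det (mat c :: 'a::comm_ring_1 ^ 2 ^ 2) = c ^ 2"
  by (simp add: mat2_simps power2_eq_square)

lemma det_smul: "det (smul c A) = c ^ 2 * det A"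
  by (simp add: mat2_simps power2_eq_square algebra_simps)

lemma trace_smul: "trace (smul c A) = c * trace A"
  by (simp add: mat2_simps algebra_simps)

lemma smul_mult: "smul c A ** B = smul c (A ** B)" "A ** smul c B = smul c (A ** B)"
  by (simp_all add: mat2_simps algebra_simps)

lemma smul_smul [simp]: "smul c (smul d A) = smul (c * d) A"
  by (simp add: mat2_simps algebra_simps)

lemma smul_1 [simp]: "smul 1 A = A"
  by (simp add: mat2_simps)

lemma trace_conj: "det P = 1 \<Longrightarrow> trace (P ** A ** adj P) = trace A"
  by (metis matrix_mul_assoc matrix_mul_lid mult_adj(2) trace_mul_sym)

lemma adj_cancel:
  assumes "det P = 1"
  shows "P ** adj P = mat 1" "adj P ** P = mat 1" "A ** P ** adj P = A" "A ** adj P ** P = A"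
    "P ** (adj P ** A) = A" "adj P ** (P ** A) = A"
  using assms mult_adj[of P] by (simp_all add: matrix_mul_assoc[symmetric]) (simp_all add: matrix_mul_assoc)

lemma minus_mult_2:
  fixes A B :: "'a::comm_ring_1 ^ 2 ^ 2" shows "- A ** B = - (A ** B)" "A ** - B = - (A ** B)"
  by (simp_all add: mat2_simps algebra_simps)

lemma trace_minus_2: "trace (- A) = - trace (A :: 'a::comm_ring_1 ^ 2 ^ 2)"
  by (simp add: mat2_simps)

lemma adj_minus: "adj (- A) = - adj (A :: 'a::comm_ring_1 ^ 2 ^ 2)"
  by (simp add: mat2_simps)

lemma adj_mat: "adj (mat c) = mat c"
  by (simp add: mat2_simps)

interpretation mat2: Modules.module "smul :: 'a::comm_ring_1 \<Rightarrow> 'a ^ 2 ^ 2 \<Rightarrow> 'a ^ 2 ^ 2"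
  by unfold_locales (simp_all add: mat2_simps algebra_simps)

lemma mdvd_2: "mdvd m A \<longleftrightarrow> m dvd A$1$1 \<and> m dvd A$1$2 \<and> m dvd A$2$1 \<and> m dvd A$2$2"
  by (auto simp: mdvd_def forall_2)

lemma mdvd_iff: "mdvd m A \<longleftrightarrow> (\<exists>B. A = smul m B)"
proof
  assume "mdvd m A"
  then obtain a b c d where "A$1$1 = m * a" "A$1$2 = m * b" "A$2$1 = m * c" "A$2$2 = m * d"
    by (auto simp: mdvd_2 dvd_def)
  then have "A = smul m (mat2 a b c d)" by (simp add: mat2_simps)
  then show "\<exists>B. A = smul m B" by blast
qed (auto simp: mdvd_2)

lemma mdvd_add: "mdvd m A \<Longrightarrow> mdvd m B \<Longrightarrow> mdvd m (A + B)"
  by (simp add: mdvd_2)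

lemma mdvd_diff: "mdvd m A \<Longrightarrow> mdvd m B \<Longrightarrow> mdvd m (A - B)"
  by (simp add: mdvd_2)

lemma mdvd_minus: "mdvd m (- A) \<longleftrightarrow> mdvd m A"
  by (simp add: mdvd_2)

lemma mdvd_minus_commute: "mdvd m (A - B) \<longleftrightarrow> mdvd m (B - A)"
  using mdvd_minus[of m "A - B"] by simp

lemma mdvd_mult: "mdvd m A \<Longrightarrow> mdvd m (A ** B)" "mdvd m B \<Longrightarrow> mdvd m (A ** B)"
  by (simp_all add: mdvd_2 mult_nth)

lemma mdvd_smul: "mdvd m A \<Longrightarrow> mdvd m (smul c A)" "m dvd c \<Longrightarrow> mdvd m (smul c A)"
  by (simp_all add: mdvd_2)

lemma mdvd_0 [simp]: "mdvd m 0"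
  by (simp add: mdvd_2)

lemma mdvd_trans: "m dvd n \<Longrightarrow> mdvd n A \<Longrightarrow> mdvd m A"
  unfolding mdvd_def by (meson dvd_trans)

lemma mdvd_cong_trans: "mdvd m (A - B) \<Longrightarrow> mdvd m (B - C) \<Longrightarrow> mdvd m (A - C)"
  using mdvd_add[of m "A - B" "B - C"] by simp

lemma mdvd_cong_mult:
  assumes "mdvd m (A - A')" "mdvd m (B - B')" shows "mdvd m (A ** B - A' ** B')"
proof -
  have "A ** B - A' ** B' = (A - A') ** B + A' ** (B - B')"
    by (simp add: mat2_simps algebra_simps)
  then show ?thesis using assms by (metis mdvd_add mdvd_mult)
qed

lemma mdvd_trace: "mdvd m A \<Longrightarrow> m dvd trace A"
  by (simp add: mdvd_2 trace_2)

subsection \<open>Powers\<close>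

lemma mpow_commute: "mpow A n ** A = A ** mpow A n"
  by (induction n) (simp_all add: matrix_mul_assoc[symmetric])

lemma mpow_add: "mpow A (m + n) = mpow A m ** mpow A n"
  by (induction m) (simp_all add: matrix_mul_assoc)

lemma mpow_mult: "mpow A (m * n) = mpow (mpow A m) n"
  by (induction n) (simp_all add: mpow_add)

lemma det_mpow: "det (mpow A n) = det A ^ n"
  by (induction n) (simp_all add: det_mul)

lemma mpow_binomial:
  "mpow (mat 1 + M) n = (\<Sum>k\<le>n. smul (of_nat (n choose k)) (mpow M k))"
proof (induction n)
  case 0
  show ?case by simp
next
  case (Suc n)
  let ?f = "\<lambda>n k. smul (of_nat (n choose k)) (mpow M k)"
  have d: "(mat 1 + M) ** A = A + M ** A" for A :: "'a ^ 2 ^ 2"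
    by (simp add: mat2_simps algebra_simps)
  have M: "M ** sum f A = (\<Sum>k\<in>A. M ** f k)" for f :: "nat \<Rightarrow> 'a ^ 2 ^ 2" and A
    by (induction A rule: infinite_finite_induct) (simp_all add: mat2_simps algebra_simps)
  have "mpow (mat 1 + M) (Suc n) = (\<Sum>k\<le>n. ?f n k) + (\<Sum>k\<le>n. smul (of_nat (n choose k)) (mpow M (Suc k)))"
    by (simp add: Suc d M smul_mult)
  also have "(\<Sum>k\<le>n. ?f n k) = (\<Sum>k\<le>Suc n. ?f n k)"
    by (simp add: binomial_eq_0)
  also have "\<dots> = mat 1 + (\<Sum>k\<le>n. ?f n (Suc k))"
    by (subst sum.atMost_Suc_shift) simp
  finally have "mpow (mat 1 + M) (Suc n)
      = mat 1 + (\<Sum>k\<le>n. ?f n (Suc k) + smul (of_nat (n choose k)) (mpow M (Suc k)))"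
    by (simp only: sum.distrib add.assoc)
  also have "\<dots> = mat 1 + (\<Sum>k\<le>n. ?f (Suc n) (Suc k))"
    by (intro arg_cong2[of _ _ _ _ "(+)"] sum.cong refl) (simp add: mat2.scale_left_distrib add.commute)
  also have "\<dots> = (\<Sum>k\<le>Suc n. ?f (Suc n) k)"
    by (subst sum.atMost_Suc_shift) simp
  finally show ?case .
qed

lemma mdvd_sum: "(\<And>k. k \<in> K \<Longrightarrow> mdvd m (f k)) \<Longrightarrow> mdvd m (sum f K)"
  by (induction K rule: infinite_finite_induct) (simp_all add: mdvd_add)

subsection \<open>Groups of matrices\<close>

definition sl2_subgroup :: "('a::comm_ring_1 ^ 2 ^ 2) set \<Rightarrow> bool" where
  "sl2_subgroup X \<longleftrightarrow> X \<subseteq> SL2 \<and> mat 1 \<in> X \<and> (\<forall>x\<in>X. \<forall>y\<in>X. x ** y \<in> X) \<and> (\<forall>x\<in>X. adj x \<in> X)"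

lemma sl2_subgroupD:
  assumes "sl2_subgroup X"
  shows "mat 1 \<in> X" "x \<in> X \<Longrightarrow> y \<in> X \<Longrightarrow> x ** y \<in> X" "x \<in> X \<Longrightarrow> adj x \<in> X" "x \<in> X \<Longrightarrow> det x = 1"
  using assms by (auto simp: sl2_subgroup_def SL2_def)

lemma sl2_subgroup_mpow: "sl2_subgroup X \<Longrightarrow> x \<in> X \<Longrightarrow> mpow x n \<in> X"
  by (induction n) (auto intro: sl2_subgroupD)

lemma sl2_subgroup_SL2: "sl2_subgroup SL2"
  by (simp add: sl2_subgroup_def SL2_def det_mul)

lemma sl2_subgroup_Int: "sl2_subgroup X \<Longrightarrow> sl2_subgroup Y \<Longrightarrow> sl2_subgroup (X \<inter> Y)"
  by (auto simp: sl2_subgroup_def)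

definition upper :: "'a::comm_ring_1 \<Rightarrow> 'a ^ 2 ^ 2" where "upper x = mat2 1 x 0 1"
definition lower :: "'a::comm_ring_1 \<Rightarrow> 'a ^ 2 ^ 2" where "lower x = mat2 1 0 x 1"

text \<open>If the lower left entry c is a unit with inverse e, then g = upper((a - 1) e) lower(c)
  upper((d - 1) e), where a and d are the diagonal entries. If a is a unit instead, a left factor
  \<open>lower z\<close> makes the lower left entry 1.\<close>

lemma elementary_generate:
  fixes X :: "('a::comm_ring_1 ^ 2 ^ 2) set"
  assumes mult: "\<And>x y. x \<in> X \<Longrightarrow> y \<in> X \<Longrightarrow> x ** y \<in> X"
    and up: "\<And>z. upper z \<in> X" and lo: "\<And>z. lower z \<in> X"
    and g: "det g = 1" and unit: "g$1$1 dvd 1 \<or> g$2$1 dvd 1"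
  shows "g \<in> X"
proof -
  have c: "g \<in> X" if g: "det g = 1" and gu: "g$2$1 dvd 1" for g
  proof -
    obtain e where e: "1 = g$2$1 * e" using gu by (auto simp: dvd_def)
    have 1: "(g$1$1 - 1) * e * g$2$1 = g$1$1 - 1" "(g$2$2 - 1) * e * g$2$1 = g$2$2 - 1"
      using e by (simp_all add: mult.assoc mult.commute[of e])
    have "(g$2$2 - 1) * e + ((g$1$1 - 1) * e) * g$2$2 = (g$1$1 * g$2$2 - 1) * e"
      by (simp add: algebra_simps)
    also have "g$1$1 * g$2$2 - 1 = g$1$2 * g$2$1" using g by (simp add: det_2 algebra_simps)
    also have "g$1$2 * g$2$1 * e = g$1$2" using e by (simp add: mult.assoc)
    finally have 2: "(g$2$2 - 1) * e + ((g$1$1 - 1) * e) * g$2$2 = g$1$2" .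
    have "g = upper ((g$1$1 - 1) * e) ** (lower (g$2$1) ** upper ((g$2$2 - 1) * e))"
      using 1 2 by (simp add: mat2_simps upper_def lower_def mult.commute[of "g$2$1"])
    then show ?thesis using mult up lo by metis
  qed
  show ?thesis
  proof (cases "g$2$1 dvd 1")
    case False
    then obtain e where e: "1 = g$1$1 * e" using unit by (auto simp: dvd_def)
    define z where "z = (1 - g$2$1) * e"
    have "z * g$1$1 = 1 - g$2$1" using e by (simp add: z_def mult.assoc mult.commute[of e])
    then have "(lower z ** g)$2$1 dvd 1" by (simp add: mult_nth lower_def)
    moreover have "det (lower z ** g) = 1" using g by (simp add: det_mul) (simp add: det_2 lower_def)
    ultimately have "lower z ** g \<in> X" using c by blast
    moreover have "g = lower (- z) ** (lower z ** g)"
      by (simp add: mat2_simps lower_def algebra_simps)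
    ultimately show ?thesis using mult lo by metis
  qed (use c g in blast)
qed

lemma invertible_2_iff: "invertible (A :: 'a::comm_ring_1 ^ 2 ^ 2) \<longleftrightarrow> det A dvd 1"
proof
  assume "invertible A"
  then obtain B where "A ** B = mat 1" by (auto simp: invertible_def)
  then have "det A * det B = 1" by (metis det_I det_mul)
  then show "det A dvd 1" by (metis dvd_triv_left)
next
  assume "det A dvd 1"
  then obtain e where e: "1 = det A * e" by (auto simp: dvd_def)
  have "A ** smul e (adj A) = mat 1" "smul e (adj A) ** A = mat 1"
    using e by (simp_all add: smul_mult mult_adj) (simp_all add: mat2_simps mult.commute)
  then show "invertible A" by (auto simp: invertible_def)
qed

lemma GL2_simps [simp]:
  "carrier GL2 = {g :: 'a::comm_ring_1 ^ 2 ^ 2. det g dvd 1}"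
  "x \<otimes>\<^bsub>GL2\<^esub> y = x ** y" "\<one>\<^bsub>GL2\<^esub> = mat 1"
  by (auto simp: GL2_def invertible_2_iff)

lemma group_GL2: "group (GL2 :: ('a::comm_ring_1 ^ 2 ^ 2) monoid)"
proof (rule groupI)
  fix x :: "'a ^ 2 ^ 2" assume "x \<in> carrier GL2"
  then have "invertible x" by (simp add: invertible_2_iff)
  then obtain y where y: "y ** x = mat 1" by (auto simp: invertible_def)
  then have "det y * det x = 1" by (metis det_I det_mul)
  then have "y \<in> carrier GL2" by (simp) (metis dvd_triv_left)
  then show "\<exists>y\<in>carrier GL2. y \<otimes>\<^bsub>GL2\<^esub> x = \<one>\<^bsub>GL2\<^esub>" using y by auto
next
  fix x y :: "'a ^ 2 ^ 2" assume "x \<in> carrier GL2" "y \<in> carrier GL2"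
  then show "x \<otimes>\<^bsub>GL2\<^esub> y \<in> carrier GL2" using mult_dvd_mono[of "det x" 1 "det y" 1] by (simp add: det_mul)
qed (simp_all add: matrix_mul_assoc)

lemma inv_GL2:
  assumes "x ** y = mat 1" shows "inv\<^bsub>GL2\<^esub> x = (y :: 'a::comm_ring_1 ^ 2 ^ 2)"
proof -
  have d: "det x * det y = 1" using assms by (metis det_I det_mul)
  have "det x dvd det x * det y" "det y dvd det x * det y" by simp_all
  then have xy: "x \<in> carrier GL2" "y \<in> carrier GL2" by (simp_all add: d)
  have "x \<otimes>\<^bsub>GL2\<^esub> y = \<one>\<^bsub>GL2\<^esub>" using assms by simp
  from group.inv_comm[OF group_GL2 this xy] show ?thesis
    by (rule group.inv_equality[OF group_GL2 _ xy])
qed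

lemma inv_GL2_SL2: "det x = 1 \<Longrightarrow> inv\<^bsub>GL2\<^esub> x = adj x"
  by (rule inv_GL2) (simp add: mult_adj)

lemma sl2_subgroup_imp_subgroup: "sl2_subgroup X \<Longrightarrow> subgroup X GL2"
  by (rule subgroup.intro) (auto simp: sl2_subgroup_def SL2_def inv_GL2_SL2)

lemma subgroup_imp_sl2_subgroup: "subgroup X GL2 \<Longrightarrow> X \<subseteq> SL2 \<Longrightarrow> sl2_subgroup X"
  using subgroup.m_closed[of X GL2] subgroup.one_closed[of X GL2] subgroup.m_inv_closed[of X GL2]
  by (simp add: sl2_subgroup_def) (metis (mono_tags, lifting) SL2_def inv_GL2_SL2 mem_Collect_eq subsetD)

subsection \<open>The topology on matrices over the \<open>\<ell>\<close>-adic integers\<close>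

lemma open_padic_ball: "open {y :: 'p::prime_card padic_int. padic_res y n = r}"
  unfolding open_padic_int_def by auto

text \<open>The topology is a product topology on vectors of vectors, so its definition is unfolded
  twice; the four levels found for the entries are combined into their sum.\<close>

lemma open_mat2_iff:
  "open (S :: ('p::prime_card padic_int ^ 2 ^ 2) set) \<longleftrightarrow>
     (\<forall>x\<in>S. \<exists>n. \<forall>y. mdvd (ell ^ n) (y - x) \<longrightarrow> y \<in> S)"
proof (intro iffI ballI)
  fix x assume S: "open S" "x \<in> S"
  have "\<exists>A. (\<forall>i. open (A i) \<and> x $ i \<in> A i) \<and> (\<forall>y. (\<forall>i. y $ i \<in> A i) \<longrightarrow> y \<in> S)"
    using S unfolding open_vec_def[of S] by (rule bspec)
  then obtain A where A': "\<forall>i. open (A i) \<and> x $ i \<in> A i" "\<forall>y. (\<forall>i. y $ i \<in> A i) \<longrightarrow> y \<in> S"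
    by (elim exE conjE)
  have A: "open (A i)" "x $ i \<in> A i" "(\<And>i. y $ i \<in> A i) \<Longrightarrow> y \<in> S" for i y
    using A' by simp_all
  have "\<forall>i. \<exists>B. (\<forall>j. open (B j) \<and> x $ i $ j \<in> B j) \<and> (\<forall>y. (\<forall>j. y $ j \<in> B j) \<longrightarrow> y \<in> A i)"
  proof
    fix i
    show "\<exists>B. (\<forall>j. open (B j) \<and> x $ i $ j \<in> B j) \<and> (\<forall>y. (\<forall>j. y $ j \<in> B j) \<longrightarrow> y \<in> A i)"
      using A(1)[of i, unfolded open_vec_def[of "A i"]] A(2)[of i] by (rule bspec)
  qed
  then obtain B where B: "\<And>i j. open (B i j)" "\<And>i j. x $ i $ j \<in> B i j"
      "\<And>i y. (\<And>j. y $ j \<in> B i j) \<Longrightarrow> y \<in> A i"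
    by metis
  have "\<exists>n. \<forall>y. padic_res y n = padic_res (x $ i $ j) n \<longrightarrow> y \<in> B i j" for i j
    using B(1,2)[of i j] unfolding open_padic_int_def by blast
  then obtain n where n: "\<And>i j y. padic_res y (n i j) = padic_res (x $ i $ j) (n i j) \<Longrightarrow> y \<in> B i j"
    by metis
  define N where "N = n 1 1 + n 1 2 + n 2 1 + n 2 2"
  have N: "n i j \<le> N" for i j
    using exhaust_2[of i] exhaust_2[of j] by (auto simp: N_def)
  show "\<exists>n. \<forall>y. mdvd (ell ^ n) (y - x) \<longrightarrow> y \<in> S"
  proof (intro exI[of _ N] allI impI)
    fix y assume y: "mdvd (ell ^ N) (y - x)"
    have "ell ^ n i j dvd (y - x) $ i $ j" for i j
      using y N[of i j] unfolding mdvd_def by (meson dvd_trans le_imp_power_dvd)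
    then have "padic_res (y $ i $ j) (n i j) = padic_res (x $ i $ j) (n i j)" for i j
      unfolding ell_pow_dvd_diff_iff[symmetric] by simp
    then have "y $ i \<in> A i" for i by (intro B(3) n)
    then show "y \<in> S" by (rule A(3))
  qed
next
  assume *: "\<forall>x\<in>S. \<exists>n. \<forall>y. mdvd (ell ^ n) (y - x) \<longrightarrow> y \<in> S"
  show "open S"
    unfolding open_vec_def[of S]
  proof
    fix x assume "x \<in> S"
    then obtain n where n: "\<And>y. mdvd (ell ^ n) (y - x) \<Longrightarrow> y \<in> S" using * by blast
    let ?A = "\<lambda>i. {v. \<forall>j. v $ j \<in> {y. padic_res y n = padic_res (x $ i $ j) n}}"
    have "open (?A i)" for i
      unfolding open_vec_def[of "?A i"]
    proof
      fix v assume "v \<in> ?A i"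
      then show "\<exists>B. (\<forall>j. open (B j) \<and> v $ j \<in> B j) \<and> (\<forall>y. (\<forall>j. y $ j \<in> B j) \<longrightarrow> y \<in> ?A i)"
        by (intro exI[of _ "\<lambda>j. {y. padic_res y n = padic_res (x $ i $ j) n}"])
           (auto simp: open_padic_ball)
    qed
    moreover have "y \<in> S" if "\<And>i. y $ i \<in> ?A i" for y
      using that by (intro n) (simp add: mdvd_def ell_pow_dvd_diff_iff)
    ultimately show "\<exists>A. (\<forall>i. open (A i) \<and> x $ i \<in> A i) \<and> (\<forall>y. (\<forall>i. y $ i \<in> A i) \<longrightarrow> y \<in> S)"
      by (intro exI[of _ ?A]) auto
  qed
qed

lemma closedin_mat2_iff:
  fixes H C :: "('p::prime_card padic_int ^ 2 ^ 2) set"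
  shows "closedin (top_of_set C) H \<longleftrightarrow>
    H \<subseteq> C \<and> (\<forall>x\<in>C. (\<forall>n. \<exists>h\<in>H. mdvd (ell ^ n) (h - x)) \<longrightarrow> x \<in> H)"
proof (intro iffI conjI ballI impI)
  assume "closedin (top_of_set C) H"
  then obtain T where T: "closed T" "H = C \<inter> T" by (auto simp: closedin_closed)
  then show "H \<subseteq> C" by blast
  fix x assume x: "x \<in> C" "\<forall>n. \<exists>h\<in>H. mdvd (ell ^ n) (h - x)"
  have "x \<in> T"
  proof (rule ccontr)
    assume "x \<notin> T"
    then obtain n where "\<And>y. mdvd (ell ^ n) (y - x) \<Longrightarrow> y \<notin> T"
      using T(1) unfolding closed_def open_mat2_iff by auto
    then show False using x(2) T(2) by blast
  qed
  then show "x \<in> H" using x T by blast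
next
  assume *: "H \<subseteq> C \<and> (\<forall>x\<in>C. (\<forall>n. \<exists>h\<in>H. mdvd (ell ^ n) (h - x)) \<longrightarrow> x \<in> H)"
  let ?T = "{x. \<forall>n. \<exists>h\<in>H. mdvd (ell ^ n) (h - x)}"
  have "closed ?T" unfolding closed_def open_mat2_iff
  proof
    fix x assume "x \<in> - ?T"
    then obtain n where n: "\<And>h. h \<in> H \<Longrightarrow> \<not> mdvd (ell ^ n) (h - x)" by blast
    have "y \<in> - ?T" if "mdvd (ell ^ n) (y - x)" for y
      using n mdvd_cong_trans[OF _ that] by blast
    then show "\<exists>n. \<forall>y. mdvd (ell ^ n) (y - x) \<longrightarrow> y \<in> - ?T" by blast
  qed
  moreover have "h \<in> ?T" if "h \<in> H" for h using that by (auto intro!: bexI[of _ h])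
  then have "H = C \<inter> ?T" using * by blast
  ultimately show "closedin (top_of_set C) H" unfolding closedin_closed by blast
qed

section \<open>Commutators in pro-\<open>\<ell>\<close> subgroups of \<open>SL\<^sub>2\<close>\<close>

text \<open>On determinant 1 this is x - x^(-1); in general it equals 2 x - tr(x), twice the
  trace-free part \<open>Theta\<close>, and needs no division by 2.\<close>

definition Phi :: "'a::comm_ring_1 ^ 2 ^ 2 \<Rightarrow> 'a ^ 2 ^ 2" where
  "Phi x = x - adj x"

lemma mult_distrib_2:
  fixes A B C :: "'a::comm_ring_1 ^ 2 ^ 2"
  shows "A ** (B - C) = A ** B - A ** C" "(A - B) ** C = A ** C - B ** C"
    "A ** (B + C) = A ** B + A ** C" "(A + B) ** C = A ** C + B ** C"
  by (simp_all add: mat2_simps algebra_simps)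

text \<open>Expand 4 x y using 2 x = tr(x) + Phi x and likewise for y. The failure of
  \<open>Phi\<close> to be additive on products is thus a bracket together with multiples by tr - 2,
  both of which go deeper in the filtration used below.\<close>

lemma Phi_mult: "smul 4 (Phi (x ** y)) = smul (2 * trace x) (Phi y) + smul (2 * trace y) (Phi x) + bracket (Phi x) (Phi y)"
  by (simp add: mat2_simps Phi_def algebra_simps)

lemma trace_mult_Phi: "4 * trace (x ** y) = 2 * trace x * trace y + trace (Phi x ** Phi y)"
  by (simp add: mat2_simps Phi_def algebra_simps)

text \<open>Recovers the trace from the trace-free part: once the trace is 2 modulo an odd l, the
  factor trace + 2 is a unit, and trace - 2 is as small as the right side.\<close>

lemma trace_Phi_square: "det x = 1 \<Longrightarrow> 2 * (trace x + 2) * (trace x - 2) = trace (Phi x ** Phi x)"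
proof -
  assume "det x = 1"
  then have "8 * (x$1$1 * x$2$2 - x$1$2 * x$2$1) = 8" by (simp add: det_2)
  then show ?thesis by (simp add: mat2_simps Phi_def algebra_simps)
qed

lemma bracket_Phi: "bracket (Phi x) (Phi y) = smul 2 (Phi (x ** y) - Phi (y ** x))"
  by (simp add: mat2_simps Phi_def algebra_simps)

lemma Phi_adj: "Phi (adj x) = - Phi x"
  by (simp add: Phi_def)

lemma trace_Phi [simp]: "trace (Phi x) = 0"
  by (simp add: mat2_simps Phi_def algebra_simps)

lemma Phi_1 [simp]: "Phi (mat 1) = 0"
  by (simp add: mat2_simps Phi_def algebra_simps)

lemma Phi_smul: "Phi (smul c x) = smul c (Phi x)"
  by (simp add: mat2_simps Phi_def algebra_simps)

lemma mdvd_Phi: "mdvd m A \<Longrightarrow> mdvd m (Phi A)"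
  by (simp add: mdvd_2 Phi_def)

lemma Phi_diff: "Phi (x - y) = Phi x - Phi y"
  by (simp add: mat2_simps Phi_def)

lemma Phi_conj: "det P = 1 \<Longrightarrow> Phi (P ** x ** adj P) = P ** Phi x ** adj P"
  by (simp add: Phi_def adj_mult matrix_mul_assoc mult_distrib_2)

lemma trace_bracket [simp]: "trace (bracket x y) = 0"
  by (simp add: mat2_simps algebra_simps)

lemma bracket_linear:
  "bracket (x + y) z = bracket x z + bracket y z" "bracket x (y + z) = bracket x y + bracket x z"
  "bracket (smul c x) z = smul c (bracket x z)" "bracket x (smul c z) = smul c (bracket x z)"
  "bracket 0 z = 0" "bracket z 0 = 0"
  "bracket (x - y) z = bracket x z - bracket y z" "bracket x (y - z) = bracket x y - bracket x z"
  by (simp_all add: mat2_simps algebra_simps)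

lemma bracket_swap: "bracket x y = - bracket y x"
  by (simp add: bracket_def)

lemma bracket_self [simp]: "bracket x x = 0"
  by (simp add: bracket_def)

lemma trace_0_nth: "trace (X :: 'a::comm_ring_1 ^ 2 ^ 2) = 0 \<Longrightarrow> X$2$2 = - X$1$1"
  by (simp add: trace_2 eq_neg_iff_add_eq_0 add.commute)

text \<open>The vector triple product of three-dimensional geometry, with the bracket as cross
  product and the trace form as scalar product.\<close>

lemma double_bracket:
  assumes "trace X = 0" "trace Y = 0" "trace Z = 0"
  shows "bracket X (bracket Y Z) = smul (2 * trace (X ** Y)) Z - smul (2 * trace (X ** Z)) Y"
  using assms[THEN trace_0_nth] by (simp add: mat2_simps algebra_simps)

text \<open>
  Modulo triple brackets, \<open>tr(XY)[P,Q]\<close> is invariant under \<open>Y \<leftrightarrow> P\<close> and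
  \<open>Y \<leftrightarrow> Q\<close>, hence under \<open>P \<leftrightarrow> Q\<close>, while it is also antisymmetric in \<open>P, Q\<close>.
\<close>

lemma trace_mult_bracket:
  assumes "trace X = 0" "trace Y = 0" "trace P = 0" "trace Q = 0"
  shows "smul (4 * trace (X ** Y)) (bracket P Q) =
    bracket (bracket X (bracket Y P)) Q - bracket (bracket X (bracket P Q)) Y - bracket (bracket X (bracket Y Q)) P"
  using assms[THEN trace_0_nth] by (simp add: mat2_simps algebra_simps)

text \<open>With w = x^(-1) z^(-1) one has z x w = 1, so Phi (x z w) = Phi ((x z - z x) w), and x z
  - z x is a quarter of the bracket of Phi x and Phi z. When tr(w) is close to 2, a group commutator
  is therefore half the Lie bracket up to higher terms.\<close>

lemma Phi_commutator:
  assumes "det x = 1" "det z = 1"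
  shows "smul 8 (Phi (x ** z ** adj x ** adj z)) = smul (2 * trace (adj x ** adj z)) (bracket (Phi x) (Phi z))
    + bracket (bracket (Phi x) (Phi z)) (Phi (adj x ** adj z))"
proof -
  define w where "w = adj x ** adj z"
  have zw: "z ** x ** w = mat 1"
    using assms by (simp add: w_def adj_cancel matrix_mul_assoc)
  have b: "bracket (Phi x) (Phi z) = smul 4 (x ** z - z ** x)"
    by (simp add: mat2_simps Phi_def algebra_simps)
  have "smul 4 (Phi (x ** z ** w)) = smul 4 (Phi ((x ** z - z ** x) ** w))"
    by (simp add: mult_distrib_2 Phi_diff zw)
  also have "\<dots> = Phi (bracket (Phi x) (Phi z) ** w)" unfolding b by (simp add: smul_mult Phi_smul)
  finally have "smul 2 (smul 4 (Phi (x ** z ** w))) = smul 2 (Phi (bracket (Phi x) (Phi z) ** w))" by simp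
  then have 1: "smul 8 (Phi (x ** z ** w)) = smul 2 (Phi (bracket (Phi x) (Phi z) ** w))" by simp
  have "smul 2 (Phi (Z ** w)) = smul (2 * trace w) Z + bracket Z (Phi w)" if "trace Z = 0" for Z
    using trace_0_nth[OF that] by (simp add: mat2_simps Phi_def algebra_simps)
  from this[of "bracket (Phi x) (Phi z)"] 1 show ?thesis by (simp add: w_def matrix_mul_assoc)
qed

section \<open>Submodules, spans of brackets, and isotropic pairs of trace-free matrices\<close>

lemma dvd_unit_cancel:
  fixes c :: "'a::comm_ring_1" assumes "c dvd 1" "m dvd c * x" shows "m dvd x"
proof -
  obtain e where "1 = c * e" using assms(1) by (auto simp: dvd_def)
  then have "x = (c * x) * e" by (metis mult.assoc mult.commute mult_1)
  then show ?thesis using assms(2) dvd_mult2 by metis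
qed

lemma subspace_unit_smul:
  assumes "mat2.subspace M" "c dvd 1" "smul c v \<in> M" shows "v \<in> M"
proof -
  obtain e where "1 = c * e" using assms(2) by (auto simp: dvd_def)
  then have "v = smul e (smul c v)" by (simp add: mult.commute)
  then show ?thesis using assms(1,3) mat2.subspace_scale by metis
qed

lemma subspace_smul_vimage: "mat2.subspace M \<Longrightarrow> mat2.subspace {v. smul c v \<in> M}"
  unfolding mat2.subspace_def
  by (simp add: mat2.scale_right_distrib) (metis smul_smul mult.commute)

lemma span_bracket:
  assumes "x \<in> mat2.span S" "y \<in> mat2.span T" "mat2.subspace M"
    and "\<And>s t. s \<in> S \<Longrightarrow> t \<in> T \<Longrightarrow> bracket s t \<in> M"
  shows "bracket x y \<in> M"
proof -
  have 1: "bracket s y \<in> M" if "s \<in> S" for s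
    using assms(2)
  proof (induction rule: mat2.span_induct)
    show "mat2.subspace {y. bracket s y \<in> M}"
      using assms(3) by (auto simp: mat2.subspace_def bracket_linear)
  qed (use assms(4) that in auto)
  from assms(1) show ?thesis
  proof (induction rule: mat2.span_induct)
    show "mat2.subspace {x. bracket x y \<in> M}"
      using assms(3) by (auto simp: mat2.subspace_def bracket_linear)
  qed (use 1 in auto)
qed

lemma subspace_trace_0: "mat2.subspace {x. trace x = 0}"
  by (auto simp: mat2.subspace_def trace_2 algebra_simps simp flip: distrib_left)

lemma trace_span:
  assumes "x \<in> mat2.span S" "\<And>s. s \<in> S \<Longrightarrow> trace s = 0" shows "trace x = 0"
  using mat2.span_minimal[of S "{x. trace x = 0}"] subspace_trace_0 assms by blast

lemma subspace_mdvd: "mat2.subspace {x. mdvd m x}"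
  by (auto simp: mat2.subspace_def mdvd_add mdvd_smul)

text \<open>The entries a, b, c and d, e, f belong to two trace-free matrices that are isotropic and
  orthogonal for the trace form; the conclusion is that they commute. The square of each difference
  is a combination of the hypotheses, which avoids distinguishing which entries vanish.\<close>

lemma isotropic_commute:
  fixes a b c :: "'a::field"
  assumes "a * a + b * c = 0" "d * d + e * f = 0" "2 * a * d + b * f + c * e = 0"
  shows "b * f = c * e" "a * e = b * d" "a * f = c * d"
proof -
  have "(b * f - c * e) ^ 2 = (2 * a * d + b * f + c * e) * (b * f + c * e - 2 * a * d)
      + 4 * (a * a * (d * d + e * f) - e * f * (a * a + b * c))"
    by (simp add: power2_eq_square algebra_simps)
  then show "b * f = c * e" unfolding assms by simp
  have "(a * e - b * d) ^ 2 = e * e * (a * a + b * c) + b * b * (d * d + e * f) - b * e * (2 * a * d + b * f + c * e)"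
    by (simp add: power2_eq_square algebra_simps)
  then show "a * e = b * d" unfolding assms by simp
  have "(a * f - c * d) ^ 2 = f * f * (a * a + b * c) + c * c * (d * d + e * f) - c * f * (2 * a * d + b * f + c * e)"
    by (simp add: power2_eq_square algebra_simps)
  then show "a * f = c * d" unfolding assms by simp
qed

text \<open>Applied to the unipotent part U of X as N, to the intersection of U with G' as D, and to
  t = 2s. As determinants are 1, \<open>unip\<close> expresses unipotence modulo l through the
  trace; all elements of D that the argument produces come from \<open>comm\<close>.\<close>

locale pro_l_span =
  fixes N D :: "('p::prime_card padic_int ^ 2 ^ 2) set" and t :: nat
  assumes odd: "odd CARD('p)" and N: "sl2_subgroup N" and D: "sl2_subgroup D" and DN: "D \<subseteq> N"
    and comm: "\<And>x y. x \<in> N \<Longrightarrow> y \<in> N \<Longrightarrow> x ** y ** adj x ** adj y \<in> D"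
    and unip: "\<And>x. x \<in> N \<Longrightarrow> ell dvd trace x - 2"
    and big: "\<And>A. trace A = 0 \<Longrightarrow> smul (ell ^ t) A \<in> mat2.span (Phi ` N)"
begin

section \<open>The lower central filtration of the span, and its approximation by
  commutators\<close>

abbreviation L where "L \<equiv> mat2.span (Phi ` N)"

primrec M where
  "M 0 = L"
| "M (Suc n) = mat2.span {bracket x y |x y. x \<in> L \<and> y \<in> M n}"

lemma two_unit: "(2 :: 'p padic_int) dvd 1"
  by (rule two_padic_unit[OF odd])

lemma four_unit: "(4 :: 'p padic_int) dvd 1"
  using padic_unit_mult_iff[of "2 :: 'p padic_int" 2] two_unit by simp

lemma subspace_M: "mat2.subspace (M n)"
  by (cases n) simp_all

lemmas M_add = mat2.subspace_add[OF subspace_M]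
lemmas M_diff = mat2.subspace_diff[OF subspace_M]
lemmas M_smul = mat2.subspace_scale[OF subspace_M]
lemmas M_neg = mat2.subspace_neg[OF subspace_M]

lemma trace_L: "x \<in> L \<Longrightarrow> trace x = 0"
  by (rule trace_span[of x "Phi ` N"]) auto

lemma Phi_L: "x \<in> N \<Longrightarrow> Phi x \<in> L"
  by (simp add: mat2.span_base)

lemma bracket_M: "x \<in> L \<Longrightarrow> y \<in> M n \<Longrightarrow> bracket x y \<in> M (Suc n)"
  by (auto intro!: mat2.span_base)

lemma bracket_L: "x \<in> L \<Longrightarrow> y \<in> L \<Longrightarrow> bracket x y \<in> L"
proof (erule (1) span_bracket)
  fix s t assume "s \<in> Phi ` N" "t \<in> Phi ` N"
  then obtain x y where "s = Phi x" "t = Phi y" "x \<in> N" "y \<in> N" by blast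
  then show "bracket s t \<in> L"
    by (auto simp: bracket_Phi intro!: mat2.span_scale mat2.span_diff Phi_L sl2_subgroupD[OF N])
qed simp

lemma M_Suc_subset: "M (Suc n) \<subseteq> M n"
proof (induction n)
  case 0
  have "{bracket x y |x y. x \<in> L \<and> y \<in> L} \<subseteq> L" using bracket_L by blast
  then show ?case using mat2.span_minimal[OF _ mat2.subspace_span] by simp
next
  case (Suc n)
  then have "{bracket x y |x y. x \<in> L \<and> y \<in> M (Suc n)} \<subseteq> {bracket x y |x y. x \<in> L \<and> y \<in> M n}"
    by blast
  from mat2.span_mono[OF this] show ?case by (simp only: M.simps)
qed

lemma M_subset_L: "M n \<subseteq> L"
  by (induction n) (use M_Suc_subset in auto)

lemma M_sub: "x \<in> M n \<Longrightarrow> x \<in> L"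
  using M_subset_L by blast

lemma M_Suc: "x \<in> M (Suc n) \<Longrightarrow> x \<in> M n"
  using M_Suc_subset by blast

lemma bracket_M': "x \<in> L \<Longrightarrow> y \<in> M n \<Longrightarrow> bracket y x \<in> M (Suc n)"
  by (subst bracket_swap) (intro M_neg bracket_M)

text \<open>Since u, v and u v all have trace 2 modulo l, the identity for tr(Phi u Phi v) gives 4 *
  2 - 2 * 2 * 2 = 0 modulo l, and bilinearity extends this to the span. So L is totally isotropic
  modulo l for the trace form.\<close>

lemma trace_mult_L: assumes "x \<in> L" "y \<in> L" shows "ell dvd trace (x ** y)"
proof -
  have 1: "ell dvd trace (Phi u ** Phi v)" if "u \<in> N" "v \<in> N" for u v
  proof -
    have "trace (Phi u ** Phi v) = 4 * (trace (u ** v) - 2) - 2 * (trace u - 2) * trace v - 4 * (trace v - 2)"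
      using trace_mult_Phi[of u v] by (simp add: algebra_simps)
    moreover have "ell dvd trace (u ** v) - 2" "ell dvd trace u - 2" "ell dvd trace v - 2"
      using that by (auto intro!: unip sl2_subgroupD(2)[OF N])
    then obtain a b c where "trace (u ** v) - 2 = ell * a" "trace u - 2 = ell * b" "trace v - 2 = ell * c"
      by (elim dvdE)
    ultimately have "trace (Phi u ** Phi v) = ell * (4 * a - 2 * b * trace v - 4 * c)"
      by (simp add: algebra_simps)
    then show ?thesis by simp
  qed
  have 2: "ell dvd trace (s ** y)" if "s \<in> Phi ` N" for s
    using assms(2)
  proof (induction rule: mat2.span_induct)
    show "mat2.subspace {y. ell dvd trace (s ** y)}"
      by (auto simp: mat2.subspace_def smul_mult trace_smul mult_distrib_2 trace_add trace_0[simplified])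
  qed (use 1 that in auto)
  from assms(1) show ?thesis
  proof (induction rule: mat2.span_induct)
    show "mat2.subspace {x. ell dvd trace (x ** y)}"
      by (auto simp: mat2.subspace_def smul_mult trace_smul mult_distrib_2 trace_add trace_0[simplified])
  qed (use 2 in auto)
qed

text \<open>The triple product identity alone would leave a multiple of X. Instead
  \<open>trace_mult_bracket\<close> with Y = X writes a multiple of tr(X X) [P, Q] as a sum of
  triple brackets; deeper in the filtration the scalar is carried through the outer bracket by
  linearity.\<close>

lemma trace_square_smul_M:
  assumes "X \<in> L" "Z \<in> M (Suc n)" shows "smul (trace (X ** X)) Z \<in> M (Suc (Suc n))"
  using assms(2)
proof (induction n arbitrary: Z)
  case 0
  have "bracket P Q \<in> {Z. smul (trace (X ** X)) Z \<in> M (Suc (Suc 0))}" if "P \<in> L" "Q \<in> L" for P Q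
  proof -
    have "smul 4 (smul (trace (X ** X)) (bracket P Q)) \<in> M (Suc (Suc 0))"
      unfolding smul_smul trace_mult_bracket[OF trace_L[OF assms(1)] trace_L[OF assms(1)] trace_L[OF that(1)] trace_L[OF that(2)]]
      using assms(1) that by (intro M_diff bracket_M' bracket_M) (simp_all only: M.simps(1) bracket_L)
    then show ?thesis using subspace_unit_smul[OF subspace_M four_unit] by blast
  qed
  then have "{bracket x y |x y. x \<in> L \<and> y \<in> M 0} \<subseteq> {Z. smul (trace (X ** X)) Z \<in> M (Suc (Suc 0))}"
    by auto
  moreover have "mat2.subspace {Z. smul (trace (X ** X)) Z \<in> M (Suc (Suc 0))}"
    by (rule subspace_smul_vimage[OF subspace_M])
  ultimately show ?case using 0 mat2.span_minimal M.simps(2)[of 0] by blast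
next
  case (Suc n)
  have "bracket P Q \<in> {Z. smul (trace (X ** X)) Z \<in> M (Suc (Suc (Suc n)))}" if "P \<in> L" "Q \<in> M (Suc n)" for P Q
    using Suc.IH[OF that(2)] bracket_M[OF that(1), of "smul (trace (X ** X)) Q"] by (simp add: bracket_linear del: M.simps)
  then have "{bracket x y |x y. x \<in> L \<and> y \<in> M (Suc n)} \<subseteq> {Z. smul (trace (X ** X)) Z \<in> M (Suc (Suc (Suc n)))}"
    by blast
  moreover have "mat2.subspace {Z. smul (trace (X ** X)) Z \<in> M (Suc (Suc (Suc n)))}"
    by (rule subspace_smul_vimage[OF subspace_M])
  ultimately show ?case using Suc.prems mat2.span_minimal M.simps(2)[of "Suc n"] by blast
qed

lemma trace_unit:
  assumes "ell dvd trace w - (2 :: 'p padic_int)" shows "2 * (trace w + 2) dvd 1"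
proof -
  have "\<not> ell dvd trace w + 2"
    using dvd_diff[of ell "trace w + 2" "trace w - 2"] assms four_unit by (auto simp: padic_unit_iff)
  then have "trace w + 2 dvd 1" by (simp add: padic_unit_iff)
  then show ?thesis using two_unit by (simp only: padic_unit_mult_iff)
qed

text \<open>Up to the unit 2 (tr(w) + 2) the factor tr(w) - 2 is tr(Phi w Phi w). This makes the
  trace terms in the product and commutator formulas negligible at the next level.\<close>

lemma trace_smul_M:
  assumes "det w = 1" "Phi w \<in> L" "ell dvd trace w - 2" "Z \<in> M (Suc n)"
  shows "smul (trace w - 2) Z \<in> M (Suc (Suc n))"
proof -
  have "smul (2 * (trace w + 2)) (smul (trace w - 2) Z) \<in> M (Suc (Suc n))"
    unfolding smul_smul trace_Phi_square[OF assms(1)] by (rule trace_square_smul_M) fact+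
  then show ?thesis using subspace_unit_smul[OF subspace_M] trace_unit[OF assms(3)] by blast
qed

text \<open>Modulo l the elements X and Z are isotropic and orthogonal for the trace form, so
  \<open>isotropic_commute\<close> applies to their residues.\<close>

lemma bracket_L_mdvd: assumes "X \<in> L" "Z \<in> L" shows "mdvd ell (bracket X Z)"
proof -
  define r where "r = (padic_residue :: 'p padic_int \<Rightarrow> _)"
  have r: "r (x + y) = r x + r y" "r (x * y) = r x * r y" "r (- x) = - r x" "r 2 = 2" for x y
    by (simp_all add: r_def)
  have r0: "r x = 0 \<longleftrightarrow> ell dvd x" for x by (simp add: r_def padic_residue_eq_0_iff)
  have nz: "(2 :: 'p mod_ring) \<noteq> 0" by (rule two_mod_ring_nonzero[OF odd])
  let ?a = "r (X$1$1)" and ?b = "r (X$1$2)" and ?c = "r (X$2$1)"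
  let ?d = "r (Z$1$1)" and ?e = "r (Z$1$2)" and ?f = "r (Z$2$1)"
  have X: "X$2$2 = - X$1$1" "Z$2$2 = - Z$1$1" using assms trace_L trace_0_nth by blast+
  have *: "r (trace (X ** X)) = 0" "r (trace (Z ** Z)) = 0" "r (trace (X ** Z)) = 0"
    using trace_mult_L assms r0 by blast+
  have "2 * (?a * ?a + ?b * ?c) = 0" "2 * (?d * ?d + ?e * ?f) = 0" and 3: "2 * ?a * ?d + ?b * ?f + ?c * ?e = 0"
    using * by (simp_all add: trace_2 mult_nth X r algebra_simps)
  then have "?a * ?a + ?b * ?c = 0" "?d * ?d + ?e * ?f = 0" using nz by (metis mult_eq_0_iff)+
  note isotropic_commute[OF this 3]
  then have "r (bracket X Z $ i $ j) = 0" for i j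
    using exhaust_2[of i] exhaust_2[of j]
    by (auto simp: bracket_def mult_nth X r r_def algebra_simps)
  then show ?thesis by (simp add: mdvd_def r0)
qed

text \<open>Write W = l^k W' and expand [Y, [Z, W']] by the triple product: one coefficient is a
  multiple of tr(Y Z), divisible by l, and the other term becomes a multiple of [X, Z], again
  divisible by l. Three brackets thus gain one factor l although W' itself need not lie in
  L.\<close>

lemma M_mdvd_step:
  assumes "\<And>W. W \<in> M n \<Longrightarrow> mdvd (ell ^ k) W" and "V \<in> M (Suc (Suc (Suc n)))"
  shows "mdvd (ell ^ Suc k) V"
proof -
  note sp = mat2.span_minimal[THEN subsetD]
  have 1: "mdvd (ell ^ Suc k) (bracket X (bracket Y V))" if XY: "X \<in> L" "Y \<in> L" and V: "V \<in> M (Suc n)" for X Y V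
  proof -
    have "V \<in> {V. mdvd (ell ^ Suc k) (bracket X (bracket Y V))}"
    proof (rule sp[OF _ _ V[unfolded M.simps]])
      show "mat2.subspace {V. mdvd (ell ^ Suc k) (bracket X (bracket Y V))}"
        by (auto simp: mat2.subspace_def bracket_linear mdvd_add mdvd_smul)
      show "{bracket x y |x y. x \<in> L \<and> y \<in> M n} \<subseteq> {V. mdvd (ell ^ Suc k) (bracket X (bracket Y V))}"
      proof clarify
        fix Z W assume Z: "Z \<in> L" and W: "W \<in> M n"
        obtain W' where W': "W = smul (ell ^ k) W'" using assms(1)[OF W] unfolding mdvd_iff by blast
        have "ell ^ k * trace W' = 0" using trace_L[OF M_sub[OF W]] by (simp add: W' trace_smul)
        then have tW: "trace W' = 0" by (rule ell_cancel)
        have "bracket X (bracket Y (bracket Z W')) =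
            smul (trace (Y ** Z)) (bracket X (smul 2 W')) - smul (2 * trace (Y ** W')) (bracket X Z)"
          unfolding double_bracket[OF trace_L[OF XY(2)] trace_L[OF Z] tW]
          by (simp add: bracket_linear mult.commute)
        moreover have "mdvd ell \<dots>"
          by (intro mdvd_diff mdvd_smul(1)[of ell "bracket X Z"] mdvd_smul(2) trace_mult_L bracket_L_mdvd XY Z)
        ultimately obtain B where "bracket X (bracket Y (bracket Z W')) = smul ell B" by (auto simp: mdvd_iff)
        then have "bracket X (bracket Y (bracket Z W)) = smul (ell ^ Suc k) B"
          by (simp add: W' bracket_linear mult.commute)
        then show "mdvd (ell ^ Suc k) (bracket X (bracket Y (bracket Z W)))" unfolding mdvd_iff by blast
      qed
    qed
    then show ?thesis by blast
  qed
  have 2: "mdvd (ell ^ Suc k) (bracket X V)" if X: "X \<in> L" and V: "V \<in> M (Suc (Suc n))" for X V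
  proof -
    have "V \<in> {V. mdvd (ell ^ Suc k) (bracket X V)}"
    proof (rule sp[OF _ _ V[unfolded M.simps(2)[of "Suc n"]]])
      show "mat2.subspace {V. mdvd (ell ^ Suc k) (bracket X V)}"
        by (auto simp: mat2.subspace_def bracket_linear mdvd_add mdvd_smul)
    qed (use 1 X in blast)
    then show ?thesis by blast
  qed
  have "V \<in> {V. mdvd (ell ^ Suc k) V}"
    by (rule sp[OF _ subspace_mdvd assms(2)[unfolded M.simps(2)[of "Suc (Suc n)"]]]) (use 2 in blast)
  then show ?thesis by blast
qed

lemma M_mdvd: "\<exists>n. \<forall>V\<in>M (Suc n). mdvd (ell ^ k) V"
proof (induction k)
  case (Suc k)
  then obtain n where "\<forall>V\<in>M (Suc n). mdvd (ell ^ k) V" by blast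
  then have "\<forall>V\<in>M (Suc (Suc (Suc (Suc n)))). mdvd (ell ^ Suc k) V"
    using M_mdvd_step by blast
  then show ?case by blast
qed (simp add: mdvd_2)

text \<open>Brackets of H, E and F span sl_2 because 2 is a unit, and every further bracket with L
  costs another factor l^t.\<close>

lemma M_big: "trace A = 0 \<Longrightarrow> smul (ell ^ (Suc n * t)) A \<in> M n"
proof (induction n arbitrary: A)
  case 0
  then show ?case using big by simp
next
  case (Suc n)
  define H E F where "H = (mat2 1 0 0 (-1) :: 'p padic_int ^ 2 ^ 2)" and "E = (mat2 0 1 0 0 :: 'p padic_int ^ 2 ^ 2)"
    and "F = (mat2 0 0 1 0 :: 'p padic_int ^ 2 ^ 2)"
  let ?u = "ell ^ t" and ?v = "ell ^ (Suc n * t)"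
  have tr: "trace H = 0" "trace E = 0" "trace F = 0" by (simp_all add: H_def E_def F_def trace_2)
  have "smul 2 (smul (ell ^ (Suc (Suc n) * t)) A) =
      smul (2 * A$1$1) (bracket (smul ?u E) (smul ?v F)) + smul (A$1$2) (bracket (smul ?u H) (smul ?v E))
      - smul (A$2$1) (bracket (smul ?u H) (smul ?v F))"
    using trace_0_nth[OF Suc.prems]
    by (simp add: mat2_simps H_def E_def F_def algebra_simps power_add)
  also have "\<dots> \<in> M (Suc n)"
    by (intro M_add M_diff M_smul bracket_M big Suc.IH tr)
  finally show ?case by (rule subspace_unit_smul[OF subspace_M two_unit])
qed

text \<open>The part of M (n + 1) that is realised by elements of D modulo M (n + 2); the aim is to
  show that it is everything.\<close>

definition A where "A n = {v \<in> M (Suc n). \<exists>d\<in>D. Phi d - v \<in> M (Suc (Suc n))}"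

lemma Phi_mult_M:
  assumes "det x = 1" "det y = 1" "ell dvd trace x - 2" "ell dvd trace y - 2" "Phi x \<in> M (Suc n)" "Phi y \<in> M (Suc n)"
  shows "Phi (x ** y) - (Phi x + Phi y) \<in> M (Suc (Suc n))"
proof -
  have "smul 4 (Phi (x ** y) - (Phi x + Phi y)) =
      smul 2 (smul (trace x - 2) (Phi y)) + smul 2 (smul (trace y - 2) (Phi x)) + bracket (Phi x) (Phi y)"
    unfolding mat2.scale_right_diff_distrib Phi_mult by (simp add: mat2_simps algebra_simps)
  also have "\<dots> \<in> M (Suc (Suc n))"
    by (intro M_add M_smul trace_smul_M bracket_M assms M_sub[OF assms(5)] M_sub[OF assms(6)])
  finally show ?thesis by (rule subspace_unit_smul[OF subspace_M four_unit])
qed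

lemma M_Suc_subset_A: "v \<in> M (Suc (Suc n)) \<Longrightarrow> v \<in> A n"
  unfolding A_def using M_Suc[of v "Suc n"] M_neg[of v "Suc (Suc n)"] sl2_subgroupD(1)[OF D]
  by (auto simp del: M.simps intro!: bexI[of _ "mat 1"])

lemma A_add: assumes "v \<in> A n" "v' \<in> A n" shows "v + v' \<in> A n"
proof -
  obtain d d' where d: "d \<in> D" "d' \<in> D" "Phi d - v \<in> M (Suc (Suc n))" "Phi d' - v' \<in> M (Suc (Suc n))"
      and v: "v \<in> M (Suc n)" "v' \<in> M (Suc n)"
    using assms unfolding A_def by blast
  have "(Phi d - v) + v \<in> M (Suc n)" "(Phi d' - v') + v' \<in> M (Suc n)"
    using M_add[OF M_Suc[OF d(3)] v(1)] M_add[OF M_Suc[OF d(4)] v(2)] .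
  then have "Phi (d ** d') - (Phi d + Phi d') \<in> M (Suc (Suc n))"
    using d DN by (intro Phi_mult_M unip sl2_subgroupD(4)[OF D]) auto
  from M_add[OF this M_add[OF d(3,4)]] have "Phi (d ** d') - (v + v') \<in> M (Suc (Suc n))"
    by (simp add: algebra_simps del: M.simps)
  then show ?thesis unfolding A_def using M_add[OF v] sl2_subgroupD(2)[OF D d(1,2)] by blast
qed

lemma A_smul_nat: "v \<in> A n \<Longrightarrow> smul (of_nat k) v \<in> A n"
proof (induction k)
  case 0
  show ?case using M_Suc_subset_A[OF mat2.subspace_0[OF subspace_M]] by simp
next
  case (Suc k)
  then show ?case using A_add[of v n "smul (of_nat k) v"] by (simp add: mat2.scale_left_distrib)
qed

text \<open>Products in D only yield natural multiples. So c is replaced by a natural number, and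
  the error lands in the next level because \<open>M_big\<close> puts l^((n + 3) t) sl_2 into M (n +
  2).\<close>

lemma A_smul: assumes "v \<in> A n" shows "smul c v \<in> A n"
proof -
  let ?k = "Suc (Suc (Suc n)) * t"
  obtain k e where "c - of_nat k = ell ^ ?k * e" using padic_approx_nat[of ?k c] by (auto simp: dvd_def)
  then have "c = of_nat k + e * ell ^ ?k" by (simp add: algebra_simps)
  then have c: "smul c v = smul (of_nat k) v + smul e (smul (ell ^ ?k) v)"
    by (simp add: mat2.scale_left_distrib)
  have "trace v = 0" using assms trace_L M_sub unfolding A_def by blast
  then have "smul e (smul (ell ^ ?k) v) \<in> M (Suc (Suc n))" by (intro M_smul M_big)
  then show ?thesis unfolding c by (intro A_add A_smul_nat assms M_Suc_subset_A)
qed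

lemma subspace_A: "mat2.subspace (A n)"
  unfolding mat2.subspace_def
  using A_add A_smul M_Suc_subset_A[OF mat2.subspace_0[OF subspace_M]] by blast

text \<open>For the commutator c of x and z, the difference 2 Phi c - [Phi x, Phi z] lies one level
  deeper: by \<open>Phi_commutator\<close> it comes from a multiple by tr(w) - 2 and a further
  bracket, where w = x^(-1) z^(-1) is in N.\<close>

lemma bracket_Phi_A:
  assumes x: "x \<in> N" and z: "z \<in> N" and b: "bracket (Phi x) (Phi z) \<in> M (Suc n)"
  shows "bracket (Phi x) (Phi z) \<in> A n"
proof -
  let ?Z = "bracket (Phi x) (Phi z)" and ?w = "adj x ** adj z" and ?c = "x ** z ** adj x ** adj z"
  have w: "?w \<in> N" using x z by (intro sl2_subgroupD[OF N])
  have "smul 4 (smul 2 (Phi ?c) - ?Z) = smul 2 (smul (trace ?w - 2) ?Z) + bracket ?Z (Phi ?w)"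
    using Phi_commutator[of x z] sl2_subgroupD(4)[OF N] x z
    by (simp add: mat2.scale_right_diff_distrib mat2.scale_left_diff_distrib left_diff_distrib right_diff_distrib)
  also have "\<dots> \<in> M (Suc (Suc n))"
    by (intro M_add M_smul trace_smul_M bracket_M' Phi_L w b unip sl2_subgroupD(4)[OF N])
  finally have 1: "smul 2 (Phi ?c) - ?Z \<in> M (Suc (Suc n))" by (rule subspace_unit_smul[OF subspace_M four_unit])
  from M_add[OF M_Suc[OF this] b] have "smul 2 (Phi ?c) \<in> M (Suc n)" by (simp del: M.simps)
  then have "Phi ?c \<in> M (Suc n)" by (rule subspace_unit_smul[OF subspace_M two_unit])
  then have "Phi ?c \<in> A n"
    unfolding A_def using comm[OF x z] mat2.subspace_0[OF subspace_M] by (auto simp del: M.simps intro!: bexI[of _ ?c])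
  from mat2.subspace_diff[OF subspace_A A_smul[OF this, of 2] M_Suc_subset_A[OF 1]]
  show ?thesis by simp
qed

text \<open>Induction on the level: y is approximated by Phi d with d in D. Then [Phi x, y] differs
  from [Phi x, Phi d], which the commutator of x and d realises, by [Phi x, Phi d - y], one level
  deeper.\<close>

lemma A_eq_M: "M (Suc n) \<subseteq> A n"
proof (induction n)
  case 0
  have "bracket x y \<in> A 0" if "x \<in> L" "y \<in> L" for x y
  proof (rule span_bracket[OF that subspace_A])
    fix s t assume "s \<in> Phi ` N" "t \<in> Phi ` N"
    then show "bracket s t \<in> A 0"
      using bracket_Phi_A[of _ _ 0] bracket_M[of _ _ 0] Phi_L by auto
  qed
  then show ?case unfolding M.simps by (intro mat2.span_minimal subspace_A) auto
next
  case (Suc n)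
  have "bracket x y \<in> A (Suc n)" if "x \<in> L" and y: "y \<in> M (Suc n)" for x y
  proof -
    obtain d where d: "d \<in> D" "Phi d - y \<in> M (Suc (Suc n))"
      using Suc y unfolding A_def by blast
    have dM: "Phi d \<in> M (Suc n)" using M_add[OF M_Suc[OF d(2)] y] by (simp del: M.simps)
    from that(1) show ?thesis
    proof (induction rule: mat2.span_induct)
      show "mat2.subspace {x. bracket x y \<in> A (Suc n)}"
        using subspace_A[of "Suc n"] by (auto simp: mat2.subspace_def bracket_linear)
    next
      fix s assume "s \<in> Phi ` N"
      then obtain x where x: "s = Phi x" "x \<in> N" by blast
      have "bracket (Phi x) (Phi d) \<in> A (Suc n)"
        using x d(1) DN by (intro bracket_Phi_A bracket_M Phi_L dM) auto
      moreover have "bracket (Phi x) (Phi d - y) \<in> A (Suc n)"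
        using x d by (intro M_Suc_subset_A bracket_M Phi_L)
      ultimately have "bracket (Phi x) (Phi d) - bracket (Phi x) (Phi d - y) \<in> A (Suc n)"
        by (rule mat2.subspace_diff[OF subspace_A])
      then show "bracket s y \<in> A (Suc n)" by (simp add: bracket_linear x)
    qed
  qed
  then show ?case unfolding M.simps(2)[of "Suc n"] by (intro mat2.span_minimal subspace_A) auto
qed

lemma approx_step:
  assumes g: "det g = 1" "ell dvd trace g - 2" "Phi g \<in> M (Suc n)"
  shows "\<exists>d\<in>D. ell dvd trace (d ** g) - 2 \<and> Phi (d ** g) \<in> M (Suc (Suc n))"
proof -
  obtain e where e: "e \<in> D" "Phi e - Phi g \<in> M (Suc (Suc n))"
    using A_eq_M g(3) unfolding A_def by blast
  define d where "d = adj e"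
  have d: "d \<in> D" "d \<in> N" using sl2_subgroupD(3)[OF D e(1)] DN by (auto simp: d_def)
  have Pd: "Phi d = - Phi e" by (simp add: d_def Phi_adj)
  from M_neg[OF M_add[OF M_Suc[OF e(2)] g(3)]] have Md: "Phi d \<in> M (Suc n)"
    by (simp add: Pd del: M.simps)
  have "Phi (d ** g) - (Phi d + Phi g) \<in> M (Suc (Suc n))"
    by (intro Phi_mult_M g Md unip d sl2_subgroupD(4)[OF N])
  from M_diff[OF this e(2)] have 1: "Phi (d ** g) \<in> M (Suc (Suc n))" by (simp add: Pd del: M.simps)
  have "4 * (trace (d ** g) - 2) = trace (Phi d ** Phi g) + 2 * (trace d - 2) * trace g + 4 * (trace g - 2)"
    using trace_mult_Phi[of d g] by (simp add: algebra_simps)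
  moreover have "ell dvd \<dots>"
    by (rule dvd_add[OF dvd_add[OF trace_mult_L[OF M_sub[OF Md] M_sub[OF g(3)]] dvd_mult2[OF dvd_mult[OF unip[OF d(2)]]]]
      dvd_mult[OF g(2)]])
  ultimately have "ell dvd 4 * (trace (d ** g) - 2)" by (simp only:)
  then have "ell dvd trace (d ** g) - 2" using four_unit by (simp only: ell_dvd_mult_iff padic_unit_iff) simp
  then show ?thesis using 1 d(1) by blast
qed

lemma approx:
  assumes g: "det g = 1" "ell dvd trace g - 2" "Phi g \<in> M (Suc 0)"
  shows "\<exists>d\<in>D. ell dvd trace (d ** g) - 2 \<and> Phi (d ** g) \<in> M (Suc n)"
proof (induction n)
  case 0
  show ?case using g sl2_subgroupD(1)[OF D] by (intro bexI[of _ "mat 1"]) (auto simp del: M.simps)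
next
  case (Suc n)
  then obtain d where d: "d \<in> D" "ell dvd trace (d ** g) - 2" "Phi (d ** g) \<in> M (Suc n)" by blast
  have "det (d ** g) = 1" using sl2_subgroupD(4)[OF D d(1)] g(1) by (simp add: det_mul)
  from approx_step[OF this d(2,3)] obtain e where "e \<in> D" "ell dvd trace (e ** (d ** g)) - 2"
    "Phi (e ** (d ** g)) \<in> M (Suc (Suc n))" by blast
  then show ?case using sl2_subgroupD(2)[OF D _ d(1), of e] by (intro bexI[of _ "e ** d"]) (simp_all add: matrix_mul_assoc del: M.simps)
qed

text \<open>The exponent 2t is the one for which \<open>M_big\<close> reaches M 1, the first level
  made of brackets. Multiplying g repeatedly by elements of D pushes Phi (d g) to any depth, hence
  close to zero; the trace identity then brings tr(d g) close to 2, and 2 h = tr(h) + Phi h shows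
  that d g is close to 1.\<close>

lemma commutators_dense:
  assumes t: "t > 0" and g: "g \<in> congruence_subgroup (2 * t)"
  shows "\<exists>d\<in>D. mdvd (ell ^ k) (d - g)"
proof -
  have det: "det g = 1" and c: "mdvd (ell ^ (2 * t)) (g - mat 1)"
    using g by (auto simp: congruence_subgroup_def SL2_def mdvd_def)
  have P: "Phi g = Phi (g - mat 1)" by (simp add: mat2_simps Phi_def)
  have "mdvd (ell ^ (2 * t)) (Phi g)" unfolding P using c by (rule mdvd_Phi)
  then obtain B where B: "Phi g = smul (ell ^ (Suc 1 * t)) B" by (auto simp: mdvd_iff mult_2)
  have "trace B = 0" using trace_Phi[of g] ell_cancel unfolding B trace_smul by blast
  then have "Phi g \<in> M (Suc 0)" unfolding B using M_big[of B 1] by (simp del: M.simps)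
  moreover have "mdvd ell (g - mat 1)"
    using c t by (auto elim!: mdvd_trans[rotated] intro: dvd_power)
  then have "ell dvd trace (g - mat 1)" by (rule mdvd_trace)
  then have "ell dvd trace g - 2" by (simp add: trace_2 algebra_simps)
  ultimately have ap: "\<exists>d\<in>D. ell dvd trace (d ** g) - 2 \<and> Phi (d ** g) \<in> M (Suc n)" for n
    using approx det by blast
  obtain n where n: "\<forall>V\<in>M (Suc n). mdvd (ell ^ k) V" using M_mdvd by blast
  obtain d where d: "d \<in> D" "ell dvd trace (d ** g) - 2" "mdvd (ell ^ k) (Phi (d ** g))"
    using ap[of n] n by blast
  let ?h = "d ** g"
  have "det ?h = 1" using sl2_subgroupD(4)[OF D d(1)] det by (simp add: det_mul)
  have "ell ^ k dvd 2 * (trace ?h + 2) * (trace ?h - 2)"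
    unfolding trace_Phi_square[OF \<open>det ?h = 1\<close>] by (intro mdvd_trace mdvd_mult d)
  then have "ell ^ k dvd trace ?h - 2" by (rule dvd_unit_cancel[OF trace_unit[OF d(2)]])
  then have "mdvd (ell ^ k) (smul (trace ?h - 2) (mat 1) + Phi ?h)"
    by (intro mdvd_add mdvd_smul(2) d)
  moreover have "smul (trace ?h - 2) (mat 1) + Phi ?h = smul 2 (?h - mat 1)"
    by (simp add: mat2_eq_iff Phi_def trace_2 algebra_simps)
  ultimately have "smul 2 (?h - mat 1) \<in> {x. mdvd (ell ^ k) x}" by simp
  then have "mdvd (ell ^ k) (?h - mat 1)" using subspace_unit_smul[OF subspace_mdvd two_unit] by blast
  then have "mdvd (ell ^ k) (adj d ** (?h - mat 1))" by (rule mdvd_mult)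
  also have "adj d ** (?h - mat 1) = g - adj d"
    using sl2_subgroupD(4)[OF D d(1)] by (simp add: mult_distrib_2 adj_cancel)
  finally show ?thesis using sl2_subgroupD(3)[OF D d(1)] mdvd_minus_commute by blast
qed

end

section \<open>Cartan and Borel subgroups over a field\<close>

definition toral :: "('a::field ^ 2 ^ 2) set \<Rightarrow> bool" where
  "toral R \<longleftrightarrow> (\<exists>C. (split_cartan C \<or> nonsplit_cartan C \<or> borel_subgroup C) \<and> R \<subseteq> C)"

text \<open>
  What is used of a subgroup of a Cartan or Borel subgroup: writing \<open>\<mu>(x)\<close> for an
  eigenvalue of \<open>x\<close> depending multiplicatively on \<open>x\<close>, the trace \<open>\<mu> + \<mu>\<^sup>-\<^sup>1\<close> is \<open>2\<close> iff
  \<open>\<mu> = 1\<close> and \<open>0\<close> iff \<open>\<mu>\<^sup>2 = - 1\<close>.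
\<close>

definition torus_like :: "('a::comm_ring_1 ^ 2 ^ 2) set \<Rightarrow> bool" where
  "torus_like R \<longleftrightarrow> (\<forall>x\<in>R. \<forall>y\<in>R.
     (trace x = 2 \<longrightarrow> trace y = 2 \<longrightarrow> trace (x ** y) = 2) \<and>
     trace (x ** y ** adj x ** adj y) = 2 \<and>
     (trace x = 0 \<longrightarrow> trace (x ** y) = 0 \<longrightarrow> trace y ^ 2 = 4))"

text \<open>The second alternative is the case of a quotient of order at most two by the unipotent
  elements; together they exclude exactly a quotient of order four.\<close>

definition trace_generic :: "('a::comm_ring_1 ^ 2 ^ 2) set \<Rightarrow> bool" where
  "trace_generic R \<longleftrightarrow> (\<exists>x\<in>R. trace x ^ 2 \<noteq> 0 \<and> trace x ^ 2 \<noteq> 4) \<or> (\<forall>x\<in>R. trace x ^ 2 = 4)"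

lemma matrix_inv_unique:
  assumes "(A :: 'a::comm_ring_1 ^ 2 ^ 2) ** B = mat 1" "B ** A = mat 1" shows "matrix_inv A = B"
proof -
  have "A ** matrix_inv A = mat 1 \<and> matrix_inv A ** A = mat 1"
    unfolding matrix_inv_def using assms by (intro someI[of "\<lambda>B. A ** B = mat 1 \<and> B ** A = mat 1" B]) simp
  then have "matrix_inv A = matrix_inv A ** (A ** B)" "matrix_inv A ** A = mat 1" using assms by simp_all
  then show ?thesis by (simp add: matrix_mul_assoc)
qed

text \<open>A split Cartan subgroup is diagonalisable and so falls under the triangular case. In the
  nonsplit case what remains of the field is a commutative algebra without zero divisors.\<close>

lemma toralE:
  fixes R :: "('a::field ^ 2 ^ 2) set"
  assumes "toral R"
  obtains (borel) P Q :: "'a ^ 2 ^ 2" where "P ** Q = mat 1" "Q ** P = mat 1" "\<And>x. x \<in> R \<Longrightarrow> (Q ** x ** P)$2$1 = 0"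
  | (nonsplit) A :: "('a ^ 2 ^ 2) set" where "R \<subseteq> A" "mat 1 \<in> A" "\<And>x y. x \<in> A \<Longrightarrow> y \<in> A \<Longrightarrow> x ** y \<in> A"
      "\<And>x y. x \<in> A \<Longrightarrow> y \<in> A \<Longrightarrow> x + y \<in> A" "\<And>c x. x \<in> A \<Longrightarrow> smul c x \<in> A"
      "\<And>x y. x \<in> A \<Longrightarrow> y \<in> A \<Longrightarrow> x ** y = y ** x"
      "\<And>x y. x \<in> A \<Longrightarrow> y \<in> A \<Longrightarrow> x ** y = 0 \<Longrightarrow> x = 0 \<or> y = 0"
proof -
  obtain C where C: "split_cartan C \<or> nonsplit_cartan C \<or> borel_subgroup C" "R \<subseteq> C"
    using assms by (auto simp: toral_def)
  show thesis
  proof (cases "nonsplit_cartan C")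
    case True
    then obtain A where A: "subfield A M2" "\<And>c x. x \<in> A \<Longrightarrow> mat c ** x \<in> A" "C = Units (M2\<lparr>carrier := A\<rparr>)"
      unfolding nonsplit_cartan_def by blast
    have sd: "subdomain A M2" using A(1) by (simp add: subfield_def)
    note E = subcringE[OF subdomain.axioms(1)[OF sd]]
    show thesis
    proof (rule nonsplit)
      show "R \<subseteq> A" using C(2) A(3) by (auto simp: Units_def)
      show "mat 1 \<in> A" using E(3) by (simp add: M2_def)
      show "smul c x \<in> A" if "x \<in> A" for c x using A(2) that by (simp add: smul_def)
    next
      fix x y assume "x \<in> A" "y \<in> A"
      then show "x ** y \<in> A" "x + y \<in> A" "x ** y = y ** x" using E(6)[of x y] E(7)[of x y] E(8)[of x y] by (simp_all add: M2_def)
      show "x = 0 \<or> y = 0" if "x ** y = 0"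
        using subdomain.subintegral[OF sd \<open>x \<in> A\<close> \<open>y \<in> A\<close>] that by (simp add: M2_def)
    qed
  next
    case False
    obtain P where P: "invertible P" and x: "\<And>x. x \<in> C \<Longrightarrow> \<exists>g :: 'a ^ 2 ^ 2. x = P ** g ** matrix_inv P \<and> g$2$1 = 0"
      using C(1) False by (auto simp: split_cartan_def borel_subgroup_def conjugate_by_def)
    obtain Q where Q: "P ** Q = mat 1" "Q ** P = mat 1" using P by (auto simp: invertible_def)
    have "(Q ** x ** P)$2$1 = 0" if xR: "x \<in> R" for x
    proof -
      obtain g where g: "x = P ** g ** Q" "g$2$1 = 0" using x[OF subsetD[OF C(2) xR]] matrix_inv_unique[OF Q] by auto
      have "Q ** x ** P = (Q ** P) ** g ** (Q ** P)" by (simp add: g(1) matrix_mul_assoc)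
      then show ?thesis using g(2) Q by simp
    qed
    then show thesis using borel Q by blast
  qed
qed

lemma toral_subset: "toral R \<Longrightarrow> S \<subseteq> R \<Longrightarrow> toral S"
  unfolding toral_def by blast

lemma cayley_hamilton: "det x = 1 \<Longrightarrow> x ** x = smul (trace x) x - mat 1"
  by (simp add: mat2_simps algebra_simps)

lemma adj_conv_trace: "adj x = mat (trace x) - x"
  by (simp add: mat2_simps)

text \<open>In the triangular case the upper left entry \<mu> after conjugation is multiplicative,
  with \<mu> (tr(x) - \<mu>) = 1. In the nonsplit case an eigenvalue need not lie in the field, and
  the absence of zero divisors takes over: trace 2 gives (x - 1)^2 = 0 and so x = 1, and y^2 = 1
  gives y = 1 or y = -1.\<close>

lemma toral_imp_torus_like:
  fixes R :: "('a::field ^ 2 ^ 2) set"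
  assumes R: "sl2_subgroup R" and "toral R" and two: "(2 :: 'a) \<noteq> 0"
  shows "torus_like R"
  using \<open>toral R\<close>
proof (cases rule: toralE)
  case (borel P Q)
  define \<mu> where "\<mu> x = (Q ** x ** P)$1$1" for x
  have conj: "Q ** (x ** y) ** P = (Q ** x ** P) ** (Q ** y ** P)" for x y
    by (metis borel(1) matrix_mul_assoc matrix_mul_rid)
  have mu: "\<mu> (x ** y) = \<mu> x * \<mu> y" if "x \<in> R" "y \<in> R" for x y
    using borel(3)[OF that(2)] unfolding \<mu>_def conj by (simp add: mult_nth)
  have mu1: "\<mu> (mat 1) = 1" using borel(2) by (simp add: \<mu>_def)
  have tr: "\<mu> x * (trace x - \<mu> x) = 1" if "x \<in> R" for x
  proof -
    let ?y = "Q ** x ** P"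
    have "trace ?y = trace x" using trace_mul_sym[of "Q ** x" P] by (simp add: matrix_mul_assoc borel(1))
    then have t: "trace x = ?y$1$1 + ?y$2$2" by (simp only: trace_2[of ?y])
    have "det ?y = det (P ** Q) * det x" unfolding det_mul by simp
    then have "det ?y = 1" using borel(1) sl2_subgroupD(4)[OF R that] by simp
    then have "?y$1$1 * ?y$2$2 = 1" using borel(3)[OF that] by (simp add: det_2[of ?y])
    then show ?thesis by (simp add: \<mu>_def t)
  qed
  have t2: "trace x = 2 \<longleftrightarrow> \<mu> x = 1" if "x \<in> R" for x
  proof
    assume "trace x = 2"
    then have "(\<mu> x - 1) ^ 2 = 0" using tr[OF that] by (simp add: power2_eq_square algebra_simps)
    then show "\<mu> x = 1" by simp
  next
    assume "\<mu> x = 1"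
    then show "trace x = 2" using tr[OF that] by (simp add: algebra_simps)
  qed
  show ?thesis unfolding torus_like_def
  proof (intro ballI conjI impI)
    fix x y assume xy: "x \<in> R" "y \<in> R"
    note D = sl2_subgroupD[OF R]
    show "trace (x ** y) = 2" if "trace x = 2" "trace y = 2"
      using that t2 mu xy D(2) by simp
    have "\<mu> x * \<mu> (adj x) = 1" if "x \<in> R" for x
      using mu[OF that D(3)[OF that]] mu1 D(4)[OF that] by (simp add: mult_adj)
    then have "\<mu> (x ** y ** adj x ** adj y) = 1"
      using xy D by (simp add: mu) (metis mult.assoc mult.commute mult_1)
    then show "trace (x ** y ** adj x ** adj y) = 2" using t2 xy D by simp
    show "trace y ^ 2 = 4" if "trace x = 0" "trace (x ** y) = 0"
    proof -
      have "\<mu> x * \<mu> x = -1" using tr[OF xy(1)] that(1) by (simp add: minus_equation_iff)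
      moreover have "(\<mu> x * \<mu> y) * (\<mu> x * \<mu> y) = -1"
        using tr[OF D(2)[OF xy]] that(2) mu[OF xy] by (simp add: minus_equation_iff)
      ultimately have y: "\<mu> y * \<mu> y = 1"
        by (metis (no_types, lifting) minus_minus mult.assoc mult.left_commute mult_minus1 mult_minus_left)
      then have "\<mu> y * (trace y - 2 * \<mu> y) = 0" using tr[OF xy(2)] by (simp add: algebra_simps)
      then have "trace y = 2 * \<mu> y" using y by auto
      then show ?thesis using y by (simp add: power2_eq_square)
    qed
  qed
next
  case (nonsplit A)
  have in_A: "x \<in> A" if "x \<in> R" for x using nonsplit(1) that by blast
  note D = sl2_subgroupD[OF R]
  have A_diff: "x - y \<in> A" if "x \<in> A" "y \<in> A" for x y
    using nonsplit(4)[OF that(1) nonsplit(5)[OF that(2), of "-1"]] by simp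
  have t2: "x = mat 1" if "x \<in> R" "trace x = 2" for x
  proof -
    have "(x - mat 1) ** (x - mat 1) = 0"
      using cayley_hamilton[OF D(4)[OF that(1)]] that(2) by (simp add: mult_distrib_2) (simp add: mat2_simps)
    then show ?thesis using nonsplit(7)[of "x - mat 1" "x - mat 1"] A_diff in_A nonsplit(2) that(1) by auto
  qed
  show ?thesis unfolding torus_like_def
  proof (intro ballI conjI impI)
    fix x y assume xy: "x \<in> R" "y \<in> R"
    note xyA = xy[THEN in_A]
    show "trace (x ** y) = 2" if "trace x = 2" "trace y = 2"
      using t2[OF xy(1) that(1)] that(2) by simp
    have "x ** y ** adj x ** adj y = y ** (x ** adj x) ** adj y"
      by (simp add: nonsplit(6)[OF xyA] matrix_mul_assoc)
    also have "\<dots> = mat 1" using D(4)[OF xy(1)] D(4)[OF xy(2)] by (simp add: mult_adj)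
    finally show "trace (x ** y ** adj x ** adj y) = 2" by (simp add: trace_2)
    show "trace y ^ 2 = 4" if "trace x = 0" "trace (x ** y) = 0"
    proof -
      have xx: "x ** x = - mat 1" using cayley_hamilton[OF D(4)[OF xy(1)]] that(1) by simp
      have "(x ** y) ** (x ** y) = - mat 1" using cayley_hamilton[OF D(4)[OF D(2)[OF xy]]] that(2) by simp
      moreover have "(x ** y) ** (x ** y) = (x ** x) ** (y ** y)"
        using nonsplit(6)[OF xyA] by (metis matrix_mul_assoc)
      ultimately have yy: "y ** y = mat 1" unfolding xx by (simp add: minus_mult_2)
      then have "(y - mat 1) ** (y + mat 1) = 0" by (simp add: mult_distrib_2)
      then have "y - mat 1 = 0 \<or> y + mat 1 = 0"
        using nonsplit(2) nonsplit(4) A_diff xyA(2) by (intro nonsplit(7)) auto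
      then have "y = mat 1 \<or> y = - mat 1" by (auto simp: eq_neg_iff_add_eq_0)
      then show ?thesis by (auto simp: trace_2 power2_eq_square)
    qed
  qed
qed

lemma torus_likeD:
  assumes "torus_like R" "sl2_subgroup R" "x \<in> R" "y \<in> R"
  shows "trace x = 2 \<Longrightarrow> trace y = 2 \<Longrightarrow> trace (x ** y) = 2" "trace (x ** y ** adj x ** adj y) = 2"
    "trace x = 0 \<Longrightarrow> trace (x ** y) = 0 \<Longrightarrow> trace y ^ 2 = 4"
    "trace x = 0 \<Longrightarrow> trace y = 0 \<Longrightarrow> trace (x ** y) ^ 2 = 4"
proof -
  have *: "(trace x = 2 \<longrightarrow> trace y = 2 \<longrightarrow> trace (x ** y) = 2) \<and>
     trace (x ** y ** adj x ** adj y) = 2 \<and>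
     (trace x = 0 \<longrightarrow> trace (x ** y) = 0 \<longrightarrow> trace y ^ 2 = 4)" if "x \<in> R" "y \<in> R" for x y
    using assms(1) that unfolding torus_like_def by blast
  show "trace x = 2 \<Longrightarrow> trace y = 2 \<Longrightarrow> trace (x ** y) = 2" "trace (x ** y ** adj x ** adj y) = 2"
    "trace x = 0 \<Longrightarrow> trace (x ** y) = 0 \<Longrightarrow> trace y ^ 2 = 4"
    using *[OF assms(3,4)] by blast+
  note D = sl2_subgroupD[OF assms(2)]
  show "trace (x ** y) ^ 2 = 4" if "trace x = 0" "trace y = 0"
  proof -
    have "x ** (adj x ** y) = y" using D(4)[OF assms(3)] by (simp add: adj_cancel)
    then have "trace (adj x ** y) ^ 2 = 4"
      using *[of x "adj x ** y"] D assms(3,4) that by simp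
    then show ?thesis using that(1) by (simp add: adj_conv_trace minus_mult_2 trace_minus_2)
  qed
qed

lemma eigenvalue_imp_triangular:
  fixes g :: "'a::field ^ 2 ^ 2"
  assumes det: "det g = 1" and m: "m ^ 2 - trace g * m + 1 = 0"
  obtains P where "det P = 1" "(adj P ** g ** P)$2$1 = 0"
proof (cases "g$2$1 = 0")
  case True
  then show ?thesis using that[of "mat 1"] by (simp add: adj_mat)
next
  case False
  \<comment> \<open>By Cayley-Hamilton the first column of g - m is an eigenvector, for the
    eigenvalue 1/m; the second column makes the determinant 1.\<close>
  let ?P = "mat2 (g$1$1 - m) (- 1 / g$2$1) (g$2$1) 0"
  have P: "det ?P = 1" using False by (simp add: det_2)
  have "(adj ?P ** g ** ?P)$2$1 = (g$1$1 - m) * (g$2$1 * (g$1$1 - m) + g$2$2 * g$2$1) - g$2$1 * (g$1$1 * (g$1$1 - m) + g$1$2 * g$2$1)"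
    by (simp add: mult_nth algebra_simps)
  also have "\<dots> = g$2$1 * (m ^ 2 - (g$1$1 + g$2$2) * m + (g$1$1 * g$2$2 - g$1$2 * g$2$1))"
    by (simp add: power2_eq_square algebra_simps)
  also have "\<dots> = 0" using m det by (simp add: trace_2 det_2)
  finally show ?thesis using that P by blast
qed

lemma borel_toral:
  fixes R :: "('a::field ^ 2 ^ 2) set"
  assumes "det P = 1" "\<And>x. x \<in> R \<Longrightarrow> det x = 1 \<and> (adj P ** x ** P)$2$1 = 0"
  shows "toral R"
proof -
  have P: "P ** adj P = mat 1" "adj P ** P = mat 1" using assms(1) by (simp_all add: mult_adj)
  have "x \<in> conjugate_by P {g. invertible g \<and> g$2$1 = 0}" if "x \<in> R" for x
    unfolding conjugate_by_def matrix_inv_unique[OF P]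
  proof (rule image_eqI)
    show "x = P ** (adj P ** x ** P) ** adj P"
      using assms(1) by (simp add: matrix_mul_assoc adj_cancel)
    show "adj P ** x ** P \<in> {g. invertible g \<and> g$2$1 = 0}"
      using assms(1) assms(2)[OF that] by (simp add: invertible_2_iff det_mul)
  qed
  moreover have "invertible P" using P by (auto simp: invertible_def)
  ultimately show ?thesis unfolding toral_def borel_subgroup_def by blast
qed

text \<open>A nonscalar 2 by 2 matrix is cyclic, so its commutant consists of polynomials in it. The
  three cases say which entries witness that g is not scalar.\<close>

lemma commute_nonscalar:
  fixes g h :: "'a::field ^ 2 ^ 2"
  assumes "h ** g = g ** h" "\<And>c. g \<noteq> mat c"
  shows "\<exists>a b. h = mat a + smul b g"
proof -
  have e: "h$1$2 * g$2$1 = g$1$2 * h$2$1" "h$1$1 * g$1$2 + h$1$2 * g$2$2 = g$1$1 * h$1$2 + g$1$2 * h$2$2"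
    "h$2$1 * g$1$1 + h$2$2 * g$2$1 = g$2$1 * h$1$1 + g$2$2 * h$2$1"
    using arg_cong[OF assms(1), of "\<lambda>x. x$1$1"] arg_cong[OF assms(1), of "\<lambda>x. x$1$2"]
      arg_cong[OF assms(1), of "\<lambda>x. x$2$1"]
    by (simp_all only: mult_nth mult.commute[of "h$1$1" "g$1$1"] add_left_cancel)
  consider "g$1$2 \<noteq> 0" | "g$2$1 \<noteq> 0" | "g$1$2 = 0" "g$2$1 = 0" "g$1$1 \<noteq> g$2$2"
    using assms(2)[of "g$1$1"] by (metis mat2_eq_iff mat_nth)
  then show ?thesis
  proof cases
    case 1
    let ?b = "h$1$2 / g$1$2"
    have "h = mat (h$1$1 - ?b * g$1$1) + smul ?b g"
      using 1 e by (simp add: mat2_simps field_simps)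
    then show ?thesis by blast
  next
    case 2
    let ?b = "h$2$1 / g$2$1"
    have "h = mat (h$1$1 - ?b * g$1$1) + smul ?b g"
      using 2 e by (simp add: mat2_simps field_simps)
    then show ?thesis by blast
  next
    case 3
    obtain b where b: "b * (g$1$1 - g$2$2) = h$1$1 - h$2$2"
      by (rule that[of "(h$1$1 - h$2$2) / (g$1$1 - g$2$2)"]) (use 3 in simp)
    have "h$1$2 * (g$1$1 - g$2$2) = 0" "h$2$1 * (g$1$1 - g$2$2) = 0" using 3 e by (simp_all add: algebra_simps)
    then have "h = mat (h$1$1 - b * g$1$1) + smul b g"
      using 3 b by (simp add: mat2_simps algebra_simps)
    then show ?thesis by blast
  qed
qed

lemma ring_M2: "ring (M2 :: ('a::comm_ring_1 ^ 2 ^ 2) ring)"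
  by (rule ringI, rule abelian_groupI, unfold_locales)
     (auto simp: M2_def matrix_mul_assoc mult_distrib_2 add.assoc add.commute intro: exI[of _ "- _"])

lemma det_linear: "det (mat a + smul b g) = a ^ 2 + a * b * trace g + b ^ 2 * det g"
  by (simp add: mat2_simps power2_eq_square algebra_simps)

text \<open>The determinant of a + b g is the norm form a^2 + a b tr(g) + b^2, and a nontrivial zero
  would make - a / b a root of the characteristic polynomial. So nonzero elements are invertible,
  and the inverse, a multiple of the adjugate, has the same form.\<close>

lemma commutant_nonsplit_cartan:
  fixes g :: "'a::field ^ 2 ^ 2"
  assumes det: "det g = 1" and irr: "\<And>m. m ^ 2 - trace g * m + 1 \<noteq> 0"
  shows "nonsplit_cartan {x. \<exists>a b. x = mat a + smul b g \<and> x \<noteq> 0}"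
proof -
  let ?A = "{x. \<exists>a b. x = mat a + smul b g}"
  have A: "mat a + smul b g \<in> ?A" for a b by blast
  have gg: "g ** g = smul (trace g) g - mat 1" by (rule cayley_hamilton[OF det])
  have mult: "(mat a + smul b g) ** (mat c + smul d g)
      = mat (a * c - b * d) + smul (a * d + b * c + b * d * trace g) g" for a b c d
  proof -
    have "(mat a + smul b g) ** (mat c + smul d g) = mat (a * c) + smul (a * d + b * c) g + smul (b * d) (g ** g)"
      by (simp add: mat2_simps algebra_simps)
    also have "\<dots> = mat (a * c - b * d) + smul (a * d + b * c + b * d * trace g) g"
      unfolding gg by (simp add: mat2_eq_iff algebra_simps)
    finally show ?thesis .
  qed
  have det0: "det x \<noteq> 0" if xA: "x \<in> ?A" and x0: "x \<noteq> 0" for x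
  proof
    obtain a b where x: "x = mat a + smul b g" using xA by blast
    assume "det x = 0"
    then have z: "a ^ 2 + a * b * trace g + b ^ 2 = 0" by (simp add: x det_linear det)
    show False
    proof (cases "b = 0")
      case True
      then show False using z x0 by (simp add: x mat2_eq_iff)
    next
      case False
      then have "(- a / b) ^ 2 - trace g * (- a / b) + 1 = (a ^ 2 + a * b * trace g + b ^ 2) / b ^ 2"
        by (simp add: field_simps power2_eq_square)
      then show False using irr[of "- a / b"] z by simp
    qed
  qed
  have neg: "\<ominus>\<^bsub>M2\<^esub> x = - x" for x :: "'a ^ 2 ^ 2"
    by (rule abelian_group.minus_equality[OF ring.is_abelian_group[OF ring_M2]]) (simp_all add: M2_def)
  have sr: "subring ?A M2"
  proof (rule ring.subringI[OF ring_M2])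
    show "\<one>\<^bsub>M2\<^esub> \<in> ?A" using A[of 1 0] by (simp add: M2_def)
    show "\<ominus>\<^bsub>M2\<^esub> h \<in> ?A" if h: "h \<in> ?A" for h
    proof -
      obtain a b where "h = mat a + smul b g" using h by blast
      then have "- h = mat (- a) + smul (- b) g" by (simp add: mat2_eq_iff)
      then show ?thesis unfolding neg by blast
    qed
    show "x \<otimes>\<^bsub>M2\<^esub> y \<in> ?A" if xy: "x \<in> ?A" "y \<in> ?A" for x y
    proof -
      obtain a b c d where "x = mat a + smul b g" "y = mat c + smul d g" using xy by blast
      then have "x \<otimes>\<^bsub>M2\<^esub> y = mat (a * c - b * d) + smul (a * d + b * c + b * d * trace g) g"
        by (simp add: M2_def mult)
      then show ?thesis by blast
    qed
    show "x \<oplus>\<^bsub>M2\<^esub> y \<in> ?A" if xy: "x \<in> ?A" "y \<in> ?A" for x y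
    proof -
      obtain a b c d where "x = mat a + smul b g" "y = mat c + smul d g" using xy by blast
      then have "x + y = mat (a + c) + smul (b + d) g" by (simp add: mat2_eq_iff algebra_simps)
      then show ?thesis unfolding M2_def by auto
    qed
  qed (simp add: M2_def)
  have comm: "x ** y = y ** x" if xy: "x \<in> ?A" "y \<in> ?A" for x y
  proof -
    obtain a b c d where "x = mat a + smul b g" "y = mat c + smul d g" using xy by blast
    then show ?thesis by (simp add: mult algebra_simps)
  qed
  have U: "Units (M2\<lparr>carrier := ?A\<rparr>) = ?A - {0}"
  proof
    show "Units (M2\<lparr>carrier := ?A\<rparr>) \<subseteq> ?A - {0}"
    proof
      fix x assume "x \<in> Units (M2\<lparr>carrier := ?A\<rparr>)"
      then have "x \<in> ?A" "\<exists>y. y ** x = mat 1" by (auto simp: Units_def M2_def)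
      moreover have "y ** 0 \<noteq> mat 1" for y :: "'a ^ 2 ^ 2" by (simp add: mat2_simps)
      ultimately show "x \<in> ?A - {0}" by auto
    qed
    show "?A - {0} \<subseteq> Units (M2\<lparr>carrier := ?A\<rparr>)"
    proof
      fix x assume x: "x \<in> ?A - {0}"
      then obtain a b where ab: "x = mat a + smul b g" by blast
      let ?y = "smul (inverse (det x)) (adj x)"
      have "?y = mat (inverse (det x) * (a + b * trace g)) + smul (- inverse (det x) * b) g"
        by (simp add: ab mat2_eq_iff trace_2 algebra_simps)
      then have y: "?y \<in> ?A" by blast
      have "x ** ?y = mat 1" "?y ** x = mat 1"
        using det0[of x] x by (simp_all add: smul_mult mult_adj) (simp_all add: mat2_simps)
      then show "x \<in> Units (M2\<lparr>carrier := ?A\<rparr>)"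
        using x y by (auto simp: Units_def M2_def)
    qed
  qed
  have "subfield ?A M2"
  proof (rule ring.subfieldI[OF ring_M2])
    show "subcring ?A M2" by (rule ring.subcringI[OF ring_M2 sr]) (use comm in \<open>auto simp: M2_def\<close>)
    show "Units (M2\<lparr>carrier := ?A\<rparr>) = ?A - {\<zero>\<^bsub>M2\<^esub>}" using U by (simp add: M2_def)
  qed
  moreover have "mat c ** X \<in> ?A" if X: "X \<in> ?A" for c X
  proof -
    obtain a b where "X = mat a + smul b g" using X by blast
    then have "mat c ** X = mat (c * a) + smul (c * b) g" by (simp add: mat2_simps algebra_simps)
    then show ?thesis by blast
  qed
  moreover have "{x. \<exists>a b. x = mat a + smul b g \<and> x \<noteq> 0} = ?A - {0}" by blast
  ultimately show ?thesis unfolding nonsplit_cartan_def U[symmetric] by blast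
qed

lemma commutant_toral:
  fixes g :: "'a::field ^ 2 ^ 2"
  assumes det: "det g = 1" and R: "\<And>x. x \<in> R \<Longrightarrow> det x = 1 \<and> (\<exists>a b. x = mat a + smul b g)"
  shows "toral R"
proof (cases "\<exists>m. m ^ 2 - trace g * m + 1 = 0")
  case True
  then obtain m where "m ^ 2 - trace g * m + 1 = 0" by blast
  then obtain P where P: "det P = 1" "(adj P ** g ** P)$2$1 = 0" by (rule eigenvalue_imp_triangular[OF det])
  have "(adj P ** x ** P)$2$1 = 0" if x: "x \<in> R" for x
  proof -
    obtain a b where "x = mat a + smul b g" using R[OF x] by blast
    then have "adj P ** x ** P = smul a (adj P ** P) + smul b (adj P ** g ** P)"
      by (simp add: mat2_simps algebra_simps)
    then show ?thesis using P by (simp add: mult_adj)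
  qed
  then show ?thesis using borel_toral[OF P(1)] R by blast
next
  case False
  have "R \<subseteq> {x. \<exists>a b. x = mat a + smul b g \<and> x \<noteq> 0}"
  proof
    fix x assume x: "x \<in> R"
    have "det (0 :: 'a ^ 2 ^ 2) \<noteq> 1" by (simp add: det_2)
    then have "x \<noteq> 0" using R[OF x] by auto
    then show "x \<in> {x. \<exists>a b. x = mat a + smul b g \<and> x \<noteq> 0}" using R[OF x] by blast
  qed
  then show ?thesis unfolding toral_def using commutant_nonsplit_cartan[OF det] False by blast
qed

section \<open>Subgroups of \<open>SL\<^sub>2\<close> over a finite field\<close>

lemma sl2_subgroup_card_dvd:
  assumes A: "sl2_subgroup A" and B: "sl2_subgroup B" and AB: "A \<subseteq> B"
  shows "card A dvd card B"
proof -
  note sA = sl2_subgroup_imp_subgroup[OF A] and sB = sl2_subgroup_imp_subgroup[OF B]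
  have "subgroup A (GL2\<lparr>carrier := B\<rparr>)" by (rule group.subgroup_incl[OF group_GL2 sA sB AB])
  moreover have "group (GL2\<lparr>carrier := B\<rparr>)" by (rule group.subgroup_imp_group[OF group_GL2 sB])
  ultimately have "card (rcosets\<^bsub>GL2\<lparr>carrier := B\<rparr>\<^esub> A) * card A = order (GL2\<lparr>carrier := B\<rparr>)"
    by (intro group.lagrange)
  then show ?thesis by (simp add: order_def) (metis dvd_triv_right)
qed

lemma sl2_subgroup_minus:
  assumes "sl2_subgroup G" "- mat 1 \<in> G" "x \<in> G" shows "- x \<in> G"
  using sl2_subgroupD(2)[OF assms] by (simp add: minus_mult_2)

lemma sl2_subgroup_pm: "sl2_subgroup {mat 1, - mat 1}"
  by (auto simp: sl2_subgroup_def SL2_def minus_mult_2 adj_minus adj_mat) (simp add: det_2)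

section \<open>Counting in a finite group whose unipotent elements are trivial up to sign\<close>

definition cj :: "'a::comm_ring_1 ^ 2 ^ 2 \<Rightarrow> 'a ^ 2 ^ 2 \<Rightarrow> 'a ^ 2 ^ 2" where
  "cj x y = x ** y ** adj x"

lemma cj_simps:
  assumes "det x = 1"
  shows "cj x (a ** b) = cj x a ** cj x b" "cj (adj x) (cj x a) = a" "cj x (cj (adj x) a) = a"
    "trace (cj x a) = trace a" "cj x a = cj x b \<longleftrightarrow> a = b" "cj x (mat 1) = mat 1"
proof -
  show "cj x (a ** b) = cj x a ** cj x b"
    using assms by (simp add: cj_def matrix_mul_assoc adj_cancel)
  show 1: "cj (adj x) (cj x a) = a" for a
    using assms by (simp add: cj_def matrix_mul_assoc adj_cancel)
  show "cj x (cj (adj x) a) = a"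
    using assms by (simp add: cj_def matrix_mul_assoc adj_cancel)
  show "trace (cj x a) = trace a" using assms by (simp add: cj_def trace_conj)
  show "cj x a = cj x b \<longleftrightarrow> a = b" using 1 by metis
  show "cj x (mat 1) = mat 1" using assms by (simp add: cj_def adj_cancel)
qed

lemma cj_cj: "cj x (cj y a) = cj (x ** y) a"
  by (simp add: cj_def adj_mult matrix_mul_assoc)

lemma cj_minus: "cj x (- a) = - cj x a"
  by (simp add: cj_def minus_mult_2)

lemma adj_cj: "adj (cj x a) = cj x (adj a)"
  by (simp add: cj_def adj_mult matrix_mul_assoc)

lemma cj_commute: "det x = 1 \<Longrightarrow> cj x a ** cj x b = cj x b ** cj x a \<longleftrightarrow> a ** b = b ** a"
  by (metis cj_simps(1,5))

lemma scalar_commute: "mat c ** (x :: 'a::comm_ring_1 ^ 2 ^ 2) = x ** mat c"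
  by (simp add: mat2_simps algebra_simps)

text \<open>Trace 2 or -2 with determinant 1 means unipotent up to sign, so \<open>ss\<close>
  excludes such elements except 1 and -1. Centralisers of the remaining elements are abelian and
  partition the group apart from 1 and -1, which makes a class equation possible.\<close>

locale finite_semisimple =
  fixes \<Gamma> :: "('a::{field,finite} ^ 2 ^ 2) set"
  assumes two: "(2 :: 'a) \<noteq> 0" and grp: "sl2_subgroup \<Gamma>" and minus: "- mat 1 \<in> \<Gamma>"
    and ss: "\<And>u. u \<in> \<Gamma> \<Longrightarrow> trace u ^ 2 = 4 \<Longrightarrow> u = mat 1 \<or> u = - mat 1"
begin

lemmas D = sl2_subgroupD[OF grp]

definition Z :: "('a ^ 2 ^ 2) set" where "Z = {mat 1, - mat 1}"
definition X where "X = \<Gamma> - Z"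
definition C where "C g = {h \<in> \<Gamma>. h ** g = g ** h}"
definition K where "K g = C g - Z"
text \<open>All conjugates of the abelian group C g without 1 and -1. These sets, rather than
  conjugacy classes, are the pieces into which X is partitioned.\<close>

definition Orb where "Orb g = {cj x k |x k. x \<in> \<Gamma> \<and> k \<in> K g}"
text \<open>The normaliser of C g: if the conjugate of g commutes with g, then both have the same
  centraliser.\<close>

definition Nm where "Nm g = {x \<in> \<Gamma>. cj x g \<in> C g}"

lemma one_neq: "mat 1 \<noteq> (- mat 1 :: 'a ^ 2 ^ 2)"
proof
  assume "mat 1 = (- mat 1 :: 'a ^ 2 ^ 2)"
  then have "(1 :: 'a) = -1" by (simp add: mat2_eq_iff)
  then show False using two by (metis add_eq_0_iff one_add_one)
qed

lemma card_Z: "card Z = 2"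
  using one_neq by (simp add: Z_def)

lemma Z_sub: "Z \<subseteq> \<Gamma>"
  using D(1) minus by (simp add: Z_def)

lemma X_D: "g \<in> X \<Longrightarrow> g \<in> \<Gamma>" "g \<in> X \<Longrightarrow> det g = 1" "g \<in> X \<Longrightarrow> trace g ^ 2 \<noteq> 4"
  using ss D(4) by (auto simp: X_def Z_def)

lemma X_nonscalar: "g \<in> X \<Longrightarrow> g \<noteq> mat c"
proof
  assume g: "g \<in> X" "g = mat c"
  then have "c ^ 2 = 1" using X_D(2)[OF g(1)] by simp
  then have "trace g ^ 2 = 4" by (simp add: g(2) trace_2 power2_eq_square algebra_simps)
  then show False using X_D(3)[OF g(1)] by blast
qed

lemma C_form: "g \<in> X \<Longrightarrow> h \<in> C g \<Longrightarrow> \<exists>a b. h = mat a + smul b g"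
  using commute_nonscalar[of h g] X_nonscalar unfolding C_def by blast

lemma C_commute: assumes g: "g \<in> X" and h: "h \<in> C g" and k: "k \<in> C g" shows "h ** k = k ** h"
proof -
  obtain a b where ab: "h = mat a + smul b g" using C_form[OF g h] by blast
  have "h ** k = smul a k + smul b (g ** k)" "k ** h = smul a k + smul b (k ** g)"
    by (simp_all add: ab mat2_simps algebra_simps)
  then show ?thesis using k by (simp add: C_def)
qed

lemma C_eq: assumes g: "g \<in> X" and h: "h \<in> X" and hg: "h \<in> C g" shows "C h = C g"
proof -
  have "g \<in> C h" using g hg X_D(1)[OF g] by (simp add: C_def)
  then have "k ** h = h ** k \<longleftrightarrow> k ** g = g ** k" if "k \<in> \<Gamma>" for k
    using C_commute[OF g, of k h] C_commute[OF h, of k g] hg that by (metis (mono_tags, lifting) C_def mem_Collect_eq)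
  then show ?thesis unfolding C_def by blast
qed

lemma Z_C: "Z \<subseteq> C g"
  using Z_sub by (auto simp: C_def Z_def minus_mult_2)

lemma C_subgroup: assumes "g \<in> X" shows "sl2_subgroup (C g)"
  unfolding sl2_subgroup_def
proof (intro conjI ballI)
  show "C g \<subseteq> SL2" using grp by (auto simp: C_def sl2_subgroup_def)
  show "mat 1 \<in> C g" using Z_C by (auto simp: Z_def)
  fix x assume x: "x \<in> C g"
  then show "adj x \<in> C g" using D(3)[of x]
    by (simp add: C_def adj_conv_trace mult_distrib_2 scalar_commute)
  fix y assume y: "y \<in> C g"
  have "x ** y ** g = x ** (y ** g)" by (simp add: matrix_mul_assoc)
  also have "\<dots> = x ** g ** y" using y by (simp add: C_def matrix_mul_assoc)
  also have "\<dots> = g ** (x ** y)" using x by (simp add: C_def matrix_mul_assoc)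
  finally show "x ** y \<in> C g" using x y D(2) by (simp add: C_def)
qed

lemma cj_G: "x \<in> \<Gamma> \<Longrightarrow> y \<in> \<Gamma> \<Longrightarrow> cj x y \<in> \<Gamma>"
  by (simp add: cj_def D)

lemma cj_Z: "x \<in> \<Gamma> \<Longrightarrow> cj x y \<in> Z \<longleftrightarrow> y \<in> Z"
  using cj_simps(5)[of x y "mat 1"] cj_simps(5)[of x y "- mat 1"] cj_simps(6)[of x] D(4)[of x]
  by (auto simp: Z_def cj_minus)

lemma cj_X: "x \<in> \<Gamma> \<Longrightarrow> g \<in> X \<Longrightarrow> cj x g \<in> X"
  by (simp add: X_def cj_G cj_Z)

lemma cj_C: "x \<in> \<Gamma> \<Longrightarrow> h \<in> C g \<Longrightarrow> cj x h \<in> C (cj x g)"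
  using cj_commute[OF D(4)] cj_G by (auto simp: C_def)

lemma K_X: "k \<in> K g \<Longrightarrow> k \<in> X"
  by (auto simp: K_def X_def C_def)

lemma K_C: "k \<in> K g \<Longrightarrow> k \<in> C g"
  by (auto simp: K_def)

lemma self_K: "g \<in> X \<Longrightarrow> g \<in> K g"
  by (auto simp: K_def X_def C_def)

text \<open>If x k x^(-1) = x0 k0 x0^(-1), then y = x0^(-1) x carries k to k0 and therefore
  normalises the common centraliser C g. So all fibres of conjugation have the size of the
  normaliser, and \<open>card_Orb\<close> follows by double counting.\<close>

lemma fibre_bij:
  assumes g: "g \<in> X" and x0: "x0 \<in> \<Gamma>" and k0: "k0 \<in> K g"
  shows "bij_betw (\<lambda>y. (x0 ** y, cj (adj y) k0)) (Nm g)
    {s \<in> \<Gamma> \<times> K g. (case s of (x, k) \<Rightarrow> cj x k) = cj x0 k0}" (is "bij_betw ?f _ ?F")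
proof (rule bij_betw_imageI)
  have dx0: "det x0 = 1" using D(4)[OF x0] .
  show "inj_on ?f (Nm g)"
    by (rule inj_onI) (metis adj_cancel(6) dx0 prod.inject)
  show "?f ` Nm g = ?F"
  proof (intro equalityI subsetI)
    fix s assume "s \<in> ?f ` Nm g"
    then obtain y where y: "y \<in> \<Gamma>" "cj y g \<in> C g" and s: "s = (x0 ** y, cj (adj y) k0)" by (auto simp: Nm_def)
    have "C (cj y g) = C g" using C_eq[OF g cj_X[OF y(1) g] y(2)] .
    then have "cj (adj y) k0 \<in> C (cj (adj y) (cj y g))" using cj_C[OF D(3)[OF y(1)]] K_C[OF k0] by blast
    then have "cj (adj y) k0 \<in> C g" using cj_simps(2)[OF D(4)[OF y(1)]] by simp
    moreover have "cj (adj y) k0 \<notin> Z" using cj_Z[OF D(3)[OF y(1)]] k0 by (auto simp: K_def)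
    moreover have "cj (x0 ** y) (cj (adj y) k0) = cj x0 k0"
      using cj_simps(3)[OF D(4)[OF y(1)]] by (simp add: cj_cj[symmetric])
    ultimately show "s \<in> ?F" using s D(2)[OF x0 y(1)] by (simp add: K_def)
  next
    fix s assume "s \<in> ?F"
    then obtain x k where s: "s = (x, k)" "x \<in> \<Gamma>" "k \<in> K g" "cj x k = cj x0 k0" by auto
    define y where "y = adj x0 ** x"
    have y: "y \<in> \<Gamma>" unfolding y_def by (intro D x0 s)
    have yk: "cj y k = k0" unfolding y_def cj_cj[symmetric] s(4) by (rule cj_simps(2)[OF dx0])
    have "g \<in> C k" using K_C[OF s(3)] X_D(1)[OF g] by (auto simp: C_def)
    then have "cj y g \<in> C k0" using cj_C[OF y] yk by metis
    then have "y \<in> Nm g" using C_eq[OF g K_X[OF k0] K_C[OF k0]] y by (simp add: Nm_def)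
    moreover have "x = x0 ** y" using dx0 by (simp add: y_def adj_cancel)
    moreover have "k = cj (adj y) k0" using cj_simps(2)[OF D(4)[OF y], of k] yk by simp
    ultimately show "s \<in> ?f ` Nm g" using s(1) by blast
  qed
qed

lemma card_Orb: assumes g: "g \<in> X" shows "card (Orb g) * card (Nm g) = card \<Gamma> * card (K g)"
proof -
  let ?S = "\<Gamma> \<times> K g" and ?f = "\<lambda>(x, k). cj x k"
  have im: "?f ` ?S = Orb g" by (auto simp: Orb_def image_def)
  have "card ?S = (\<Sum>s\<in>?S. 1)" by simp
  also have "\<dots> = (\<Sum>h\<in>?f ` ?S. \<Sum>s\<in>{s \<in> ?S. ?f s = h}. 1)" by (rule sum.image_gen) simp
  also have "\<dots> = (\<Sum>h\<in>Orb g. card (Nm g))"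
  proof (rule sum.cong[OF im])
    fix h assume "h \<in> Orb g"
    then obtain x0 k0 where "x0 \<in> \<Gamma>" "k0 \<in> K g" "h = cj x0 k0" by (auto simp: Orb_def)
    then show "(\<Sum>s\<in>{s \<in> ?S. ?f s = h}. 1) = card (Nm g)"
      using bij_betw_same_card[OF fibre_bij[OF g]] by simp
  qed
  finally show ?thesis by (simp add: card_cartesian_product)
qed

text \<open>The Weyl group has at most two elements: a conjugate a + b g of g has the same trace t
  and determinant, which gives (t^2 - 4) (1 - b^2) = 0; the solutions b = 1 and b = -1 are g and its
  inverse.\<close>

lemma Nm_cases: assumes g: "g \<in> X" and x: "x \<in> Nm g" shows "cj x g = g \<or> cj x g = adj g"
proof -
  obtain a b where ab: "cj x g = mat a + smul b g" using C_form[OF g, of "cj x g"] x unfolding Nm_def by blast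
  have x: "x \<in> \<Gamma>" using x by (simp add: Nm_def)
  let ?t = "trace g"
  have "trace (cj x g) = ?t" using cj_simps(4)[OF D(4)[OF x]] .
  then have tr: "2 * a = ?t * (1 - b)" unfolding ab by (simp add: trace_2 algebra_simps)
  have "det (cj x g) = 1" using D(4)[OF cj_G[OF x X_D(1)[OF g]]] .
  then have "a ^ 2 + a * b * ?t + b ^ 2 = 1" unfolding ab det_linear X_D(2)[OF g] by simp
  moreover have "(2 * a) ^ 2 + 2 * (2 * a) * b * ?t + 4 * b ^ 2 = 4 * (a ^ 2 + a * b * ?t + b ^ 2)"
    by (simp add: power2_eq_square algebra_simps)
  ultimately have "(2 * a) ^ 2 + 2 * (2 * a) * b * ?t + 4 * b ^ 2 = 4" by simp
  then have "(?t ^ 2 - 4) * ((1 - b) * (1 + b)) = 0" unfolding tr by (simp add: power2_eq_square algebra_simps)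
  then have "b = 1 \<or> b = -1" using X_D(3)[OF g] by (auto simp: eq_neg_iff_add_eq_0 add.commute)
  then show ?thesis
  proof
    assume b: "b = 1"
    then have "a = 0" using tr two by simp
    then show ?thesis using ab b by (simp add: mat2_eq_iff)
  next
    assume b: "b = -1"
    then have "2 * a = 2 * ?t" using tr by simp
    then have "a = ?t" using two by simp
    then show ?thesis using ab b by (simp add: adj_conv_trace mat2_eq_iff)
  qed
qed

lemma card_Nm: assumes g: "g \<in> X" shows "card (Nm g) = card (C g) \<or> card (Nm g) = 2 * card (C g)"
proof -
  let ?E = "{x \<in> \<Gamma>. cj x g = adj g}"
  have fx: "cj x g = g \<longleftrightarrow> x ** g = g ** x" if "x \<in> \<Gamma>" for x
    using D(4)[OF that] by (metis cj_def adj_cancel(3,4))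
  have "adj g \<in> C g" using D(3)[OF X_D(1)[OF g]] by (simp add: C_def mult_adj)
  moreover have "g \<in> C g" using X_D(1)[OF g] by (simp add: C_def)
  ultimately have Nm: "Nm g = C g \<union> ?E"
    using Nm_cases[OF g] fx by (fastforce simp: Nm_def C_def)
  have "g \<noteq> adj g"
  proof
    assume "g = adj g"
    then have "smul 2 g = mat (trace g)" by (simp add: adj_conv_trace mat2_eq_iff)
    then have "g = mat (trace g / 2)" using two by (simp add: mat2_eq_iff field_simps)
    then show False using X_nonscalar[OF g] by blast
  qed
  then have disj: "C g \<inter> ?E = {}" using fx by (fastforce simp: C_def)
  show ?thesis
  proof (cases "?E = {}")
    case False
    then obtain x0 where x0: "x0 \<in> \<Gamma>" "cj x0 g = adj g" by blast
    have x0': "cj x0 (adj g) = g" using x0(2) by (metis adj_adj adj_cj)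
    have "?E = (\<lambda>y. x0 ** y) ` C g"
    proof (intro equalityI subsetI)
      fix x assume x: "x \<in> ?E"
      have "cj (adj x0 ** x) g = g"
        using x x0' cj_simps(2)[OF D(4)[OF x0(1)]] x0(2) by (simp add: cj_cj[symmetric]) metis
      then have "adj x0 ** x \<in> C g" using fx D(2)[OF D(3)[OF x0(1)], of x] x by (simp add: C_def)
      moreover have "x = x0 ** (adj x0 ** x)" using D(4)[OF x0(1)] by (simp add: adj_cancel)
      ultimately show "x \<in> (\<lambda>y. x0 ** y) ` C g" by blast
    next
      fix x assume "x \<in> (\<lambda>y. x0 ** y) ` C g"
      then obtain y where y: "y \<in> \<Gamma>" "cj y g = g" "x = x0 ** y" using fx by (auto simp: C_def)
      then show "x \<in> ?E" using x0 D(2) by (simp add: cj_cj[symmetric])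
    qed
    moreover have "inj_on (\<lambda>y. x0 ** y) (C g)"
      by (rule inj_onI) (metis adj_cancel(6) D(4)[OF x0(1)])
    ultimately have "card ?E = card (C g)" by (simp add: card_image)
    then show ?thesis using Nm disj by (simp add: card_Un_disjoint)
  next
    case True
    then have "Nm g = C g" using Nm by (simp only: Un_empty_right)
    then show ?thesis by simp
  qed
qed

text \<open>Here e is the order of C g modulo signs and f the index of C g in its normaliser. The
  weight of \<open>Orb g\<close> in \<Gamma> is then (1 - 1/e)/f, and the bound on 2 f e says that
  the normaliser lies in \<Gamma>.\<close>

lemma Orb_data:
  assumes g: "g \<in> X"
  obtains e f where "e \<ge> 2" "f = 1 \<or> f = 2" "card (C g) = 2 * e" "2 * f * e \<le> card \<Gamma>"
    "card (Orb g) * (f * e) = card \<Gamma> * (e - 1)"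
proof -
  have "2 dvd card (C g)"
    using sl2_subgroup_card_dvd[OF sl2_subgroup_pm C_subgroup[OF g]] Z_C card_Z by (simp add: Z_def)
  then obtain e where e: "card (C g) = 2 * e" by (auto simp: dvd_def)
  have "card (insert g Z) \<le> card (C g)"
    using Z_C self_K[OF g] by (intro card_mono) (auto simp: K_def)
  moreover have "g \<notin> Z" using g by (simp add: X_def)
  ultimately have "e \<ge> 2" using e card_Z by (simp add: card_insert_if Z_def)
  moreover obtain f where f: "f = 1 \<or> f = 2" "card (Nm g) = f * card (C g)" using card_Nm[OF g] by (metis mult_1)
  moreover have "card (Nm g) \<le> card \<Gamma>" by (intro card_mono) (auto simp: Nm_def)
  moreover have "card (K g) = 2 * (e - 1)" using e card_Z Z_C by (simp add: K_def card_Diff_subset right_diff_distrib')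
  then have "card (Orb g) * (f * e) = card \<Gamma> * (e - 1)" using card_Orb[OF g] f(2) e by simp
  moreover have "f * card (C g) = 2 * f * e" using e by simp
  ultimately show thesis using that[of e f] e by simp
qed

lemma Orb_X: "g \<in> X \<Longrightarrow> Orb g \<subseteq> X"
  using K_X cj_X by (auto simp: Orb_def)

lemma Orb_disjoint:
  assumes g: "g1 \<in> X" "g2 \<in> X" "g2 \<notin> Orb g1" shows "Orb g1 \<inter> Orb g2 = {}"
proof (rule ccontr)
  assume "\<not> ?thesis"
  then obtain x y k m where *: "x \<in> \<Gamma>" "y \<in> \<Gamma>" "k \<in> K g1" "m \<in> K g2" "cj x k = cj y m"
    by (auto simp: Orb_def)
  define z where "z = adj y ** x"
  have z: "z \<in> \<Gamma>" unfolding z_def by (intro D *)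
  have zk: "cj z k = m" unfolding z_def cj_cj[symmetric] *(5) by (rule cj_simps(2)[OF D(4)[OF *(2)]])
  have "g2 \<in> C m" using K_C[OF *(4)] X_D(1)[OF g(2)] by (auto simp: C_def)
  then have "cj (adj z) g2 \<in> C (cj (adj z) m)" by (rule cj_C[OF D(3)[OF z]])
  also have "cj (adj z) m = k" using zk cj_simps(2)[OF D(4)[OF z]] by blast
  also have "C k = C g1" using C_eq[OF g(1) K_X[OF *(3)] K_C[OF *(3)]] .
  finally have "cj (adj z) g2 \<in> K g1" using cj_Z[OF D(3)[OF z]] g(2) by (simp add: K_def X_def)
  moreover have "g2 = cj z (cj (adj z) g2)" using cj_simps(3)[OF D(4)[OF z]] by simp
  ultimately show False using g(3) z unfolding Orb_def by blast
qed

end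

text \<open>
  The solutions of the class equation \<open>1 - 2/n = \<Sum> (1 - 1/e\<^sub>i)/f\<^sub>i\<close>, where \<open>n\<close> is twice the order
  in \<open>PSL\<^sub>2\<close>: cyclic, dihedral, tetrahedral, octahedral and icosahedral groups.
\<close>

lemma class_equation_1:
  fixes n :: real and e f :: nat
  assumes "n > 24" "e \<ge> 2" "f = 1 \<or> f = 2" "1 - 2 / n = (1 - 1 / e) / f"
  shows "e \<ge> 3 \<and> n \<le> 24 * e"
  using assms(3)
proof
  assume "f = 1"
  then have "1 / e = 2 / n" using assms(4) by simp
  then have "n = 2 * e" using assms(1,2) by (simp add: field_simps)
  then show ?thesis using assms(1) by auto
next
  assume "f = 2"
  then have "1 - 2 / n = (1 - 1 / e) / 2" using assms(4) by simp
  moreover have "1 / e > 0" "2 / n < 1 / 2" using assms(1,2) by (simp_all add: field_simps)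
  ultimately show ?thesis by (simp add: field_simps)
qed

lemma recip_cases:
  fixes e :: nat assumes "e \<ge> 2"
  shows "0 < 1 / real e" "e = 2 \<or> e = 3 \<or> 1 / real e \<le> 1 / 4" "1 / real e \<le> 1 / 2"
proof -
  have "e = 2 \<or> e = 3 \<or> real e \<ge> 4" using assms by linarith
  then show "e = 2 \<or> e = 3 \<or> 1 / real e \<le> 1 / 4" by (auto simp: field_simps)
qed (use assms in \<open>auto simp: field_simps\<close>)

text \<open>The equation reads 2/e1 + 1/e2 = 1 + 4/n. Here e1 = 2 gives n = 4 e2, a dihedral group
  modulo signs; e1 = 3 forces e2 = 2 and n = 24, the binary tetrahedral group, excluded by n > 24;
  and e1 \<ge> 4 makes the left side at most 1.\<close>

lemma class_equation_2':
  fixes n :: real and e1 e2 :: nat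
  assumes n: "n > 24" and e: "e1 \<ge> 2" "e2 \<ge> 2" and eq: "1 - 2 / n = (1 - 1 / e1) + (1 - 1 / e2) / 2"
  shows "e2 \<ge> 3 \<and> n \<le> 24 * e2"
proof -
  define q r1 r2 where "q = 1 / n" and "r1 = 1 / real e1" and "r2 = 1 / real e2"
  have q: "q > 0" "q < 1 / 24" using n by (simp_all add: q_def field_simps)
  have "1 - 2 * q = (1 - r1) + (1 - r2) / 2" using eq by (simp add: q_def r1_def r2_def)
  then have *: "2 * r1 + r2 = 1 + 4 * q" by (simp add: field_simps)
  note r = recip_cases[OF e(1), folded r1_def] recip_cases[OF e(2), folded r2_def]
  consider "e1 = 2" | "e1 = 3" | "r1 \<le> 1 / 4" using r(2) by blast
  then show ?thesis
  proof cases
    case 1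
    then have "r2 = 4 * q" using * by (simp add: r1_def)
    then have "n = 4 * e2" using n e by (simp add: q_def r2_def field_simps)
    then show ?thesis using n by auto
  next
    case 2
    then have "r1 = 1 / 3" by (simp add: r1_def)
    then have r2: "r2 = 1 / 3 + 4 * q" using * by linarith
    have "e2 = 2" using r(5) r2 q by (auto simp: r2_def)
    then show ?thesis using r2 q by (simp add: r2_def)
  next
    case 3
    then show ?thesis using * q r(6) by linarith
  qed
qed

text \<open>With f1 = f2 = 1 the right side is at least 1. With f1 = f2 = 2 the equation says 1/e1 +
  1/e2 = 4/n, although each summand is at least 4/n by the size bounds. The mixed cases are
  \<open>class_equation_2'\<close>.\<close>

lemma class_equation_2:
  fixes n :: real and e1 e2 f1 f2 :: nat
  assumes n: "n > 24" and e: "e1 \<ge> 2" "e2 \<ge> 2" and f: "f1 = 1 \<or> f1 = 2" "f2 = 1 \<or> f2 = 2"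
    and le: "2 * f1 * e1 \<le> n" "2 * f2 * e2 \<le> n"
    and eq: "1 - 2 / n = (1 - 1 / e1) / f1 + (1 - 1 / e2) / f2"
  shows "(e1 \<ge> 3 \<and> n \<le> 24 * e1) \<or> (e2 \<ge> 3 \<and> n \<le> 24 * e2)"
proof -
  define q r1 r2 where "q = 1 / n" and "r1 = 1 / real e1" and "r2 = 1 / real e2"
  have q: "q > 0" using n by (simp add: q_def)
  note r = recip_cases(3)[OF e(1), folded r1_def] recip_cases(3)[OF e(2), folded r2_def]
  have eq': "1 - 2 * q = (1 - r1) / f1 + (1 - r2) / f2" using eq by (simp add: q_def r1_def r2_def)
  consider "f1 = 1" "f2 = 1" | "f1 = 1" "f2 = 2" | "f1 = 2" "f2 = 1" | "f1 = 2" "f2 = 2" using f by blast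
  then show ?thesis
  proof cases
    case 1
    then show ?thesis using eq' r q by simp
  next
    case 2
    then show ?thesis using class_equation_2'[OF n e] eq by simp
  next
    case 3
    then show ?thesis using class_equation_2'[OF n e(2,1)] eq by simp
  next
    case 4
    have "r1 \<ge> 4 * q" "r2 \<ge> 4 * q" using le 4 n e by (simp_all add: q_def r1_def r2_def field_simps)
    moreover have "1 - 2 * q = (1 - r1) / 2 + (1 - r2) / 2" using eq' 4 by simp
    then have "r1 + r2 = 4 * q" by (simp add: field_simps)
    ultimately show ?thesis using q by linarith
  qed
qed

text \<open>Only e1 = 2 lets the sum exceed 1. Then e2 = 2 is dihedral with n = 4 e3, and e2 = 3
  gives n (6 - e3) = 24 e3 with e3 < 6: the binary tetrahedral, octahedral and icosahedral groups of
  orders 24, 48 and 120. The last one attains n = 24 e3 and is the origin of the factor 24.\<close>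

lemma class_equation_3':
  fixes n :: real and e1 e2 e3 :: nat
  assumes n: "n > 24" and e: "2 \<le> e1" "e1 \<le> e2" "e2 \<le> e3"
    and eq: "1 / e1 + 1 / e2 + 1 / e3 = 1 + 4 * (1 / n)"
  shows "e3 \<ge> 3 \<and> n \<le> 24 * e3"
proof -
  define q r1 r2 r3 where "q = 1 / n" and "r1 = 1 / real e1" and "r2 = 1 / real e2" and "r3 = 1 / real e3"
  have q: "q > 0" "q < 1 / 24" using n by (simp_all add: q_def field_simps)
  have eq': "r1 + r2 + r3 = 1 + 4 * q" using eq by (simp only: q_def r1_def r2_def r3_def)
  have le: "r3 \<le> r2" "r2 \<le> r1" using e by (simp_all add: r1_def r2_def r3_def field_simps)
  have "e1 = 2"
  proof (rule ccontr)
    assume "e1 \<noteq> 2"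
    then have "r1 \<le> 1 / 3" using e(1) by (simp add: r1_def field_simps)
    then show False using eq' le q by linarith
  qed
  then have 1: "r2 + r3 = 1 / 2 + 4 * q" using eq' by (simp add: r1_def)
  have e23: "e2 \<ge> 2" "e3 \<ge> 2" using e by auto
  then consider "e2 = 2" | "e2 = 3" | "r2 \<le> 1 / 4"
    using recip_cases(2) unfolding r2_def by blast
  then show ?thesis
  proof cases
    case 1
    then have "r3 = 4 * q" using \<open>r2 + r3 = 1 / 2 + 4 * q\<close> by (simp add: r2_def)
    then have "n = 4 * e3" using n e by (simp add: r3_def q_def field_simps)
    then show ?thesis using n by auto
  next
    case 2
    then have r: "r3 = 1 / 6 + 4 * q" using 1 by (simp add: r2_def)
    then have "1 / real e3 > 1 / 6" using q by (simp add: r3_def)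
    then have "e3 < 6" using e23 by (simp add: field_simps)
    then have "6 - real e3 \<ge> 1" by simp
    moreover have "n * (6 - real e3) = 24 * real e3" using r n e23 by (simp add: r3_def q_def field_simps)
    moreover have "n * 1 \<le> n * (6 - real e3)" using calculation(1) n by (intro mult_left_mono) auto
    ultimately show ?thesis using 2 e by simp
  next
    case 3
    then show ?thesis using 1 le q by linarith
  qed
qed

text \<open>Each weight is at least 1/4, and at least 1/2 when f = 1, while the total stays below 1.
  So all three f are 2, and it remains to order the three e.\<close>

lemma class_equation_3:
  fixes n :: real and e1 e2 e3 f1 f2 f3 :: nat
  assumes n: "n > 24" and e: "e1 \<ge> 2" "e2 \<ge> 2" "e3 \<ge> 2"
    and f: "f1 = 1 \<or> f1 = 2" "f2 = 1 \<or> f2 = 2" "f3 = 1 \<or> f3 = 2"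
    and eq: "1 - 2 / n = (1 - 1 / e1) / f1 + (1 - 1 / e2) / f2 + (1 - 1 / e3) / f3"
  shows "\<exists>e\<in>{e1, e2, e3}. e \<ge> 3 \<and> n \<le> 24 * e"
proof -
  define q where "q = 1 / n"
  define w where "w e f = (1 - 1 / real e) / real f" for e f :: nat
  have q: "q > 0" using n by (simp add: q_def)
  have w4: "w e f \<ge> 1 / 4" and w2: "f = 1 \<Longrightarrow> w e f \<ge> 1 / 2" if "e \<ge> 2" "f = 1 \<or> f = 2" for e f
    using recip_cases(3)[OF that(1)] that(2) by (auto simp: w_def)
  have eq': "1 - 2 * q = w e1 f1 + w e2 f2 + w e3 f3" using eq by (simp add: w_def q_def)
  have f': "f1 = 2" "f2 = 2" "f3 = 2"
    using f eq' q w4[OF e(1) f(1)] w4[OF e(2) f(2)] w4[OF e(3) f(3)]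
      w2[OF e(1) f(1)] w2[OF e(2) f(2)] w2[OF e(3) f(3)] by linarith+
  define r1 r2 r3 where "r1 = 1 / real e1" and "r2 = 1 / real e2" and "r3 = 1 / real e3"
  have "1 - 2 * q = (1 - r1) / 2 + (1 - r2) / 2 + (1 - r3) / 2"
    using eq' by (simp add: w_def f' r1_def r2_def r3_def)
  then have "r1 + r2 + r3 = 1 + 4 * q" by (simp add: field_simps)
  then have *: "1 / real e1 + 1 / real e2 + 1 / real e3 = 1 + 4 * (1 / n)"
    by (simp only: r1_def r2_def r3_def q_def)
  consider "e1 \<le> e2" "e2 \<le> e3" | "e1 \<le> e3" "e3 \<le> e2" | "e2 \<le> e1" "e1 \<le> e3"
    | "e2 \<le> e3" "e3 \<le> e1" | "e3 \<le> e1" "e1 \<le> e2" | "e3 \<le> e2" "e2 \<le> e1" by linarith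
  then show ?thesis
    using class_equation_3'[OF n e(1), of e2 e3] class_equation_3'[OF n e(1), of e3 e2]
      class_equation_3'[OF n e(2), of e1 e3] class_equation_3'[OF n e(2), of e3 e1]
      class_equation_3'[OF n e(3), of e1 e2] class_equation_3'[OF n e(3), of e2 e1] *
    by cases (simp_all only: add.commute add.left_commute bex_simps insert_iff, blast+)
qed

context finite_semisimple
begin

lemma weight:
  assumes "g \<in> X"
  obtains e f where "e \<ge> 2" "f = 1 \<or> f = 2" "card (C g) = 2 * e" "2 * f * e \<le> card \<Gamma>"
    "real (card (Orb g)) / card \<Gamma> = (1 - 1 / e) / f" "real (card (Orb g)) / card \<Gamma> \<ge> 1 / 4"
proof -
  obtain e f where *: "e \<ge> 2" "f = 1 \<or> f = 2" "card (C g) = 2 * e" "2 * f * e \<le> card \<Gamma>"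
    "card (Orb g) * (f * e) = card \<Gamma> * (e - 1)" by (rule Orb_data[OF assms])
  have pos: "real (card \<Gamma>) > 0" "real f > 0" "real e > 0" using D(1) *(1,2) by (auto simp: card_gt_0_iff)
  have "real (card (Orb g)) * (f * e) = real (card \<Gamma>) * (real e - 1)"
    using arg_cong[OF *(5), of real] *(1) by (simp add: of_nat_diff)
  then have "real (card (Orb g)) / card \<Gamma> = (real e - 1) / (f * e)"
    using pos by (subst frac_eq_eq) (auto simp: mult.commute)
  also have "\<dots> = (1 - 1 / e) / f" using pos by (simp add: field_simps)
  finally have w: "real (card (Orb g)) / card \<Gamma> = (1 - 1 / e) / f" .
  moreover have "(1 - 1 / e) / f \<ge> 1 / 4" using *(2) recip_cases(3)[OF *(1)] by auto
  ultimately show thesis using that * by metis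
qed

text \<open>The set X has weight 1 - 2/n in \<Gamma>, n being the order of \<Gamma>, and each piece
  weighs at least 1/4, so there are at most three pieces and the class equation has one, two or
  three terms. The two bounds are e \<ge> 3 and n \<le> 24 e for e half the order of C g.\<close>

lemma large_commutant:
  assumes big: "card \<Gamma> > 24"
  shows "\<exists>g\<in>X. card (C g) \<ge> 6 \<and> card \<Gamma> \<le> 12 * card (C g)"
proof -
  let ?n = "real (card \<Gamma>)"
  have n: "?n > 24" using big by simp
  have good: ?thesis if "g \<in> X" "card (C g) = 2 * e" "e \<ge> 3 \<and> ?n \<le> 24 * real e" for g e
    using that by (intro bexI[of _ g]) auto
  have cX: "card X = card \<Gamma> - 2" using card_Z Z_sub by (simp add: X_def card_Diff_subset)
  then have cX': "real (card X) / ?n = 1 - 2 / ?n" using big D(1) by (auto simp: of_nat_diff diff_divide_distrib)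
  have "card X \<noteq> 0" unfolding cX using big by simp
  then have "X \<noteq> {}" by auto
  then obtain g1 where g1: "g1 \<in> X" by blast
  obtain e1 f1 where 1: "e1 \<ge> 2" "f1 = 1 \<or> f1 = 2" "card (C g1) = 2 * e1" "2 * f1 * e1 \<le> card \<Gamma>"
    "real (card (Orb g1)) / ?n = (1 - 1 / e1) / f1" "real (card (Orb g1)) / ?n \<ge> 1 / 4" by (rule weight[OF g1])
  show ?thesis
  proof (cases "X = Orb g1")
    case True
    then show ?thesis using good[OF g1 1(3)] class_equation_1[OF n 1(1,2)] 1(5) cX' by simp
  next
    case False
    then obtain g2 where g2: "g2 \<in> X" "g2 \<notin> Orb g1" using Orb_X[OF g1] by blast
    obtain e2 f2 where 2: "e2 \<ge> 2" "f2 = 1 \<or> f2 = 2" "card (C g2) = 2 * e2" "2 * f2 * e2 \<le> card \<Gamma>"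
      "real (card (Orb g2)) / ?n = (1 - 1 / e2) / f2" "real (card (Orb g2)) / ?n \<ge> 1 / 4" by (rule weight[OF g2(1)])
    have d12: "Orb g1 \<inter> Orb g2 = {}" by (rule Orb_disjoint[OF g1 g2])
    then have c12: "card (Orb g1 \<union> Orb g2) = card (Orb g1) + card (Orb g2)" by (simp add: card_Un_disjoint)
    show ?thesis
    proof (cases "X = Orb g1 \<union> Orb g2")
      case True
      then have "1 - 2 / ?n = (1 - 1 / e1) / f1 + (1 - 1 / e2) / f2"
        using c12 1(5) 2(5) cX' by (simp add: add_divide_distrib)
      moreover have "real (2 * f1 * e1) \<le> ?n" "real (2 * f2 * e2) \<le> ?n"
        using 1(4) 2(4) by (simp_all only: of_nat_le_iff)
      ultimately have "(e1 \<ge> 3 \<and> ?n \<le> real (24 * e1)) \<or> (e2 \<ge> 3 \<and> ?n \<le> real (24 * e2))"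
        by (intro class_equation_2[OF n 1(1) 2(1) 1(2) 2(2)])
      then have "(e1 \<ge> 3 \<and> ?n \<le> 24 * real e1) \<or> (e2 \<ge> 3 \<and> ?n \<le> 24 * real e2)" by simp
      then show ?thesis using good[OF g1 1(3)] good[OF g2(1) 2(3)] by blast
    next
      case False
      then obtain g3 where g3: "g3 \<in> X" "g3 \<notin> Orb g1" "g3 \<notin> Orb g2" using Orb_X[OF g1] Orb_X[OF g2(1)] by blast
      obtain e3 f3 where 3: "e3 \<ge> 2" "f3 = 1 \<or> f3 = 2" "card (C g3) = 2 * e3" "2 * f3 * e3 \<le> card \<Gamma>"
        "real (card (Orb g3)) / ?n = (1 - 1 / e3) / f3" "real (card (Orb g3)) / ?n \<ge> 1 / 4" by (rule weight[OF g3(1)])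
      have d3: "(Orb g1 \<union> Orb g2) \<inter> Orb g3 = {}"
        using Orb_disjoint[OF g1 g3(1,2)] Orb_disjoint[OF g2(1) g3(1,3)] by blast
      then have c3: "card (Orb g1 \<union> Orb g2 \<union> Orb g3) = card (Orb g1) + card (Orb g2) + card (Orb g3)"
        using c12 by (simp add: card_Un_disjoint)
      have "X = Orb g1 \<union> Orb g2 \<union> Orb g3"
      proof (rule ccontr)
        assume "X \<noteq> Orb g1 \<union> Orb g2 \<union> Orb g3"
        then obtain g4 where g4: "g4 \<in> X" "g4 \<notin> Orb g1" "g4 \<notin> Orb g2" "g4 \<notin> Orb g3"
          using Orb_X[OF g1] Orb_X[OF g2(1)] Orb_X[OF g3(1)] by blast
        obtain e4 f4 where 4: "real (card (Orb g4)) / ?n = (1 - 1 / real e4) / real f4"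
            "real (card (Orb g4)) / ?n \<ge> 1 / 4" by (rule weight[OF g4(1)])
        have d4: "(Orb g1 \<union> Orb g2 \<union> Orb g3) \<inter> Orb g4 = {}"
          using Orb_disjoint[OF g1 g4(1,2)] Orb_disjoint[OF g2(1) g4(1,3)] Orb_disjoint[OF g3(1) g4(1,4)] by blast
        have "card (Orb g1) + card (Orb g2) + card (Orb g3) + card (Orb g4) = card (Orb g1 \<union> Orb g2 \<union> Orb g3 \<union> Orb g4)"
          using c3 d4 by (simp add: card_Un_disjoint)
        also have "\<dots> \<le> card X"
          using Orb_X[OF g1] Orb_X[OF g2(1)] Orb_X[OF g3(1)] Orb_X[OF g4(1)] by (intro card_mono) auto
        finally have "real (card (Orb g1) + card (Orb g2) + card (Orb g3) + card (Orb g4)) / ?n \<le> real (card X) / ?n"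
          by (intro divide_right_mono) (simp_all only: of_nat_le_iff of_nat_0_le_iff)
        then have "real (card (Orb g1)) / ?n + real (card (Orb g2)) / ?n + real (card (Orb g3)) / ?n
            + real (card (Orb g4)) / ?n \<le> 1 - 2 / ?n"
          unfolding cX' by (simp only: add_divide_distrib of_nat_add)
        moreover have "2 / ?n > 0" using n by simp
        ultimately show False using 1(6) 2(6) 3(6) 4(2) by linarith
      qed
      then have "1 - 2 / ?n = (1 - 1 / e1) / f1 + (1 - 1 / e2) / f2 + (1 - 1 / e3) / f3"
        using c3 1(5) 2(5) 3(5) cX' by (simp add: add_divide_distrib)
      from class_equation_3[OF n 1(1) 2(1) 3(1) 1(2) 2(2) 3(2) this]
      have "\<exists>e\<in>{e1, e2, e3}. e \<ge> 3 \<and> ?n \<le> 24 * real e" by simp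
      then show ?thesis using good[OF g1 1(3)] good[OF g2(1) 2(3)] good[OF g3(1) 3(3)] by blast
    qed
  qed
qed

text \<open>If g and a + b g both have trace 0 and determinant 1, the latter is g or - g. So a
  centraliser without a generic element has at most four elements: 1, -1, g and - g.\<close>

lemma commutant_generic:
  assumes g: "g \<in> X" and c: "card (C g) \<ge> 6"
  shows "\<exists>x\<in>C g. trace x ^ 2 \<noteq> 0 \<and> trace x ^ 2 \<noteq> 4"
proof (rule ccontr)
  assume *: "\<not> ?thesis"
  have t0: "trace y = 0" if "y \<in> K g" for y
    using * that X_D(3)[OF K_X[OF that]] by (auto simp: K_def)
  have gK: "g \<in> K g" by (rule self_K[OF g])
  have "y = g \<or> y = - g" if y: "y \<in> K g" for y
  proof -
    obtain a b where ab: "y = mat a + smul b g" using C_form[OF g K_C[OF y]] by blast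
    have "trace y = 2 * a + b * trace g" by (simp add: ab trace_2 algebra_simps)
    then have "2 * a = 0" using t0[OF y] t0[OF gK] by simp
    then have a: "a = 0" using two by simp
    have "b ^ 2 = 1" using X_D(2)[OF K_X[OF y]] X_D(2)[OF g] by (simp add: ab a det_smul)
    then have "b = 1 \<or> b = -1" by (simp add: power2_eq_1_iff)
    then show ?thesis by (auto simp: ab a mat2_eq_iff)
  qed
  then have "C g \<subseteq> {mat 1, - mat 1, g, - g}" by (auto simp: K_def Z_def)
  then have "card (C g) \<le> card {mat 1, - mat 1, g, - g}" by (intro card_mono) auto
  also have "\<dots> \<le> 4" by (simp add: card_insert_if)
  finally show False using c by simp
qed

end

section \<open>Groups containing a transvection, and the subgroup of index at most twelve\<close>

lemma mpow_upper: "mpow (upper z) n = upper (of_nat n * z)"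
  by (induction n) (simp_all add: mat2_simps upper_def algebra_simps)

lemma unipotent_triangular:
  assumes "det g = 1" "trace g = 2" "g$2$1 = 0" shows "g = upper (g$1$2 :: 'a::field)"
proof -
  have "g$1$1 * g$2$2 = 1" "g$2$2 = 2 - g$1$1" using assms by (simp_all add: det_2 trace_2 algebra_simps)
  then have "(g$1$1 - 1) ^ 2 = 0" by (simp add: power2_eq_square algebra_simps)
  then show ?thesis using \<open>g$2$2 = 2 - g$1$1\<close> assms(3) by (simp add: mat2_simps upper_def)
qed

text \<open>The field is prime, so the powers of one transvection give all upper ones. An element
  with nonzero lower left entry, multiplied by upper transvections on both sides, becomes
  antidiagonal, and conjugation by it turns upper into lower transvections.\<close>

lemma SL2_generated_by_transvection:
  fixes G :: "('p::prime_card mod_ring ^ 2 ^ 2) set"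
  assumes G: "sl2_subgroup G" and u: "upper z \<in> G" "z \<noteq> 0" and g: "g \<in> G" "g$2$1 \<noteq> 0"
  shows "SL2 \<subseteq> G"
proof
  note D = sl2_subgroupD[OF G]
  have up: "upper w \<in> G" for w
  proof -
    obtain n where "w / z = of_nat n" using surj_of_nat_mod_ring by metis
    then have "w = of_nat n * z" using u(2) by (simp add: field_simps)
    then show ?thesis using sl2_subgroup_mpow[OF G u(1), of n] by (simp add: mpow_upper)
  qed
  define c where "c = g$2$1"
  define w where "w = upper (- g$1$1 / c) ** g ** upper (- g$2$2 / c)"
  have w: "w \<in> G" unfolding w_def by (intro D up g)
  have "g$1$2 * c = g$1$1 * g$2$2 - 1" using D(4)[OF g(1)] by (simp add: det_2 c_def algebra_simps)
  then have w_eq: "w = mat2 0 (- 1 / c) c 0"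
    using g(2) by (simp add: w_def upper_def mat2_simps c_def field_simps)
  have lo: "lower y \<in> G" for y
  proof -
    have "lower y = w ** upper (- y / (c * c)) ** adj w"
      using g(2) by (simp add: w_eq lower_def upper_def mat2_simps c_def field_simps)
    then show ?thesis using w up D by metis
  qed
  fix x :: "'p mod_ring ^ 2 ^ 2" assume "x \<in> SL2"
  then have det: "det x = 1" by (simp add: SL2_def)
  then have "x$1$1 \<noteq> 0 \<or> x$2$1 \<noteq> 0" by (auto simp: det_2)
  then have "x$1$1 dvd 1 \<or> x$2$1 dvd 1" by (auto simp: dvd_field_iff)
  then show "x \<in> G" by (intro elementary_generate[of G x] D(2) up lo det)
qed

lemma SL2_conj:
  fixes P :: "'a::comm_ring_1 ^ 2 ^ 2" and G :: "('a ^ 2 ^ 2) set"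
  shows "det P = 1 \<Longrightarrow> SL2 \<subseteq> cj P ` G \<Longrightarrow> SL2 \<subseteq> G"
proof
  fix x :: "'a ^ 2 ^ 2" assume P: "det P = 1" "SL2 \<subseteq> cj P ` G" and "x \<in> SL2"
  then have "det (cj P x) = 1" by (simp add: SL2_def cj_def det_mul)
  then obtain y where "y \<in> G" "cj P x = cj P y" using P(2) by (auto simp: SL2_def)
  then show "x \<in> G" using cj_simps(5)[OF P(1)] by simp
qed

text \<open>A matrix of determinant 1 is determined by its first column and one further entry. For
  three elements the bound is 24, which puts that field among the small cases below.\<close>

lemma card_SL2_le:
  "card (SL2 :: ('a::{field,finite} ^ 2 ^ 2) set) \<le> (CARD('a) * CARD('a) - 1) * CARD('a)"
proof -
  let ?f = "\<lambda>x :: 'a ^ 2 ^ 2. ((x$1$1, x$2$1), if x$1$1 = 0 then x$2$2 else x$1$2)"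
  have "inj_on ?f SL2"
  proof (rule inj_onI)
    fix x y :: "'a ^ 2 ^ 2" assume "x \<in> SL2" "y \<in> SL2" and eq: "?f x = ?f y"
    then have d: "x$1$1 * x$2$2 - x$1$2 * x$2$1 = 1" "y$1$1 * y$2$2 - y$1$2 * y$2$1 = 1"
      by (simp_all add: SL2_def det_2)
    have e: "y$1$1 = x$1$1" "y$2$1 = x$2$1" using eq by auto
    show "x = y"
    proof (cases "x$1$1 = 0")
      case True
      then have "- (x$1$2 * x$2$1) = 1" "- (y$1$2 * x$2$1) = 1" using d e by simp_all
      then have "x$1$2 * x$2$1 = - 1" "y$1$2 * x$2$1 = - 1" by (metis minus_minus)+
      then have "x$2$1 \<noteq> 0" "x$1$2 * x$2$1 = y$1$2 * x$2$1" by auto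
      then show ?thesis using eq e True by (simp add: mat2_eq_iff)
    next
      case False
      then have "x$1$2 = y$1$2" using eq e by simp
      then have "x$1$1 * x$2$2 = x$1$1 * y$2$2" using d e by (simp add: algebra_simps)
      then show ?thesis using False e \<open>x$1$2 = y$1$2\<close> by (simp add: mat2_eq_iff)
    qed
  qed
  then have "card (SL2 :: ('a ^ 2 ^ 2) set) = card (?f ` SL2)" by (simp add: card_image)
  also have "\<dots> \<le> card ((UNIV - {(0 :: 'a, 0 :: 'a)}) \<times> (UNIV :: 'a set))"
    by (intro card_mono) (auto simp: SL2_def det_2)
  also have "\<dots> = (CARD('a) * CARD('a) - 1) * CARD('a)" by (simp add: card_cartesian_product card_Diff_singleton)
  finally show ?thesis .
qed

lemma trace_4_cases:
  assumes "trace x ^ 2 = (4 :: 'a::field)" shows "trace x = 2 \<or> trace x = -2"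
proof -
  have "(trace x - 2) * (trace x + 2) = 0" using assms by (simp add: power2_eq_square algebra_simps)
  then show ?thesis by (auto simp: eq_neg_iff_add_eq_0)
qed

lemma pm_toral: "toral {mat 1, - mat 1 :: 'a::field ^ 2 ^ 2}"
  by (rule borel_toral[of "mat 1"]) (auto simp: adj_mat, simp_all add: det_2)

lemma torus_like_subgroup:
  fixes G :: "('a::field ^ 2 ^ 2) set"
  assumes G: "sl2_subgroup G" and minus: "- mat 1 \<in> G" and tl: "torus_like G"
  shows "sl2_subgroup {x \<in> G. trace x ^ 2 = 4}"
  unfolding sl2_subgroup_def
proof (intro conjI ballI)
  note D = sl2_subgroupD[OF G] and T = torus_likeD[OF tl G]
  show "{x \<in> G. trace x ^ 2 = 4} \<subseteq> SL2" using G by (auto simp: sl2_subgroup_def)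
  show "mat 1 \<in> {x \<in> G. trace x ^ 2 = 4}" using D(1) by (simp add: trace_2)
  fix x assume x: "x \<in> {x \<in> G. trace x ^ 2 = 4}"
  then show "adj x \<in> {x \<in> G. trace x ^ 2 = 4}" using D(3) by simp
  fix y assume y: "y \<in> {x \<in> G. trace x ^ 2 = 4}"
  have s: "\<exists>x'\<in>G. (x' = x \<or> x' = - x) \<and> trace x' = 2" if "x \<in> G" "trace x ^ 2 = 4" for x
    using trace_4_cases[OF that(2)]
  proof
    assume "trace x = -2"
    then show ?thesis using sl2_subgroup_minus[OF G minus that(1)] by (intro bexI[of _ "- x"]) (auto simp: trace_minus_2)
  qed (use that in blast)
  obtain x' y' where "x' \<in> G" "x' = x \<or> x' = - x" "trace x' = 2" "y' \<in> G" "y' = y \<or> y' = - y" "trace y' = 2"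
    using s[of x] s[of y] x y by blast
  moreover from this have "trace (x' ** y') = 2" using T(1) by blast
  ultimately have "trace (x ** y) = 2 \<or> - trace (x ** y) = 2"
    by (auto simp: minus_mult_2 trace_minus_2)
  then have "trace (x ** y) ^ 2 = 2 ^ 2" by (metis power2_minus)
  then show "x ** y \<in> {x \<in> G. trace x ^ 2 = 4}" using x y D(2) by simp
qed

text \<open>A group of order at most 24 is served by {1, -1}. Without nontrivial unipotents the
  class equation supplies a large centraliser. With one, either its fixed line is invariant, so that
  G is triangular and at worst the elements of square trace 4, a subgroup of index two, must be
  taken; or a transvection and an element moving the line generate SL_2, which for l = 3 has order
  at most 24.\<close>

theorem subgroup_classification:
  fixes G :: "('p::prime_card mod_ring ^ 2 ^ 2) set"
  assumes odd: "odd CARD('p)" and G: "sl2_subgroup G" and minus: "- mat 1 \<in> G"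
  shows "(G = SL2 \<and> CARD('p) \<ge> 5) \<or>
    (\<exists>H. H \<subseteq> G \<and> sl2_subgroup H \<and> - mat 1 \<in> H \<and> card G \<le> 12 * card H \<and> toral H \<and> trace_generic H)"
proof -
  note D = sl2_subgroupD[OF G]
  have two: "(2 :: 'p mod_ring) \<noteq> 0" by (rule two_mod_ring_nonzero[OF odd])
  have neq: "mat 1 \<noteq> (- mat 1 :: 'p mod_ring ^ 2 ^ 2)"
  proof
    assume "mat 1 = (- mat 1 :: 'p mod_ring ^ 2 ^ 2)"
    then have "(1 :: 'p mod_ring) = -1" by (simp add: mat2_eq_iff)
    then show False using two by (metis add_eq_0_iff one_add_one)
  qed
  have small: ?thesis if "card G \<le> 24"
  proof -
    let ?H = "{mat 1, - mat 1 :: 'p mod_ring ^ 2 ^ 2}"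
    have "card ?H = 2" using neq by simp
    moreover have "trace_generic ?H" by (simp add: trace_generic_def trace_2)
    ultimately show ?thesis
      using D(1) minus that sl2_subgroup_pm pm_toral by (intro disjI2 exI[of _ ?H]) auto
  qed
  show ?thesis
  proof (cases "\<forall>u\<in>G. trace u ^ 2 = 4 \<longrightarrow> u = mat 1 \<or> u = - mat 1")
    case True
    interpret finite_semisimple G by unfold_locales (use two G minus True in auto)
    show ?thesis
    proof (cases "card G \<le> 24")
      case False
      then obtain g where g: "g \<in> X" "card (C g) \<ge> 6" "card G \<le> 12 * card (C g)" using large_commutant by auto
      have "toral (C g)"
        using C_form[OF g(1)] D(4) by (intro commutant_toral[OF X_D(2)[OF g(1)]]) (auto simp: C_def)
      moreover have "trace_generic (C g)" unfolding trace_generic_def using commutant_generic[OF g(1,2)] by blast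
      moreover have "- mat 1 \<in> C g" using Z_C by (auto simp: Z_def)
      moreover have "C g \<subseteq> G" by (auto simp: C_def)
      ultimately show ?thesis using g(3) C_subgroup[OF g(1)] by (intro disjI2 exI[of _ "C g"]) simp
    qed (rule small)
  next
    case False
    then obtain v where v: "v \<in> G" "trace v ^ 2 = 4" "v \<noteq> mat 1" "v \<noteq> - mat 1" by blast
    obtain u where u: "u \<in> G" "trace u = 2" "u \<noteq> mat 1"
      using trace_4_cases[OF v(2)]
    proof
      assume "trace v = -2"
      moreover have "- v \<noteq> mat 1" using v(4) by (metis minus_minus)
      ultimately show thesis using that[of "- v"] sl2_subgroup_minus[OF G minus v(1)] by (simp add: trace_minus_2)
    qed (use that v in blast)
    obtain P where P: "det P = 1" "(adj P ** u ** P)$2$1 = 0"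
      by (rule eigenvalue_imp_triangular[OF D(4)[OF u(1)], of 1]) (simp add: u)
    have cjP: "adj P ** x ** P = cj (adj P) x" for x by (simp add: cj_def)
    have dP: "det (adj P) = 1" using P(1) by simp
    have cG: "sl2_subgroup (cj (adj P) ` G)"
      unfolding sl2_subgroup_def
    proof (intro conjI ballI)
      show "cj (adj P) ` G \<subseteq> SL2" using D(4) P(1) by (auto simp: SL2_def cj_def det_mul)
      show "mat 1 \<in> cj (adj P) ` G" using cj_simps(6)[OF dP] D(1) by (metis imageI)
      fix x assume "x \<in> cj (adj P) ` G"
      then obtain a where a: "a \<in> G" "x = cj (adj P) a" by blast
      then show "adj x \<in> cj (adj P) ` G" using D(3) by (simp add: adj_cj)
      fix y assume "y \<in> cj (adj P) ` G"
      then obtain b where b: "b \<in> G" "y = cj (adj P) b" by blast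
      show "x ** y \<in> cj (adj P) ` G" using a b D(2) cj_simps(1)[OF dP] by (metis imageI)
    qed
    show ?thesis
    proof (cases "\<forall>g\<in>G. (adj P ** g ** P)$2$1 = 0")
      case True
      have tor: "toral G" by (rule borel_toral[OF P(1)]) (use True D(4) in blast)
      have tl: "torus_like G" by (rule toral_imp_torus_like[OF G tor two])
      show ?thesis
      proof (cases "trace_generic G")
        case True
        then show ?thesis using G minus tor by (intro disjI2 exI[of _ G]) simp
      next
        case False
        then have tr: "\<And>x. x \<in> G \<Longrightarrow> trace x = 0 \<or> trace x ^ 2 = 4" by (auto simp: trace_generic_def)
        obtain h where h: "h \<in> G" "trace h = 0" using False tr by (auto simp: trace_generic_def)
        let ?H = "{x \<in> G. trace x ^ 2 = 4}"
        have "G \<subseteq> ?H \<union> (\<lambda>x. h ** x) ` ?H"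
        proof
          fix x assume x: "x \<in> G"
          show "x \<in> ?H \<union> (\<lambda>x. h ** x) ` ?H"
          proof (cases "trace x = 0")
            case True
            then have "trace (adj h ** x) ^ 2 = 4"
              using torus_likeD(4)[OF tl G D(3)[OF h(1)] x] h by simp
            then have "adj h ** x \<in> ?H" using D h x by simp
            moreover have "x = h ** (adj h ** x)" using D(4)[OF h(1)] by (simp add: adj_cancel)
            ultimately show ?thesis by blast
          qed (use tr x in blast)
        qed
        then have "card G \<le> card (?H \<union> (\<lambda>x. h ** x) ` ?H)" by (intro card_mono) auto
        also have "\<dots> \<le> card ?H + card ((\<lambda>x. h ** x) ` ?H)" by (rule card_Un_le)
        also have "\<dots> \<le> card ?H + card ?H" by (intro add_left_mono card_image_le) simp
        finally have "card G \<le> 12 * card ?H" by simp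
        moreover have "toral ?H" using tor by (rule toral_subset) blast
        moreover have "trace_generic ?H" by (simp add: trace_generic_def)
        moreover have "- mat 1 \<in> ?H" using minus by (simp add: trace_2)
        ultimately show ?thesis using torus_like_subgroup[OF G minus tl]
          by (intro disjI2 exI[of _ ?H]) auto
      qed
    next
      case False
      then obtain g where g: "g \<in> G" "(cj (adj P) g)$2$1 \<noteq> 0" using cjP by metis
      have tu: "trace (cj (adj P) u) = 2" using u(2) cj_simps(4)[OF dP] by simp
      have "det (cj (adj P) u) = 1" using sl2_subgroupD(4)[OF cG] u(1) by blast
      from unipotent_triangular[OF this tu] P(2) obtain z where z: "cj (adj P) u = upper z" by (auto simp: cjP)
      have "z \<noteq> 0"
      proof
        assume "z = 0"
        then have "cj (adj P) u = cj (adj P) (mat 1)" using z cj_simps(6)[OF dP] by (simp add: upper_def mat2_eq_iff)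
        then show False using u(3) cj_simps(5)[OF dP] by blast
      qed
      then have "SL2 \<subseteq> cj (adj P) ` G"
        using g imageI[OF u(1), of "cj (adj P)", unfolded z]
        by (intro SL2_generated_by_transvection[OF cG, of z "cj (adj P) g"]) auto
      then have "SL2 \<subseteq> G" by (rule SL2_conj[OF dP])
      then have SL: "G = SL2" using G by (auto simp: sl2_subgroup_def)
      show ?thesis
      proof (cases "CARD('p) \<ge> 5")
        case False
        have "CARD('p) \<noteq> 4" "CARD('p) \<noteq> 2" using odd by auto
        then have "CARD('p) = 3" using False prime_ge_2_nat[OF prime_card[where 'a='p]] by linarith
        then have "card G \<le> 24" using card_SL2_le[where 'a="'p mod_ring"] SL by simp
        then show ?thesis by (rule small)
      qed (use SL in blast)
    qed
  qed
qed

section \<open>The maximal normal pro-\<open>\<ell>\<close> subgroup\<close>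

lemma group_sl2_subgroup: "sl2_subgroup X \<Longrightarrow> group (GL2\<lparr>carrier := X\<rparr>)"
  by (rule group.subgroup_imp_group[OF group_GL2 sl2_subgroup_imp_subgroup])

lemma inv_sl2_subgroup: "sl2_subgroup X \<Longrightarrow> x \<in> X \<Longrightarrow> inv\<^bsub>GL2\<lparr>carrier := X\<rparr>\<^esub> x = adj x"
  using group.m_inv_consistent[OF group_GL2 sl2_subgroup_imp_subgroup] inv_GL2_SL2 sl2_subgroupD(4) by metis

lemma subgroup_sl2_subgroup_iff:
  assumes X: "sl2_subgroup X"
  shows "subgroup H (GL2\<lparr>carrier := X\<rparr>) \<longleftrightarrow> sl2_subgroup H \<and> H \<subseteq> X"
proof
  assume H: "subgroup H (GL2\<lparr>carrier := X\<rparr>)"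
  then have sub: "H \<subseteq> X" using subgroup.subset[OF H] by simp
  moreover have "mat 1 \<in> H" using subgroup.one_closed[OF H] by simp
  moreover have "x ** y \<in> H" if "x \<in> H" "y \<in> H" for x y using subgroup.m_closed[OF H that] by simp
  moreover have "adj x \<in> H" if "x \<in> H" for x
    using subgroup.m_inv_closed[OF H that] inv_sl2_subgroup[OF X] sub that by auto
  ultimately show "sl2_subgroup H \<and> H \<subseteq> X" using X by (auto simp: sl2_subgroup_def)
next
  assume "sl2_subgroup H \<and> H \<subseteq> X"
  then show "subgroup H (GL2\<lparr>carrier := X\<rparr>)"
    using group.subgroup_incl[OF group_GL2] sl2_subgroup_imp_subgroup X by blast
qed

lemma normal_sl2_subgroup_iff:
  assumes X: "sl2_subgroup X"
  shows "H \<lhd> GL2\<lparr>carrier := X\<rparr> \<longleftrightarrow> sl2_subgroup H \<and> H \<subseteq> X \<and> (\<forall>x\<in>X. \<forall>h\<in>H. x ** h ** adj x \<in> H)"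
  using group.normal_inv_iff[OF group_sl2_subgroup[OF X], of H] inv_sl2_subgroup[OF X]
  unfolding subgroup_sl2_subgroup_iff[OF X] by auto

lemma pow_sl2_subgroup:
  assumes X: "sl2_subgroup X" and "x \<in> X"
  shows "x [^]\<^bsub>GL2\<lparr>carrier := X\<rparr>\<^esub> (n :: nat) = mpow x n"
proof -
  interpret group "GL2\<lparr>carrier := X\<rparr>" by (rule group_sl2_subgroup[OF X])
  show ?thesis by (induction n) (simp_all add: mpow_commute)
qed

lemma r_coset_eq_iff:
  assumes X: "sl2_subgroup X" and H: "sl2_subgroup H" "H \<subseteq> X" and ab: "a \<in> X" "b \<in> X"
  shows "H #>\<^bsub>GL2\<lparr>carrier := X\<rparr>\<^esub> a = H #>\<^bsub>GL2\<lparr>carrier := X\<rparr>\<^esub> b \<longleftrightarrow> a ** adj b \<in> H"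
proof -
  let ?G = "GL2\<lparr>carrier := X\<rparr>"
  interpret group ?G by (rule group_sl2_subgroup[OF X])
  have sH: "subgroup H ?G" using H subgroup_sl2_subgroup_iff[OF X] by blast
  have db: "det b = 1" using sl2_subgroupD(4)[OF X ab(2)] .
  have "H #>\<^bsub>?G\<^esub> a = H #>\<^bsub>?G\<^esub> b \<longleftrightarrow> a \<in> H #>\<^bsub>?G\<^esub> b"
    using repr_independence[of a H b] rcos_self[of a H] sH ab by auto
  also have "\<dots> \<longleftrightarrow> (\<exists>h\<in>H. a = h ** b)" by (auto simp: r_coset_def)
  also have "\<dots> \<longleftrightarrow> a ** adj b \<in> H"
  proof
    assume "a ** adj b \<in> H"
    moreover have "a = a ** adj b ** b" using db by (simp add: adj_cancel)
    ultimately show "\<exists>h\<in>H. a = h ** b" by blast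
  qed (use db in \<open>auto simp: adj_cancel\<close>)
  finally show ?thesis .
qed

lemma order_Mod:
  "order (G Mod H) = card ((\<lambda>x. H #>\<^bsub>G\<^esub> x) ` carrier G)"
  by (simp add: order_def carrier_FactGroup)

lemma finite_image_factor:
  assumes "finite (r ` S)" "\<And>x y. x \<in> S \<Longrightarrow> y \<in> S \<Longrightarrow> r x = r y \<Longrightarrow> f x = f y"
  shows "finite (f ` S)" "card (f ` S) \<le> card (r ` S)"
proof -
  have "f x = f (inv_into S r (r x))" if "x \<in> S" for x
  proof (rule assms(2)[OF that])
    show "inv_into S r (r x) \<in> S" "r x = r (inv_into S r (r x))"
      using that inv_into_into[of "r x" r S] f_inv_into_f[of "r x" r S] by auto
  qed
  then have *: "f ` S = (\<lambda>t. f (inv_into S r t)) ` (r ` S)" by (auto simp: image_image)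
  show "finite (f ` S)" "card (f ` S) \<le> card (r ` S)"
    unfolding * using assms(1) by (auto intro: card_image_le)
qed

text \<open>By Sylow's theorem a prime q \<noteq> p dividing the order would give a subgroup of
  order q, whose nontrivial elements have order dividing both q and p^n.\<close>

lemma prime_power_order:
  assumes G: "group G" and fin: "finite (carrier G)" and p: "prime (p :: nat)"
    and pow: "\<And>x. x \<in> carrier G \<Longrightarrow> x [^]\<^bsub>G\<^esub> (p ^ n) = \<one>\<^bsub>G\<^esub>"
  shows "\<exists>k. order G = p ^ k"
proof (rule ccontr)
  assume no: "\<nexists>k. order G = p ^ k"
  interpret group G by fact
  have pos: "order G > 0" using fin order_gt_0_iff_finite by blast
  obtain k m where km: "order G = p ^ k * m" "\<not> p dvd m"
    using multiplicity_decompose'[of "order G" p] pos p not_prime_unit[of p]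
    by (metis gr_implies_not_zero)
  have "m \<noteq> 1" using no km by auto
  then obtain q where q: "prime q" "q dvd m" using prime_factor_nat by blast
  then have "q \<noteq> p" using km by auto
  have "q dvd order G" using q km by simp
  then obtain m' where "order G = q ^ 1 * m'" by (auto simp: dvd_def)
  from sylow_thm[OF q(1) G this fin] obtain H where H: "subgroup H G" "card H = q" by auto
  have "\<not> H \<subseteq> {\<one>\<^bsub>G\<^esub>}"
    using H(2) card_mono[of "{\<one>\<^bsub>G\<^esub>}" H] prime_gt_1_nat[OF q(1)] by auto
  then obtain h where h: "h \<in> H" "h \<noteq> \<one>\<^bsub>G\<^esub>" by blast
  have hG: "h \<in> carrier G" using subgroup.mem_carrier[OF H(1) h(1)] .
  interpret K: group "G\<lparr>carrier := H\<rparr>" by (rule subgroup_imp_group[OF H(1)])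
  have "h [^]\<^bsub>G\<lparr>carrier := H\<rparr>\<^esub> order (G\<lparr>carrier := H\<rparr>) = \<one>\<^bsub>G\<lparr>carrier := H\<rparr>\<^esub>"
    by (rule K.pow_order_eq_1) (simp add: h)
  then have "h [^]\<^bsub>G\<^esub> q = \<one>\<^bsub>G\<^esub>" by (simp add: order_def H(2) nat_pow_consistent[symmetric])
  then have "ord h dvd q" using pow_eq_id[OF hG] by simp
  moreover have "ord h dvd p ^ n" using pow_eq_id[OF hG] pow[OF hG] by simp
  ultimately have "ord h dvd gcd q (p ^ n)" by simp
  also have "gcd q (p ^ n) = 1"
    using primes_coprime[OF q(1) p \<open>q \<noteq> p\<close>] by (simp add: coprime_iff_gcd_eq_1[symmetric])
  finally have "ord h = 1" by simp
  then show False using h ord_eq_1[OF hG] by simp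
qed

abbreviation red :: "'p::prime_card padic_int ^ 2 ^ 2 \<Rightarrow> 'p mod_ring ^ 2 ^ 2" where
  "red \<equiv> map_matrix padic_residue"

lemma red_simps:
  "red (A ** B) = red A ** red B" "red (adj A) = adj (red A)" "red (mat c) = mat (padic_residue c)"
  "trace (red A) = padic_residue (trace A)" "det (red A) = padic_residue (det A)" "red (- A) = - red A"
  "red (smul c A) = smul (padic_residue c) (red A)"
  by (simp_all add: mat2_simps)

lemma red_mpow: "red (mpow A n) = mpow (red A) n"
  by (induction n) (simp_all add: red_simps)

lemma red_eq_iff: "red A = red B \<longleftrightarrow> mdvd ell (A - B)"
  by (simp add: mat2_eq_iff mdvd_2 padic_residue_eq_iff)

lemma sl2_subgroup_reduction: assumes "sl2_subgroup X" shows "sl2_subgroup (reduction X)"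
  unfolding sl2_subgroup_def reduction_def
proof (intro conjI ballI)
  note D = sl2_subgroupD[OF assms]
  show "red ` X \<subseteq> SL2" using D(4) by (auto simp: SL2_def red_simps)
  show "mat 1 \<in> red ` X" using D(1) by (metis imageI red_simps(3) padic_residue_1)
  fix x assume "x \<in> red ` X"
  then obtain a where a: "a \<in> X" "x = red a" by blast
  then show "adj x \<in> red ` X" using D(3) by (simp add: red_simps(2)[symmetric])
  fix y assume "y \<in> red ` X"
  then obtain b where b: "b \<in> X" "y = red b" by blast
  show "x ** y \<in> red ` X" using a b D(2) by (simp add: red_simps(1)[symmetric])
qed

section \<open>Powers of exponent l, and the unipotent part as a pro-l group\<close>

lemma mod_ring_fermat: "(a :: 'p::prime_card mod_ring) ^ CARD('p) = a"
proof (cases "a = 0")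
  case False
  obtain k where k: "a = of_nat k" using surj_of_nat_mod_ring by blast
  have "\<not> CARD('p) dvd k"
  proof
    assume "CARD('p) dvd k"
    then obtain j where "k = CARD('p) * j" by (auto simp: dvd_def)
    then show False using False k by simp
  qed
  then have "[k ^ (CARD('p) - 1) = 1] (mod CARD('p))" by (rule fermat_theorem[OF prime_card])
  then have "[int k ^ (CARD('p) - 1) = 1] (mod int CARD('p))" using cong_int_iff[of "k ^ (CARD('p) - 1)" 1 "CARD('p)"] by simp
  then have "(of_int (int k ^ (CARD('p) - 1)) :: 'p mod_ring) = of_int 1"
    unfolding of_int_mod_ring_eq_iff cong_def .
  then have "a ^ (CARD('p) - 1) = 1" by (simp add: k)
  then have "a ^ Suc (CARD('p) - 1) = a" by (simp only: power_Suc mult_1_right)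
  moreover have "Suc (CARD('p) - 1) = CARD('p)" by simp
  ultimately show ?thesis by (simp only:)
qed (simp add: zero_power)

text \<open>Frobenius on 1 + M: the inner binomial coefficients vanish, so x^p - 1 = (x - 1)^p.
  Taking determinants, with det(y - 1) = 2 - tr(y) for determinant 1 and Fermat's theorem, compares
  the traces without eigenvalues.\<close>

lemma trace_mpow_prime:
  fixes x :: "'p::prime_card mod_ring ^ 2 ^ 2"
  assumes "det x = 1"
  shows "trace (mpow x CARD('p)) = trace x"
proof -
  let ?p = "CARD('p)" and ?M = "x - mat 1"
  have z: "smul (of_nat (?p choose k)) A = 0" if "0 < k" "k < ?p" for k and A :: "'p mod_ring ^ 2 ^ 2"
  proof -
    have "?p dvd ?p choose k" using that by (intro dvd_choose_prime prime_card) auto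
    then obtain j where "?p choose k = ?p * j" by (auto simp: dvd_def)
    then have "(of_nat (?p choose k) :: 'p mod_ring) = 0" by simp
    then show ?thesis by simp
  qed
  have p: "?p \<noteq> 0" by simp
  have "mpow x ?p = (\<Sum>k\<le>?p. smul (of_nat (?p choose k)) (mpow ?M k))"
    using mpow_binomial[of ?M ?p] by simp
  also have "\<dots> = (\<Sum>k\<in>{0, ?p}. smul (of_nat (?p choose k)) (mpow ?M k))"
    by (rule sum.mono_neutral_right) (use z in auto)
  also have "\<dots> = mat 1 + mpow ?M ?p" using p by simp
  finally have "mpow ?M ?p = mpow x ?p - mat 1" by simp
  moreover have d: "det (y - mat 1) = 2 - trace y" if "det y = 1" for y :: "'p mod_ring ^ 2 ^ 2"
    using that by (simp add: mat2_simps algebra_simps)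
  moreover have "det (mpow ?M ?p) = det ?M" by (simp add: det_mpow mod_ring_fermat)
  moreover have "det (mpow x ?p) = 1" using assms by (simp add: det_mpow)
  ultimately show ?thesis using assms by (metis diff_left_imp_eq diff_eq_eq diff_add_cancel add_left_cancel)
qed

lemma trace_mpow_prime_power:
  fixes x :: "'p::prime_card mod_ring ^ 2 ^ 2"
  assumes "det x = 1"
  shows "trace (mpow x (CARD('p) ^ k)) = trace x"
proof (induction k)
  case (Suc k)
  have "mpow x (CARD('p) ^ Suc k) = mpow (mpow x (CARD('p) ^ k)) CARD('p)"
    by (simp add: mpow_mult[symmetric] mult.commute)
  then show ?case using Suc trace_mpow_prime[of "mpow x (CARD('p) ^ k)"] assms by (simp add: det_mpow)
qed simp

text \<open>The binomial terms of degree strictly between 1 and l carry a factor l and a factor M^2;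
  the term of degree l is covered by the second hypothesis.\<close>

lemma mdvd_mpow_ell:
  fixes M :: "'p::prime_card padic_int ^ 2 ^ 2"
  assumes "mdvd m (smul ell (M ** M))" "mdvd m (mpow M CARD('p))"
  shows "mdvd m (mpow (mat 1 + M) CARD('p) - (mat 1 + smul ell M))"
proof -
  let ?p = "CARD('p)"
  let ?f = "\<lambda>k. smul (of_nat (?p choose k)) (mpow M k)"
  have p2: "?p \<ge> 2" using prime_ge_2_nat[OF prime_card[where 'a='p]] .
  then have split: "{..?p} = {0, 1} \<union> {2..?p}" by auto
  have "mpow (mat 1 + M) ?p = (\<Sum>k\<in>{0, 1}. ?f k) + (\<Sum>k\<in>{2..?p}. ?f k)"
    unfolding mpow_binomial split by (rule sum.union_disjoint) auto
  also have "(\<Sum>k\<in>{0, 1}. ?f k) = mat 1 + smul ell M" by simp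
  finally have "mpow (mat 1 + M) ?p - (mat 1 + smul ell M) = (\<Sum>k\<in>{2..?p}. ?f k)" by simp
  moreover have "mdvd m (?f k)" if k: "k \<in> {2..?p}" for k
  proof (cases "k = ?p")
    case False
    then have "?p dvd ?p choose k" using k by (intro dvd_choose_prime prime_card) auto
    then obtain j where j: "?p choose k = ?p * j" by (auto simp: dvd_def)
    obtain i where i: "k = 2 + i" using k le_Suc_ex by (metis atLeastAtMost_iff)
    have "mpow M k = (M ** M) ** mpow M i" by (simp add: i matrix_mul_assoc)
    then have "?f k = smul (of_nat j) (smul ell (M ** M) ** mpow M i)"
      unfolding j by (simp add: smul_mult mult.commute)
    then show ?thesis using assms(1) by (simp add: mdvd_smul mdvd_mult)
  qed (use assms(2) in simp)
  ultimately show ?thesis using mdvd_sum[of "{2..?p}" m ?f] by simp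
qed

lemma mpow_smul: "mpow (smul c A) n = smul (c ^ n) (mpow A n)"
  by (induction n) (simp_all add: smul_mult mult.commute)

lemma mdvd_mpow_mono: "mdvd m (mpow A k) \<Longrightarrow> k \<le> n \<Longrightarrow> mdvd m (mpow A n)"
  by (metis le_Suc_ex mdvd_mult(1) mpow_add)

text \<open>Each l-th power gains a factor l. The first step rests on (x - 1)^2 = (tr(x) - 2) x,
  from Cayley-Hamilton, which is divisible by l though x - 1 need not be.\<close>

lemma mpow_ell_congruent:
  fixes x :: "'p::prime_card padic_int ^ 2 ^ 2"
  assumes det: "det x = 1" and tr: "ell dvd trace x - 2"
  shows "mdvd (ell ^ k) (mpow x (CARD('p) ^ k) - mat 1)"
proof (induction k)
  case 0
  show ?case by (simp add: mdvd_2)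
next
  case (Suc k)
  let ?p = "CARD('p)"
  have p2: "?p \<ge> 2" using prime_ge_2_nat[OF prime_card[where 'a='p]] .
  let ?y = "mpow x (?p ^ k)"
  let ?M = "?y - mat 1"
  have pow: "mpow x (?p ^ Suc k) = mpow (mat 1 + ?M) ?p"
    by (simp add: mpow_mult[symmetric] mult.commute)
  have "mdvd (ell ^ Suc k) (?M ** ?M)"
  proof (cases k)
    case 0
    have "?M ** ?M = smul (trace x - 2) x"
      using cayley_hamilton[OF det] by (simp add: 0 mult_distrib_2) (simp add: mat2_eq_iff algebra_simps)
    then show ?thesis using mdvd_smul(2)[OF tr] 0 by simp
  next
    case (Suc j)
    obtain Y where Y: "?M = smul (ell ^ k) Y" using \<open>mdvd (ell ^ k) ?M\<close> unfolding mdvd_iff by blast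
    have "?M ** ?M = smul (ell ^ (k + k)) (Y ** Y)" unfolding Y by (simp add: smul_mult power_add)
    moreover have "ell ^ Suc k dvd (ell ^ (k + k) :: 'p padic_int)" using Suc by (intro le_imp_power_dvd) simp
    ultimately show ?thesis using mdvd_smul(2) by metis
  qed
  then have MM: "mdvd (ell ^ Suc k) (mpow ?M 2)" by (simp add: numeral_2_eq_2)
  have "mdvd (ell ^ Suc k) (mpow (mat 1 + ?M) ?p - (mat 1 + smul ell ?M))"
    using MM p2 by (intro mdvd_mpow_ell mdvd_mpow_mono[OF MM] mdvd_smul(1)) (simp_all add: numeral_2_eq_2)
  moreover have "mdvd (ell ^ Suc k) (smul ell ?M)"
    using Suc unfolding mdvd_2 by (simp add: mult_dvd_mono)
  ultimately show ?case unfolding pow using mdvd_add by fastforce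
qed

lemma mdvd_det:
  assumes "mdvd m (A - B)" shows "m dvd det A - det B"
proof -
  have "det A - det B = (A - B)$1$1 * A$2$2 + B$1$1 * (A - B)$2$2 - (A - B)$1$2 * A$2$1 - B$1$2 * (A - B)$2$1"
    by (simp add: det_2 algebra_simps)
  then show ?thesis using assms unfolding mdvd_2 by (simp only: dvd_add dvd_diff dvd_mult dvd_mult2)
qed

text \<open>Closedness in GL_2: the condition on the determinant restricts to limits that are
  invertible.\<close>

definition l_closed :: "('p::prime_card padic_int ^ 2 ^ 2) set \<Rightarrow> bool" where
  "l_closed X \<longleftrightarrow> (\<forall>x. (\<forall>n. \<exists>h\<in>X. mdvd (ell ^ n) (h - x)) \<longrightarrow> det x dvd 1 \<longrightarrow> x \<in> X)"

lemma l_closed_limit: "l_closed X \<Longrightarrow> det x dvd 1 \<Longrightarrow> (\<And>n. \<exists>h\<in>X. mdvd (ell ^ n) (h - x)) \<Longrightarrow> x \<in> X"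
  unfolding l_closed_def by blast

lemma closed_subgroup_GL2_iff: "closed_subgroup X GL2 \<longleftrightarrow> subgroup X GL2 \<and> l_closed X"
  unfolding closed_subgroup_def closedin_mat2_iff l_closed_def
  using subgroup.subset[of X GL2] by auto

text \<open>For X in SL_2, trace 2 of the reduction means unipotent reduction; below this set is
  identified with N(X).\<close>

definition unip :: "('p::prime_card padic_int ^ 2 ^ 2) set \<Rightarrow> ('p padic_int ^ 2 ^ 2) set" where
  "unip X = {x \<in> X. trace (red x) = 2}"

lemma unip_iff: "x \<in> unip X \<longleftrightarrow> x \<in> X \<and> ell dvd trace x - 2"
  using padic_residue_eq_iff[of "trace x" 2] by (simp add: unip_def red_simps)

lemma sl2_subgroup_unip:
  assumes X: "sl2_subgroup X" and tl: "torus_like (reduction X)"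
  shows "sl2_subgroup (unip X)"
  unfolding sl2_subgroup_def
proof (intro conjI ballI)
  note D = sl2_subgroupD[OF X] and R = sl2_subgroup_reduction[OF X]
  show "unip X \<subseteq> SL2" using D(4) by (auto simp: unip_def SL2_def)
  show "mat 1 \<in> unip X" using D(1) by (simp add: unip_def red_simps trace_2)
  fix x assume x: "x \<in> unip X"
  then show "adj x \<in> unip X" using D(3) by (simp add: unip_def red_simps)
  fix y assume y: "y \<in> unip X"
  have "red x \<in> reduction X" "red y \<in> reduction X" using x y by (auto simp: reduction_def unip_def)
  then show "x ** y \<in> unip X"
    using torus_likeD(1)[OF tl R] x y D(2) by (simp add: unip_def red_simps(1))
qed

lemma conj_unip:
  assumes X: "sl2_subgroup X" and "x \<in> X" "h \<in> unip X"
  shows "x ** h ** adj x \<in> unip X"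
  using assms sl2_subgroupD[OF X] trace_conj[of "red x" "red h"]
  by (simp add: unip_def red_simps(1,2)) (metis red_simps(5) padic_residue_1)

lemma l_closed_unip:
  assumes X: "sl2_subgroup X" and cl: "l_closed X" shows "l_closed (unip X)"
  unfolding l_closed_def
proof (intro allI impI)
  fix x :: "'a padic_int ^ 2 ^ 2"
  assume lim: "\<forall>n. \<exists>h\<in>unip X. mdvd (ell ^ n) (h - x)" and "det x dvd 1"
  then have "x \<in> X" using l_closed_limit[OF cl] unfolding unip_def by blast
  moreover obtain h where "h \<in> unip X" "mdvd (ell ^ 1) (h - x)" using lim by blast
  then have "trace (red x) = 2" using red_eq_iff[of h x] by (simp add: unip_def)
  ultimately show "x \<in> unip X" by (simp add: unip_def)
qed

lemma finite_residues: "finite (range (\<lambda>x :: 'p::prime_card padic_int. padic_res x n))"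
  by (rule finite_subset[of _ "{0..<int CARD('p) ^ n}"]) (use padic_res_range in auto)

text \<open>An open V contains all elements of the unipotent part congruent to 1 modulo some l^n. So
  the quotient is finite, and its exponent divides l^n because x^(l^n) is congruent to 1 modulo
  l^n.\<close>

lemma pro_l_unip:
  fixes X :: "('p::prime_card padic_int ^ 2 ^ 2) set"
  assumes X: "sl2_subgroup X" and cl: "l_closed X" and tl: "torus_like (reduction X)"
  shows "pro_l_subgroup (unip X)"
  unfolding pro_l_subgroup_def
proof (intro conjI allI impI)
  let ?U = "unip X"
  let ?G = "GL2\<lparr>carrier := ?U\<rparr>"
  have U: "sl2_subgroup ?U" by (rule sl2_subgroup_unip[OF X tl])
  show "closed_subgroup ?U GL2"
    using sl2_subgroup_imp_subgroup[OF U] l_closed_unip[OF X cl] closed_subgroup_GL2_iff by blast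
  fix V assume V: "V \<lhd> ?G \<and> openin (top_of_set ?U) V"
  have V': "sl2_subgroup V" "V \<subseteq> ?U" using V normal_sl2_subgroup_iff[OF U] by blast+
  obtain T where T: "open T" "V = ?U \<inter> T" using V by (auto simp: openin_open)
  have "mat 1 \<in> T" using sl2_subgroupD(1)[OF V'(1)] T(2) by blast
  then obtain n where n: "\<And>y. mdvd (ell ^ n) (y - mat 1) \<Longrightarrow> y \<in> T" using T(1) unfolding open_mat2_iff by blast
  then have nV: "y \<in> V" if "y \<in> ?U" "mdvd (ell ^ n) (y - mat 1)" for y using that T(2) by blast
  interpret normal V ?G using V by blast
  let ?r = "\<lambda>x :: 'p padic_int ^ 2 ^ 2. (padic_res (x$1$1) n, padic_res (x$1$2) n, padic_res (x$2$1) n, padic_res (x$2$2) n)"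
  have r1: "finite (?r ` ?U)"
  proof (rule finite_subset)
    let ?R = "range (\<lambda>x :: 'p padic_int. padic_res x n)"
    show "?r ` ?U \<subseteq> ?R \<times> ?R \<times> ?R \<times> ?R" by auto
    show "finite (?R \<times> ?R \<times> ?R \<times> ?R)" by (intro finite_cartesian_product finite_residues)
  qed
  have r2: "V #>\<^bsub>?G\<^esub> x = V #>\<^bsub>?G\<^esub> y" if xy: "x \<in> ?U" "y \<in> ?U" "?r x = ?r y" for x y
  proof -
    have "mdvd (ell ^ n) (x - y)" using xy(3) by (simp add: mdvd_2 ell_pow_dvd_diff_iff)
    then have "mdvd (ell ^ n) ((x - y) ** adj y)" by (rule mdvd_mult)
    then have "mdvd (ell ^ n) (x ** adj y - mat 1)"
      using sl2_subgroupD(4)[OF U xy(2)] by (simp add: mult_distrib_2 mult_adj)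
    then have "x ** adj y \<in> V" using xy(1,2) by (intro nV sl2_subgroupD[OF U])
    then show ?thesis using r_coset_eq_iff[OF U V' xy(1,2)] by blast
  qed
  have "carrier (?G Mod V) = (\<lambda>x. V #>\<^bsub>?G\<^esub> x) ` ?U" by (simp add: carrier_FactGroup)
  then have fin: "finite (carrier (?G Mod V))"
    using finite_image_factor(1)[OF r1 r2] by (simp only:)
  show "\<exists>k. order (?G Mod V) = CARD('p) ^ k"
  proof (rule prime_power_order[OF factorgroup_is_group fin prime_card])
    fix K assume "K \<in> carrier (?G Mod V)"
    then obtain x where x: "x \<in> ?U" "K = V #>\<^bsub>?G\<^esub> x" by (auto simp: carrier_FactGroup)
    interpret h: group_hom ?G "?G Mod V" "\<lambda>x. V #>\<^bsub>?G\<^esub> x"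
      by (intro group_hom.intro group_hom_axioms.intro group_sl2_subgroup[OF U] factorgroup_is_group r_coset_hom_Mod)
    have "mpow x (CARD('p) ^ n) \<in> V"
      using x(1) sl2_subgroupD(4)[OF U x(1)] unip_iff[of x X]
      by (intro nV sl2_subgroup_mpow[OF U] mpow_ell_congruent) auto
    then have "V #>\<^bsub>?G\<^esub> (x [^]\<^bsub>?G\<^esub> (CARD('p) ^ n)) = V"
      unfolding pow_sl2_subgroup[OF U x(1)] using V'(2) by (intro coset_join2 subgroup_axioms) auto
    then show "K [^]\<^bsub>?G Mod V\<^esub> (CARD('p) ^ n) = \<one>\<^bsub>?G Mod V\<^esub>"
      using h.hom_nat_pow[of x "CARD('p) ^ n"] x by simp
  qed
qed

text \<open>The kernel of reduction is open and normal in N, so x^(l^k) reduces to 1 for some k.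
  Taking l-th powers does not change the trace of the reduction, which is therefore 2.\<close>

lemma normal_pro_l_subset_unip:
  fixes X :: "('p::prime_card padic_int ^ 2 ^ 2) set"
  assumes X: "sl2_subgroup X" and N: "normal_pro_l N X"
  shows "N \<subseteq> unip X"
proof
  fix x assume x: "x \<in> N"
  let ?G = "GL2\<lparr>carrier := N\<rparr>"
  have N': "sl2_subgroup N" "N \<subseteq> X"
    using N normal_sl2_subgroup_iff[OF X] by (auto simp: normal_pro_l_def)
  note D = sl2_subgroupD[OF N'(1)]
  let ?V = "{x \<in> N. red x = mat 1}"
  have V: "?V \<lhd> ?G"
    unfolding normal_sl2_subgroup_iff[OF N'(1)]
  proof (intro conjI ballI)
    show "sl2_subgroup ?V"
      unfolding sl2_subgroup_def using D by (auto simp: SL2_def red_simps(1,2,3) adj_mat)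
    fix y h assume y: "y \<in> N" and h: "h \<in> ?V"
    have "det (red y) = 1" using D(4)[OF y] by (simp add: red_simps)
    then show "y ** h ** adj y \<in> ?V" using y h D by (simp add: red_simps(1,2) mult_adj)
  qed blast
  have "openin (top_of_set N) ?V"
    unfolding openin_open
  proof (intro exI conjI)
    show "open {x :: 'p padic_int ^ 2 ^ 2. red x = mat 1}"
      unfolding open_mat2_iff
    proof (intro ballI exI allI impI)
      fix x y :: "'p padic_int ^ 2 ^ 2"
      assume "x \<in> {x. red x = mat 1}" "mdvd (ell ^ 1) (y - x)"
      then show "y \<in> {x. red x = mat 1}" using red_eq_iff[of y x] by simp
    qed
  qed auto
  then obtain k where k: "order (?G Mod ?V) = CARD('p) ^ k"
    using N V unfolding normal_pro_l_def pro_l_subgroup_def by blast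
  interpret normal ?V ?G by (rule V)
  interpret Q: group "?G Mod ?V" by (rule factorgroup_is_group)
  interpret h: group_hom ?G "?G Mod ?V" "\<lambda>x. ?V #>\<^bsub>?G\<^esub> x"
    by (intro group_hom.intro group_hom_axioms.intro group_sl2_subgroup[OF N'(1)] factorgroup_is_group r_coset_hom_Mod)
  have "(?V #>\<^bsub>?G\<^esub> x) [^]\<^bsub>?G Mod ?V\<^esub> (CARD('p) ^ k) = ?V"
    using Q.pow_order_eq_1[of "?V #>\<^bsub>?G\<^esub> x"] x k by (simp add: carrier_FactGroup)
  then have "?V #>\<^bsub>?G\<^esub> mpow x (CARD('p) ^ k) = ?V"
    using h.hom_nat_pow[of x "CARD('p) ^ k"] x pow_sl2_subgroup[OF N'(1) x] by simp
  then have "mpow x (CARD('p) ^ k) \<in> ?V"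
    using coset_join1[of ?V "mpow x (CARD('p) ^ k)"] subgroup_axioms sl2_subgroup_mpow[OF N'(1) x] by simp
  then have "mpow (red x) (CARD('p) ^ k) = mat 1" by (simp add: red_mpow)
  moreover have "det (red x) = 1" using D(4)[OF x] by (simp add: red_simps)
  ultimately have "trace (red x) = 2" using trace_mpow_prime_power[of "red x" k] by (simp add: trace_2)
  then show "x \<in> unip X" using x N'(2) by (auto simp: unip_def)
qed

lemma max_normal_pro_l_eq:
  assumes X: "sl2_subgroup X" and cl: "l_closed X" and tl: "torus_like (reduction X)"
  shows "max_normal_pro_l X = unip X"
  unfolding max_normal_pro_l_def
proof (rule the_equality)
  have U: "normal_pro_l (unip X) X"
    unfolding normal_pro_l_def normal_sl2_subgroup_iff[OF X]
    using pro_l_unip[OF assms] sl2_subgroup_unip[OF X tl] conj_unip[OF X] by (auto simp: unip_def)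
  then show "normal_pro_l (unip X) X \<and> (\<forall>M. normal_pro_l M X \<and> unip X \<subseteq> M \<longrightarrow> M = unip X)"
    using normal_pro_l_subset_unip[OF X] by blast
  fix N assume "normal_pro_l N X \<and> (\<forall>M. normal_pro_l M X \<and> N \<subseteq> M \<longrightarrow> M = N)"
  then show "N = unip X" using U normal_pro_l_subset_unip[OF X] by blast
qed

text \<open>In a quotient of order 4 every fourth power is unipotent modulo l, and tr(x^4) = (t^2 -
  2)^2 - 2 = 2 means t^2 (t^2 - 4) = 0. Conversely, if all traces are 0 or have square 4 and some h
  has trace 0, the quotient consists of the four cosets of 1, -1, h and - h.\<close>

lemma order_Mod_unip:
  fixes X :: "('p::prime_card padic_int ^ 2 ^ 2) set"
  assumes odd: "odd CARD('p)" and X: "sl2_subgroup X" and minus: "- mat 1 \<in> X" and tl: "torus_like (reduction X)"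
  shows "order (GL2\<lparr>carrier := X\<rparr> Mod unip X) \<noteq> 4 \<longleftrightarrow> trace_generic (reduction X)"
proof -
  let ?G = "GL2\<lparr>carrier := X\<rparr>" and ?U = "unip X"
  let ?c = "\<lambda>x. ?U #>\<^bsub>?G\<^esub> x" and ?t = "\<lambda>x. trace (red x)"
  note D = sl2_subgroupD[OF X] and R = sl2_subgroup_reduction[OF X]
  note T = torus_likeD[OF tl R]
  have U: "sl2_subgroup ?U" "?U \<subseteq> X" using sl2_subgroup_unip[OF X tl] by (auto simp: unip_def)
  have two: "(2 :: 'p mod_ring) \<noteq> 0" by (rule two_mod_ring_nonzero[OF odd])
  have four: "(2 :: 'p mod_ring) \<noteq> - 2"
    using two by (metis add_eq_0_iff mult_2 mult_eq_0_iff)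
  have rX: "red x \<in> reduction X" if "x \<in> X" for x using that by (simp add: reduction_def)
  have dr: "det (red x) = 1" if "x \<in> X" for x using D(4)[OF that] by (simp add: red_simps)
  have ceq: "?c x = ?c y \<longleftrightarrow> trace (red x ** adj (red y)) = 2" if "x \<in> X" "y \<in> X" for x y
    using r_coset_eq_iff[OF X U that] D that by (simp add: unip_def red_simps(1,2))
  have neg: "- x \<in> X" if "x \<in> X" for x using sl2_subgroup_minus[OF X minus that] .
  have rm: "red (- mat 1) = - mat 1" "red (mat 1) = mat 1" by (simp_all add: red_simps(3,6))
  have pm: "?c x \<in> {?c (mat 1), ?c (- mat 1)}" if x: "x \<in> X" and t: "?t x ^ 2 = 4" for x
    using trace_4_cases[OF t] ceq[OF x D(1)] ceq[OF x minus]
    by (auto simp: rm adj_mat adj_minus minus_mult_2 trace_minus_2)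
  have ord: "order (?G Mod ?U) = card (?c ` X)" by (simp add: order_Mod)
  show ?thesis
  proof
    assume gen: "trace_generic (reduction X)"
    consider "\<forall>x\<in>X. ?t x ^ 2 = 4" | x where "x \<in> X" "?t x ^ 2 \<noteq> 0" "?t x ^ 2 \<noteq> 4"
      using gen unfolding trace_generic_def reduction_def by blast
    then show "order (?G Mod ?U) \<noteq> 4"
    proof cases
      case 1
      then have "?c ` X \<subseteq> {?c (mat 1), ?c (- mat 1)}" using pm by blast
      then have "card (?c ` X) \<le> card {?c (mat 1), ?c (- mat 1)}" by (intro card_mono) auto
      also have "\<dots> \<le> 2" by (simp add: card_insert_if)
      finally show ?thesis by (simp add: ord)
    next
      case 2
      show ?thesis
      proof
        assume 4: "order (?G Mod ?U) = 4"
        interpret normal ?U ?G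
          using normal_sl2_subgroup_iff[OF X] U conj_unip[OF X] by blast
        interpret Q: group "?G Mod ?U" by (rule factorgroup_is_group)
        interpret h: group_hom ?G "?G Mod ?U" ?c
          by (intro group_hom.intro group_hom_axioms.intro group_sl2_subgroup[OF X] factorgroup_is_group r_coset_hom_Mod)
        have "?c x [^]\<^bsub>?G Mod ?U\<^esub> (4 :: nat) = ?U"
          using Q.pow_order_eq_1[of "?c x"] 2(1) 4 by (simp add: carrier_FactGroup)
        then have "?c (mpow x 4) = ?U"
          using h.hom_nat_pow[of x 4] 2(1) pow_sl2_subgroup[OF X 2(1)] by simp
        then have "mpow x 4 \<in> ?U"
          using coset_join1[of ?U "mpow x 4"] subgroup_axioms sl2_subgroup_mpow[OF X 2(1)] by simp
        then have t4: "trace (mpow (red x) 4) = 2" by (simp add: unip_def red_mpow)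
        have sq: "trace (y ** y) = trace y ^ 2 - 2" if "det y = 1" for y :: "'p mod_ring ^ 2 ^ 2"
          unfolding cayley_hamilton[OF that] by (simp add: trace_2 power2_eq_square algebra_simps)
        have "mpow (red x) 4 = (red x ** red x) ** (red x ** red x)"
          by (simp add: numeral_eq_Suc matrix_mul_assoc)
        then have "(?t x ^ 2 - 2) ^ 2 - 2 = 2"
          using t4 sq[OF dr[OF 2(1)]] sq[of "red x ** red x"] dr[OF 2(1)] by (simp add: det_mul)
        then have "?t x ^ 2 * (?t x ^ 2 - 4) = 0" by (simp add: power2_eq_square algebra_simps)
        then show False using 2 by simp
      qed
    qed
  next
    assume n4: "order (?G Mod ?U) \<noteq> 4"
    show "trace_generic (reduction X)"
    proof (rule ccontr)
      assume *: "\<not> trace_generic (reduction X)"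
      then have t: "?t x = 0 \<or> ?t x ^ 2 = 4" if "x \<in> X" for x
        using that unfolding trace_generic_def reduction_def by auto
      obtain h where h: "h \<in> X" "?t h ^ 2 \<noteq> 4" using * unfolding trace_generic_def reduction_def by blast
      then have h0: "?t h = 0" using t by blast
      have hm: "- h \<in> X" by (rule neg[OF h(1)])
      have rhm: "red (- h) = - red h" by (rule red_simps(6))
      have "?c x \<in> {?c (mat 1), ?c (- mat 1), ?c h, ?c (- h)}" if x: "x \<in> X" for x
      proof (cases "?t x = 0")
        case True
        have "adj (red h) \<in> reduction X" using sl2_subgroupD(3)[OF R rX[OF h(1)]] .
        then have "trace (red x ** adj (red h)) ^ 2 = 4" using T(4)[OF rX[OF x]] True h0 by simp
        then show ?thesis using trace_4_cases ceq[OF x h(1)] ceq[OF x hm]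
          by (fastforce simp: rhm adj_minus minus_mult_2 trace_minus_2)
      next
        case False
        then show ?thesis using pm[OF x] t[OF x] by blast
      qed
      then have "?c ` X = {?c (mat 1), ?c (- mat 1), ?c h, ?c (- h)}"
        using h(1) hm D(1) minus by blast
      moreover have "?c (mat 1) \<noteq> ?c (- mat 1)" "?c h \<noteq> ?c (- h)"
        "?c (mat 1) \<noteq> ?c h" "?c (mat 1) \<noteq> ?c (- h)" "?c (- mat 1) \<noteq> ?c h" "?c (- mat 1) \<noteq> ?c (- h)"
        using ceq[OF D(1) minus] ceq[OF h(1) hm] ceq[OF D(1) h(1)] ceq[OF D(1) hm] ceq[OF minus h(1)] ceq[OF minus hm]
          h0 two four dr[OF h(1)]
        by (auto simp: rm rhm adj_mat adj_minus minus_mult_2 trace_minus_2 mult_adj trace_2[of "mat 1"] simp del: mat_nth(2,3))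
      ultimately have "card (?c ` X) = 4" by simp
      then show False using n4 ord by simp
    qed
  qed
qed

section \<open>The saturation\<close>

lemma smul_conv_mat: "mat c ** x = smul c x"
  by (simp add: smul_def)

lemma inv_GL2_smul:
  assumes c: "1 = c * e" and x: "x ** y = mat 1"
  shows "inv\<^bsub>GL2\<^esub> (smul c x) = smul e (y :: 'a::comm_ring_1 ^ 2 ^ 2)"
  using c by (intro inv_GL2) (simp add: smul_mult x mult.commute)

text \<open>Scalars are central, so the products of elements of G with unit scalars already form a
  group.\<close>

lemma Sat_iff:
  fixes G :: "('a::comm_ring_1 ^ 2 ^ 2) set"
  assumes G: "subgroup G GL2"
  shows "x \<in> Sat G \<longleftrightarrow> (\<exists>c. c dvd 1 \<and> smul c x \<in> G)"
proof
  let ?T = "{x. \<exists>c. c dvd 1 \<and> smul c x \<in> G}"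
  have T: "subgroup ?T GL2"
  proof (rule subgroup.intro)
    show "?T \<subseteq> carrier GL2"
    proof clarsimp
      fix x c assume "smul c x \<in> G"
      then have "det (smul c x) dvd 1" using subgroup.subset[OF G] by auto
      then show "det x dvd 1" unfolding det_smul by (rule dvd_mult_right)
    qed
    show "\<one>\<^bsub>GL2\<^esub> \<in> ?T" using subgroup.one_closed[OF G] by (auto intro!: exI[of _ 1])
  next
    fix x y assume "x \<in> ?T" "y \<in> ?T"
    then obtain c d where *: "c dvd 1" "d dvd 1" "smul c x \<in> G" "smul d y \<in> G" by blast
    have "smul c x ** smul d y \<in> G" using subgroup.m_closed[OF G *(3,4)] by simp
    then have "smul (c * d) (x ** y) \<in> G" by (simp add: smul_mult mult.commute)
    moreover have "c * d dvd 1" using mult_dvd_mono[OF *(1,2)] by simp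
    ultimately show "x \<otimes>\<^bsub>GL2\<^esub> y \<in> ?T" by auto
  next
    fix x assume "x \<in> ?T"
    then obtain c where c: "c dvd 1" "smul c x \<in> G" by blast
    obtain e where e: "1 = c * e" using c(1) by (auto simp: dvd_def)
    have "det (smul c x) dvd 1" using subgroup.subset[OF G] c(2) by auto
    then have "det x dvd 1" unfolding det_smul by (rule dvd_mult_right)
    then obtain y where y: "x ** y = mat 1" unfolding invertible_2_iff[symmetric] by (auto simp: invertible_def)
    have "smul e y \<in> G" using subgroup.m_inv_closed[OF G c(2)] inv_GL2_smul[OF e y] by simp
    moreover have "e dvd 1" unfolding e by simp
    ultimately show "inv\<^bsub>GL2\<^esub> x \<in> ?T" using inv_GL2[OF y] by auto
  qed
  have "G \<union> mat ` {c. c dvd 1} \<subseteq> ?T"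
  proof
    fix x assume "x \<in> G \<union> mat ` {c. c dvd 1}"
    then consider "x \<in> G" | c where "x = mat c" "c dvd 1" by blast
    then show "x \<in> ?T"
    proof cases
      case 2
      then obtain e where e: "1 = c * e" by (auto simp: dvd_def)
      have "smul e x = mat 1" using e 2 by (simp add: mat2_eq_iff mult.commute)
      moreover have "e dvd 1" unfolding e by simp
      ultimately show ?thesis using subgroup.one_closed[OF G] by auto
    qed (auto intro!: exI[of _ 1])
  qed
  from group.generate_subgroup_incl[OF group_GL2 this T]
  show "x \<in> Sat G \<Longrightarrow> \<exists>c. c dvd 1 \<and> smul c x \<in> G" unfolding Sat_def by blast
  assume "\<exists>c. c dvd 1 \<and> smul c x \<in> G"
  then obtain c where c: "c dvd 1" "smul c x \<in> G" by blast
  obtain e where e: "1 = c * e" using c(1) by (auto simp: dvd_def)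
  have "e dvd 1" unfolding e by simp
  then have "mat e \<otimes>\<^bsub>GL2\<^esub> smul c x \<in> Sat G"
    unfolding Sat_def using c(2) by (intro generate.eng generate.incl) auto
  also have "mat e \<otimes>\<^bsub>GL2\<^esub> smul c x = x" using e by (simp add: smul_conv_mat mult.commute)
  finally show "x \<in> Sat G" .
qed

definition sat1 :: "('a::comm_ring_1 ^ 2 ^ 2) set \<Rightarrow> ('a ^ 2 ^ 2) set" where
  "sat1 G = Sat G \<inter> SL2"

lemma sat1_iff: "subgroup G GL2 \<Longrightarrow> x \<in> sat1 G \<longleftrightarrow> det x = 1 \<and> (\<exists>c. c dvd 1 \<and> smul c x \<in> G)"
  by (auto simp: sat1_def Sat_iff SL2_def)

lemma sl2_subgroup_sat1:
  assumes G: "subgroup G GL2" shows "sl2_subgroup (sat1 G)"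
  unfolding sl2_subgroup_def
proof (intro conjI ballI)
  show "sat1 G \<subseteq> SL2" by (simp add: sat1_def)
  show "mat 1 \<in> sat1 G" using subgroup.one_closed[OF G] by (auto simp: sat1_iff[OF G] intro!: exI[of _ 1])
  fix x assume "x \<in> sat1 G"
  then obtain c where c: "det x = 1" "c dvd 1" "smul c x \<in> G" by (auto simp: sat1_iff[OF G])
  obtain e where e: "1 = c * e" using c(2) by (auto simp: dvd_def)
  have "smul e (adj x) \<in> G"
    using subgroup.m_inv_closed[OF G c(3)] inv_GL2_smul[OF e, of x "adj x"] c(1) by (simp add: mult_adj)
  moreover have "e dvd 1" unfolding e by simp
  ultimately show "adj x \<in> sat1 G" using c(1) by (auto simp: sat1_iff[OF G])
  fix y assume "y \<in> sat1 G"
  then obtain d where d: "det y = 1" "d dvd 1" "smul d y \<in> G" by (auto simp: sat1_iff[OF G])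
  have "smul c x ** smul d y \<in> G" using subgroup.m_closed[OF G c(3) d(3)] by simp
  then have "smul (c * d) (x ** y) \<in> G" by (simp add: smul_mult mult.commute)
  moreover have "c * d dvd 1" using mult_dvd_mono[OF c(2) d(2)] by simp
  ultimately show "x ** y \<in> sat1 G" using c(1) d(1) by (auto simp: sat1_iff[OF G] det_mul)
qed

lemma minus_sat1: assumes G: "subgroup G GL2" shows "- mat 1 \<in> sat1 G"
proof -
  have "smul (- 1) (- mat 1) = (mat 1 :: 'a ^ 2 ^ 2)" by (simp add: mat2_eq_iff)
  moreover have "det (- mat 1 :: 'a ^ 2 ^ 2) = 1" by (simp add: det_2)
  ultimately show ?thesis using subgroup.one_closed[OF G] by (auto simp: sat1_iff[OF G] intro!: exI[of _ "- 1"])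
qed

lemma commutator_derived:
  assumes G: "subgroup G GL2" and x: "x \<in> sat1 G" and y: "y \<in> sat1 G"
  shows "x ** y ** adj x ** adj y \<in> derived GL2 G"
proof -
  obtain c d where c: "det x = 1" "c dvd 1" "smul c x \<in> G" and d: "det y = 1" "d dvd 1" "smul d y \<in> G"
    using x y by (auto simp: sat1_iff[OF G])
  obtain e f where e: "1 = c * e" and f: "1 = d * f" using c(2) d(2) by (auto simp: dvd_def)
  have "smul c x \<otimes>\<^bsub>GL2\<^esub> smul d y \<otimes>\<^bsub>GL2\<^esub> inv\<^bsub>GL2\<^esub> (smul c x) \<otimes>\<^bsub>GL2\<^esub> inv\<^bsub>GL2\<^esub> (smul d y) \<in> derived GL2 G"
    unfolding derived_def using c(3) d(3) by (intro generate.incl) blast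
  also have "smul c x \<otimes>\<^bsub>GL2\<^esub> smul d y \<otimes>\<^bsub>GL2\<^esub> inv\<^bsub>GL2\<^esub> (smul c x) \<otimes>\<^bsub>GL2\<^esub> inv\<^bsub>GL2\<^esub> (smul d y)
      = smul ((c * e) * (d * f)) (x ** y ** adj x ** adj y)"
    using inv_GL2_smul[OF e, of x "adj x"] inv_GL2_smul[OF f, of y "adj y"] c(1) d(1)
    by (simp add: mult_adj smul_mult mult.commute mult.left_commute)
  finally show ?thesis by (simp flip: e f)
qed

lemma SL2_subset_sat1: "subgroup G GL2 \<Longrightarrow> G \<inter> SL2 \<subseteq> sat1 G"
  by (auto simp: sat1_iff SL2_def intro!: exI[of _ 1])

lemma derived_sl2_subgroup:
  assumes G: "subgroup G GL2"
  shows "sl2_subgroup (derived GL2 G)" "derived GL2 G \<subseteq> G"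
proof -
  have GS: "G \<subseteq> carrier GL2" using subgroup.subset[OF G] .
  have "derived GL2 G \<subseteq> SL2"
    unfolding derived_def
  proof (rule group.generate_subgroup_incl[OF group_GL2 _ sl2_subgroup_imp_subgroup[OF sl2_subgroup_SL2]], clarify)
    fix x y assume "x \<in> G" "y \<in> G"
    then have "det x dvd 1" "det y dvd 1" using GS by auto
    then obtain x' y' where x': "x ** x' = mat 1" "y ** y' = mat 1"
      unfolding invertible_2_iff[symmetric] by (auto simp: invertible_def)
    then have "det x * det x' = 1" "det y * det y' = 1" by (metis det_I det_mul)+
    then have "(det x * det x') * (det y * det y') = 1" by simp
    then show "x \<otimes>\<^bsub>GL2\<^esub> y \<otimes>\<^bsub>GL2\<^esub> inv\<^bsub>GL2\<^esub> x \<otimes>\<^bsub>GL2\<^esub> inv\<^bsub>GL2\<^esub> y \<in> SL2"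
      using inv_GL2[OF x'(1)] inv_GL2[OF x'(2)] by (simp add: SL2_def det_mul mult.commute mult.left_commute)
  qed
  moreover have "subgroup (derived GL2 G) GL2" by (rule group.derived_is_subgroup[OF group_GL2 GS])
  ultimately show "sl2_subgroup (derived GL2 G)" by (intro subgroup_imp_sl2_subgroup)
  show "derived GL2 G \<subseteq> G" by (rule group.derived_incl[OF group_GL2 subset_refl G])
qed

lemma padic_det_limit:
  fixes x :: "'p::prime_card padic_int ^ 2 ^ 2"
  assumes "\<And>n. \<exists>h. det h = 1 \<and> mdvd (ell ^ n) (h - x)" shows "det x = 1"
proof -
  have "ell ^ n dvd 1 - det x" for n using assms[of n] mdvd_det by metis
  then have "1 - det x = 0" by (rule padic_eq_0I)
  then show ?thesis by simp
qed

text \<open>The approximating elements come with different units c n. By compactness these cluster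
  at some c', again a unit, and c' x is then a limit of elements of G.\<close>

lemma l_closed_sat1:
  fixes G :: "('p::prime_card padic_int ^ 2 ^ 2) set"
  assumes G: "subgroup G GL2" and cl: "l_closed G"
  shows "l_closed (sat1 G)"
  unfolding l_closed_def
proof (intro allI impI)
  fix x :: "'p padic_int ^ 2 ^ 2"
  assume "\<forall>n. \<exists>h\<in>sat1 G. mdvd (ell ^ n) (h - x)"
  then have "\<forall>n. \<exists>h c. det h = 1 \<and> c dvd 1 \<and> smul c h \<in> G \<and> mdvd (ell ^ n) (h - x)"
    using sat1_iff[OF G] by blast
  then obtain h c where h: "\<And>n. det (h n) = 1" "\<And>n. c n dvd 1" "\<And>n. smul (c n) (h n) \<in> G"
      "\<And>n. mdvd (ell ^ n) (h n - x)" by metis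
  have dx: "det x = 1" using padic_det_limit h(1,4) by blast
  obtain c' where c': "\<And>n. \<exists>k\<ge>n. ell ^ n dvd c k - c'" using padic_compact[of c] by blast
  have "ell dvd c k - c' \<Longrightarrow> c' dvd 1" for k
    using h(2)[of k] by (auto simp: padic_unit_iff_residue padic_residue_eq_iff[symmetric])
  then have cu: "c' dvd 1" using c'[of 1] by auto
  have "smul c' x \<in> G"
  proof (rule l_closed_limit[OF cl])
    show "det (smul c' x) dvd 1"
      using mult_dvd_mono[OF cu cu] by (simp add: det_smul dx power2_eq_square)
    fix n
    obtain k where k: "k \<ge> n" "ell ^ n dvd c k - c'" using c' by blast
    have "mdvd (ell ^ n) (h k - x)" using h(4)[of k] k(1) mdvd_trans le_imp_power_dvd by blast
    then have "mdvd (ell ^ n) (smul (c k - c') (h k) + smul c' (h k - x))"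
      using k(2) by (intro mdvd_add mdvd_smul)
    also have "smul (c k - c') (h k) + smul c' (h k - x) = smul (c k) (h k) - smul c' x"
      by (simp add: mat2_eq_iff algebra_simps)
    finally show "\<exists>h\<in>G. mdvd (ell ^ n) (h - smul c' x)" using h(3) by blast
  qed
  then show "x \<in> sat1 G" using dx cu by (auto simp: sat1_iff[OF G])
qed

text \<open>Both sides fail unless the reduction is toral. Then it is \<open>torus_like\<close>, so
  that N is the unipotent part and the order of the quotient is read off from traces.\<close>

lemma cartan_or_borel_type_iff:
  fixes G :: "('p::prime_card padic_int ^ 2 ^ 2) set"
  assumes odd: "odd CARD('p)" and G: "subgroup G GL2" and cl: "l_closed G"
  shows "cartan_or_borel_type G \<longleftrightarrow> toral (reduction (sat1 G)) \<and> trace_generic (reduction (sat1 G))"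
proof -
  note S = sl2_subgroup_sat1[OF G]
  have "torus_like (reduction (sat1 G))" if "toral (reduction (sat1 G))"
    by (rule toral_imp_torus_like[OF sl2_subgroup_reduction[OF S] that two_mod_ring_nonzero[OF odd]])
  then show ?thesis
    unfolding cartan_or_borel_type_def Let_def sat1_def[symmetric] toral_def[symmetric]
    using max_normal_pro_l_eq[OF S l_closed_sat1[OF G cl]] order_Mod_unip[OF odd S minus_sat1[OF G]] by metis
qed

section \<open>Spans of trace-free parts\<close>

lemma trace_0_2 [simp]: "trace (0 :: 'a::comm_ring_1 ^ 2 ^ 2) = 0"
  by (simp add: trace_2)

lemma sl2_group: "group (sl2 :: ('a::comm_ring_1 ^ 2 ^ 2) monoid)"
proof (rule groupI)
  fix x :: "'a ^ 2 ^ 2" assume "x \<in> carrier sl2"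
  then show "\<exists>y\<in>carrier sl2. y \<otimes>\<^bsub>sl2\<^esub> x = \<one>\<^bsub>sl2\<^esub>"
    by (intro bexI[of _ "- x"]) (auto simp: sl2_def trace_minus_2)
qed (auto simp: sl2_def trace_add add.assoc)

text \<open>Nakayama's lemma for a free module of rank 3, by elimination: E, F and H are solved for
  in turn, the pivots being units because they are 1 modulo l.\<close>

lemma Nakayama_sl2:
  fixes Q :: "('p::prime_card padic_int ^ 2 ^ 2) set"
  assumes Q: "mat2.subspace Q" and ex: "\<And>A. trace A = 0 \<Longrightarrow> \<exists>B. trace B = 0 \<and> A - smul ell B \<in> Q"
    and A: "trace A = 0"
  shows "A \<in> Q"
proof -
  define H E F where "H = (mat2 1 0 0 (-1) :: 'p padic_int ^ 2 ^ 2)" and "E = (mat2 0 1 0 0 :: 'p padic_int ^ 2 ^ 2)"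
    and "F = (mat2 0 0 1 0 :: 'p padic_int ^ 2 ^ 2)"
  note add = mat2.subspace_add[OF Q] and scale = mat2.subspace_scale[OF Q]
  have decomp: "B = smul (B$1$1) H + smul (B$1$2) E + smul (B$2$1) F" if "trace B = 0" for B
    using trace_0_nth[OF that] by (simp add: mat2_eq_iff H_def E_def F_def)
  have tr: "trace H = 0" "trace E = 0" "trace F = 0" by (simp_all add: H_def E_def F_def trace_2)
  have ex': "\<exists>x y z. A - smul ell (smul x H + smul y E + smul z F) \<in> Q" if "trace A = 0" for A
    using ex[OF that] decomp by metis
  have unit: "\<exists>v. v * (1 - ell * x) = 1" for x :: "'p padic_int"
  proof -
    have "1 - ell * x dvd 1" by (simp add: padic_unit_iff_residue)
    then show ?thesis using padic_inverse(2) by blast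
  qed
  obtain x y z where "E - smul ell (smul x H + smul y E + smul z F) \<in> Q" using ex' tr by blast
  moreover obtain v where v: "v * (1 - ell * y) = 1" using unit by blast
  ultimately have "smul v (E - smul ell (smul x H + smul y E + smul z F)) \<in> Q" by (intro scale)
  also have "smul v (E - smul ell (smul x H + smul y E + smul z F)) =
      smul (v * (1 - ell * y)) E - smul ell (smul (v * x) H + smul (v * z) F)"
    by (simp add: mat2_eq_iff algebra_simps)
  finally obtain e1 e2 where EQ: "E - smul ell (smul e1 H + smul e2 F) \<in> Q" unfolding v by auto
  have elimE: "\<exists>y z. A - smul ell (smul y H + smul z F) \<in> Q" if tA: "trace A = 0" for A
  proof -
    obtain x y z where "A - smul ell (smul x H + smul y E + smul z F) \<in> Q" using ex' tA by blast
    from add[OF this scale[OF EQ, of "ell * y"]]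
    have "A - smul ell (smul (x + ell * y * e1) H + smul (z + ell * y * e2) F) \<in> Q"
      by (simp add: mat2.scale_right_distrib mat2.scale_left_distrib mat2.scale_right_diff_distrib algebra_simps)
    then show ?thesis by blast
  qed
  obtain y z where "F - smul ell (smul y H + smul z F) \<in> Q" using elimE tr by blast
  moreover obtain v where v: "v * (1 - ell * z) = 1" using unit by blast
  ultimately have "smul v (F - smul ell (smul y H + smul z F)) \<in> Q" by (intro scale)
  also have "smul v (F - smul ell (smul y H + smul z F)) = smul (v * (1 - ell * z)) F - smul ell (smul (v * y) H)"
    by (simp add: mat2_eq_iff algebra_simps)
  finally obtain f where FQ: "F - smul ell (smul f H) \<in> Q" unfolding v by auto
  obtain y z where "H - smul ell (smul y H + smul z F) \<in> Q" using elimE tr by blast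
  from add[OF this scale[OF FQ, of "ell * z"]] have "smul (1 - ell * (y + ell * z * f)) H \<in> Q"
    by (simp add: mat2.scale_right_distrib mat2.scale_left_distrib mat2.scale_right_diff_distrib
        mat2.scale_left_diff_distrib algebra_simps)
  moreover obtain v where "v * (1 - ell * (y + ell * z * f)) = 1" using unit by blast
  ultimately have HQ: "H \<in> Q" using scale[of "smul (1 - ell * (y + ell * z * f)) H" v] by simp
  have FQ': "F \<in> Q" using add[OF FQ scale[OF HQ, of "ell * f"]] by simp
  have "E \<in> Q" using add[OF EQ scale[OF add[OF scale[OF HQ, of e1] scale[OF FQ', of e2]], of ell]] by simp
  then show ?thesis by (subst decomp[OF A]) (intro add scale HQ FQ')
qed

lemma smul_2_Theta:
  fixes g :: "'p::prime_card padic_int ^ 2 ^ 2"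
  assumes odd: "odd CARD('p)"
  shows "smul 2 (Theta g) = Phi g"
proof -
  note u = two_padic_unit[OF odd]
  have half: "2 * half x = x" for x :: "'p padic_int"
    unfolding half_def
  proof (rule theI)
    show "2 * (padic_inverse 2 * x) = x" using padic_inverse(1)[OF u] by (simp add: mult.assoc[symmetric])
    fix y assume "2 * y = x"
    then have "padic_inverse 2 * x = padic_inverse 2 * 2 * y" by (simp add: mult.assoc)
    then show "y = padic_inverse 2 * x" using padic_inverse(2)[OF u] by simp
  qed
  show ?thesis
    by (simp add: Theta_def Phi_def mat2_eq_iff right_diff_distrib half) (simp add: trace_2)
qed

text \<open>The span enlarged by l^(s+1) sl_2 is open in sl_2, hence closed, and contains Theta g =
  c Theta x for g = c x. So it contains L(G), and \<open>Nakayama_sl2\<close> removes the summand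
  l^(s+1) sl_2. This avoids showing that the span itself is closed.\<close>

lemma Lie_imp_span:
  fixes G :: "('p::prime_card padic_int ^ 2 ^ 2) set"
  assumes odd: "odd CARD('p)" and G: "subgroup G GL2" and sq: "square_determinants G"
    and L: "l_power_sl2 s \<subseteq> Lie G" and A: "trace A = 0"
  shows "smul (ell ^ s) A \<in> mat2.span (Phi ` sat1 G)"
proof -
  let ?L = "mat2.span (Phi ` sat1 G)"
  note u = two_padic_unit[OF odd]
  let ?T = "{A. trace A = 0 \<and> (\<exists>B. trace B = 0 \<and> A - smul (ell ^ Suc s) B \<in> ?L)}"
  have T_add: "x + y \<in> ?T" if xy: "x \<in> ?T" "y \<in> ?T" for x y
  proof -
    obtain B C where "trace x = 0" "trace y = 0" "trace B = 0" "x - smul (ell ^ Suc s) B \<in> ?L"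
      "trace C = 0" "y - smul (ell ^ Suc s) C \<in> ?L" using xy by blast
    moreover from this have "(x - smul (ell ^ Suc s) B) + (y - smul (ell ^ Suc s) C) \<in> ?L" by (intro mat2.span_add)
    then have "x + y - smul (ell ^ Suc s) (B + C) \<in> ?L" by (simp add: mat2.scale_right_distrib algebra_simps)
    moreover have "trace (x + y) = 0" "trace (B + C) = 0" using calculation by (simp_all add: trace_add)
    ultimately show ?thesis by blast
  qed
  have T_neg: "- x \<in> ?T" if x: "x \<in> ?T" for x
  proof -
    obtain B where B: "trace x = 0" "trace B = 0" "x - smul (ell ^ Suc s) B \<in> ?L" using x by blast
    have "- (x - smul (ell ^ Suc s) B) = - x - smul (ell ^ Suc s) (- B)" by (simp add: mat2_eq_iff)
    then have "- x - smul (ell ^ Suc s) (- B) \<in> ?L" using mat2.span_neg[OF B(3)] by metis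
    moreover have "trace (- B) = 0" "trace (- x) = 0" using B by (simp_all add: trace_minus_2)
    ultimately show ?thesis by blast
  qed
  have L_T: "x \<in> ?T" if "x \<in> ?L" "trace x = 0" for x
    using that by (auto intro!: exI[of _ 0] simp: trace_2)
  have "closed_subgroup ?T sl2"
    unfolding closed_subgroup_def closedin_mat2_iff
  proof (intro conjI ballI impI)
    show "subgroup ?T sl2"
    proof (rule subgroup.intro)
      show "x \<otimes>\<^bsub>sl2\<^esub> y \<in> ?T" if "x \<in> ?T" "y \<in> ?T" for x y using T_add[OF that] by (simp add: sl2_def)
      show "\<one>\<^bsub>sl2\<^esub> \<in> ?T" using L_T[OF mat2.span_zero trace_0_2] by (simp add: sl2_def)
      fix x assume x: "x \<in> ?T"
      have "inv\<^bsub>sl2\<^esub> x = - x"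
        using x by (intro group.inv_equality[OF sl2_group]) (auto simp: sl2_def trace_minus_2)
      then show "inv\<^bsub>sl2\<^esub> x \<in> ?T" using T_neg[OF x] by simp
    qed (auto simp: sl2_def)
    show "?T \<subseteq> carrier sl2" by (auto simp: sl2_def)
    fix x :: "'p padic_int ^ 2 ^ 2"
    assume x: "x \<in> carrier sl2" and lim: "\<forall>n. \<exists>h\<in>?T. mdvd (ell ^ n) (h - x)"
    obtain h where h: "h \<in> ?T" "mdvd (ell ^ Suc s) (h - x)" using lim by blast
    then obtain B where B: "h - x = smul (ell ^ Suc s) B" by (auto simp: mdvd_iff)
    have "trace (h - x) = 0" using h(1) x by (simp add: sl2_def trace_sub)
    then have "ell ^ Suc s * trace B = 0" unfolding B trace_smul .
    then have tB: "trace (- B) = 0" using ell_cancel[of "Suc s" "trace B"] by (simp add: trace_minus_2)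
    have hx: "h - smul (ell ^ Suc s) B = x" by (simp only: B[symmetric]) simp
    have "h - smul (ell ^ Suc s) B \<in> ?T"
    proof -
      obtain C where C: "trace C = 0" "h - smul (ell ^ Suc s) C \<in> ?L" using h(1) by blast
      have "(h - smul (ell ^ Suc s) B) - smul (ell ^ Suc s) (C - B) \<in> ?L"
        using C(2) by (simp add: mat2.scale_right_diff_distrib)
      moreover have "trace (C - B) = 0" using C(1) tB by (simp add: trace_sub trace_minus_2)
      moreover have "trace (h - smul (ell ^ Suc s) B) = 0" unfolding hx using x by (simp add: sl2_def)
      ultimately show ?thesis by blast
    qed
    then show "x \<in> ?T" unfolding hx .
  qed
  moreover have "Theta ` G \<subseteq> ?T"
  proof (rule image_subsetI)
    fix g assume g: "g \<in> G"
    obtain c where c: "c dvd 1" "det g = c ^ 2" using sq g unfolding square_determinants_def by blast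
    let ?e = "padic_inverse c"
    have ce: "c * ?e = 1" using padic_inverse(1)[OF c(1)] .
    have "det (smul ?e g) = (c * ?e) ^ 2" by (simp add: det_smul c(2) power2_eq_square algebra_simps)
    moreover have "smul c (smul ?e g) = g" by (simp add: ce)
    ultimately have "smul ?e g \<in> sat1 G" using g c(1) ce by (auto simp: sat1_iff[OF G])
    then have "smul c (Phi (smul ?e g)) \<in> ?L" by (intro mat2.span_scale mat2.span_base) auto
    then have "smul 2 (Theta g) \<in> ?L" using ce by (simp add: smul_2_Theta[OF odd] Phi_smul)
    then have "Theta g \<in> ?L" by (rule subspace_unit_smul[OF mat2.subspace_span u])
    moreover have "2 * trace (Theta g) = 0" unfolding trace_smul[symmetric] smul_2_Theta[OF odd] by simp
    then have "trace (Theta g) = 0" using u padic_inverse(2) by (metis mult.assoc mult_1 mult_zero_right)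
    ultimately show "Theta g \<in> ?T" by (rule L_T)
  qed
  ultimately have "Lie G \<subseteq> ?T" unfolding Lie_def by (intro hull_minimal)
  then have T: "smul (ell ^ s) A \<in> ?T" if "trace A = 0" for A
  proof -
    have "smul (ell ^ s) A \<in> l_power_sl2 s"
      unfolding l_power_sl2_def smul_def using that by (intro imageI) (simp add: sl2_def)
    then show ?thesis using L \<open>Lie G \<subseteq> ?T\<close> by blast
  qed
  have "A \<in> {A. smul (ell ^ s) A \<in> ?L}"
  proof (rule Nakayama_sl2[OF subspace_smul_vimage[OF mat2.subspace_span] _ A])
    fix A :: "'p padic_int ^ 2 ^ 2" assume "trace A = 0"
    from T[OF this] obtain B where "trace B = 0" "smul (ell ^ s) A - smul (ell ^ Suc s) B \<in> ?L" by blast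
    then show "\<exists>B. trace B = 0 \<and> A - smul ell B \<in> {A. smul (ell ^ s) A \<in> ?L}"
      by (auto simp: mat2.scale_right_diff_distrib mult.commute intro!: exI[of _ B])
  qed
  then show ?thesis by blast
qed

section \<open>From the span over X to the span over its unipotent part\<close>

lemma cj_diff:
  "smul 2 (cj x Y - cj (adj x) Y) = smul (trace x) (bracket (Phi x) Y)"
  by (simp add: cj_def Phi_def mat2_simps algebra_simps)

lemma cj_linear: "cj x (a + b) = cj x a + cj x b" "cj x (smul c a) = smul c (cj x a)" "cj x 0 = 0"
  by (simp_all add: cj_def mult_distrib_2 smul_mult)

lemma trace_bracket_left [simp]: "trace (x ** bracket x y) = 0" "trace (x ** bracket y x) = 0"
  by (simp_all add: mat2_simps algebra_simps)

lemma sub_neg_mem: "mat2.subspace S \<Longrightarrow> - x \<in> S \<longleftrightarrow> x \<in> S"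
  by (metis mat2.subspace_neg minus_minus)

text \<open>
  The prime-to-\<open>\<ell>\<close> part acts on the span of the unipotent part: for \<open>H = Phi g\<close> the operator
  \<open>(ad H)\<^sup>2\<close> is, up to a unit, the projection onto the orthogonal complement of \<open>H\<close>, and it
  maps the span of \<open>X\<close> into that of \<open>unip X\<close>. The line of \<open>H\<close> is recovered by a bracket.
\<close>

lemma span_unip:
  fixes X :: "('p::prime_card padic_int ^ 2 ^ 2) set"
  assumes odd: "odd CARD('p)" and X: "sl2_subgroup X" and minus: "- mat 1 \<in> X"
    and tl: "torus_like (reduction X)" and gen: "trace_generic (reduction X)"
    and big: "\<And>A. trace A = 0 \<Longrightarrow> smul (ell ^ s) A \<in> mat2.span (Phi ` X)" and A: "trace A = 0"
  shows "smul (ell ^ (2 * s)) A \<in> mat2.span (Phi ` unip X)"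
proof -
  let ?U = "unip X"
  let ?L = "mat2.span (Phi ` ?U)"
  note D = sl2_subgroupD[OF X] and R = sl2_subgroup_reduction[OF X]
  note T = torus_likeD[OF tl R]
  note U = sl2_subgroup_unip[OF X tl]
  note two = two_padic_unit[OF odd]
  have four: "(4 :: 'p padic_int) dvd 1" using padic_unit_mult_iff[of "2 :: 'p padic_int" 2] two by simp
  have sixteen: "(16 :: 'p padic_int) dvd 1" using padic_unit_mult_iff[of "4 :: 'p padic_int" 4] four by simp
  note sub = mat2.subspace_span[of "Phi ` ?U"]
  note divide = subspace_unit_smul[OF sub]
  have base: "Phi u \<in> ?L" if "u \<in> ?U" for u using that by (intro mat2.span_base) simp
  have rX: "red x \<in> reduction X" if "x \<in> X" for x using that by (simp add: reduction_def)
  have brL: "bracket x y \<in> ?L" if "x \<in> ?L" "y \<in> ?L" for x y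
    using that
  proof (rule span_bracket[OF _ _ sub])
    fix a b assume "a \<in> Phi ` ?U" "b \<in> Phi ` ?U"
    then show "bracket a b \<in> ?L"
      by (auto simp: bracket_Phi intro!: mat2.span_scale mat2.span_diff base sl2_subgroupD[OF U])
  qed
  consider "\<forall>x\<in>X. trace (red x) ^ 2 = 4" | g where "g \<in> X" "trace (red g) ^ 2 \<noteq> 0" "trace (red g) ^ 2 \<noteq> 4"
    using gen unfolding trace_generic_def reduction_def by blast
  then show ?thesis
  proof cases
    case 1
    \<comment> \<open>Here X is the union of U and - U, and a sign in x only changes the sign of Phi
      x.\<close>
    have "Phi x \<in> ?L" if x: "x \<in> X" for x
      using trace_4_cases[of "red x"] 1 x
    proof -
      from 1 x have "trace (red x) = 2 \<or> trace (red x) = -2" by (intro trace_4_cases) blast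
      then show ?thesis
      proof
        assume "trace (red x) = 2"
        then show ?thesis using x by (intro base) (simp add: unip_def)
      next
        assume "trace (red x) = -2"
        then have "- x \<in> ?U" using sl2_subgroup_minus[OF X minus x] by (simp add: unip_def red_simps(6) trace_minus_2)
        moreover have "Phi (- x) = - Phi x" by (simp add: Phi_def adj_minus)
        ultimately show ?thesis using base[of "- x"] sub_neg_mem[OF sub] by simp
      qed
    qed
    then have "Phi ` X \<subseteq> ?L" by blast
    from subsetD[OF mat2.span_minimal[OF this sub] big[OF A]]
    have "smul (ell ^ s) (smul (ell ^ s) A) \<in> ?L" by (rule mat2.span_scale)
    then show ?thesis by (simp add: mult_2 power_add)
  next
    case 2
    define H where "H = Phi g"
    \<comment> \<open>The eigenvalue of (ad H)^2 on the trace-free matrices orthogonal to H. It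
      equals 4 (tr(g)^2 - 4), a unit because g is generic.\<close>
    define q where "q = 2 * trace (H ** H)"
    have trH: "trace H = 0" by (simp add: H_def)
    let ?\<tau> = "trace g"
    have \<tau>: "?\<tau> dvd 1" using 2(2) by (auto simp: padic_unit_iff_residue red_simps)
    have q_eq: "q = 4 * (?\<tau> ^ 2 - 4)"
      unfolding q_def H_def trace_Phi_square[OF D(4)[OF 2(1)], symmetric] by (simp add: power2_eq_square algebra_simps)
    have "?\<tau> ^ 2 - 4 dvd 1" using 2(3) by (simp add: padic_unit_iff_residue red_simps)
    then have q: "q dvd 1" unfolding q_eq padic_unit_mult_iff using four by simp
    have cjL: "cj x Y \<in> ?L" if x: "x \<in> X" and Y: "Y \<in> ?L" for x Y
      using Y
    proof (induction rule: mat2.span_induct)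
      show "mat2.subspace {Y. cj x Y \<in> ?L}"
        using sub by (auto simp: mat2.subspace_def cj_linear)
    next
      fix Y assume "Y \<in> Phi ` ?U"
      then obtain u where u: "u \<in> ?U" "Y = Phi u" by blast
      have "cj x Y = Phi (x ** u ** adj x)" using D(4)[OF x] by (simp add: cj_def u Phi_conj)
      then show "cj x Y \<in> ?L" using base conj_unip[OF X x u(1)] by simp
    qed
    \<comment> \<open>A module stable under conjugation by x is stable under ad (Phi x) if tr(x) is
      a unit, because conjugation by x minus conjugation by its inverse is tr(x)/2 times ad (Phi
      x).\<close>
    have adL: "bracket (Phi x) Y \<in> ?L" if x: "x \<in> X" "trace x dvd 1" and Y: "Y \<in> ?L" for x Y
    proof -
      have "smul 2 (cj x Y - cj (adj x) Y) \<in> ?L" using x(1) Y D(3) by (intro mat2.span_scale mat2.span_diff cjL)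
      then show ?thesis unfolding cj_diff by (rule divide[OF x(2)])
    qed
    note adH = adL[OF 2(1) \<tau>, folded H_def]
    define V where "V Z = bracket H (bracket H Z)" for Z
    have V_eq: "V Z = smul q Z - smul (2 * trace (H ** Z)) H" if "trace Z = 0" for Z
      unfolding V_def double_bracket[OF trH trH that] q_def ..
    have V_lin: "V (x + y) = V x + V y" "V (smul c x) = smul c (V x)" "V 0 = 0" "V (x - y) = V x - V y" for x y c
      by (simp_all add: V_def bracket_linear)
    have VH: "V H = 0" by (simp add: V_def bracket_linear)
    have VL: "V Z \<in> ?L" if "Z \<in> ?L" for Z unfolding V_def using that by (intro adH)
    have unit_case: "V (Phi h) \<in> ?L" if h: "h \<in> X" "trace h dvd 1" for h
    proof -
      \<comment> \<open>The quotient by U is abelian, so k g k^(-1) = g n with n in U. Expanding Phi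
        (g n) shows that conjugation moves H only within its line modulo the span over U.\<close>
      have cjH: "\<exists>c. smul 4 (cj k H) - smul c H \<in> ?L" if k: "k \<in> X" for k
      proof -
        define n where "n = adj g ** (k ** g ** adj k)"
        have nX: "n \<in> X" unfolding n_def by (intro D 2(1) k)
        have "trace (adj (red g) ** red k ** adj (adj (red g)) ** adj (red k)) = 2"
          by (intro T(2) rX k sl2_subgroupD(3)[OF R] 2(1))
        then have "n \<in> ?U" using nX by (simp add: unip_def n_def red_simps(1,2) matrix_mul_assoc)
        then have nL: "Phi n \<in> ?L" by (rule base)
        have gn: "g ** n = k ** g ** adj k" using D(4)[OF 2(1)] by (simp add: n_def adj_cancel)
        have "smul 4 (cj k H) = smul 4 (Phi (g ** n))"
          using D(4)[OF k] by (simp add: gn H_def cj_def Phi_conj)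
        then have "smul 4 (cj k H) - smul (2 * trace n) H = smul (2 * ?\<tau>) (Phi n) + bracket H (Phi n)"
          by (simp add: Phi_mult H_def)
        moreover have "\<dots> \<in> ?L" by (intro mat2.span_add mat2.span_scale nL adH)
        ultimately show ?thesis by metis
      qed
      obtain c d where cd: "smul 4 (cj h H) - smul c H \<in> ?L" "smul 4 (cj (adj h) H) - smul d H \<in> ?L"
        using cjH[OF h(1)] cjH[OF D(3)[OF h(1)]] by blast
      \<comment> \<open>By \<open>cj_diff\<close> this bracket is, up to a unit, the difference of
        two conjugates of H, hence a multiple of H modulo the span. Applying V kills H and
        multiplies the bracket, which is orthogonal to H, by the unit q.\<close>
      let ?w = "bracket (Phi h) H"
      have tw: "trace ?w = 0" by simp
      from mat2.span_diff[OF cd] have "smul 4 (cj h H - cj (adj h) H) - smul (c - d) H \<in> ?L"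
        by (simp add: mat2.scale_right_diff_distrib mat2.scale_left_diff_distrib algebra_simps)
      moreover have "smul 4 (cj h H - cj (adj h) H) = smul 2 (smul (trace h) ?w)"
        unfolding cj_diff[symmetric] by simp
      ultimately have "smul (2 * trace h) ?w - smul (c - d) H \<in> ?L" by simp
      from VL[OF this] have "smul (2 * trace h) (V ?w) \<in> ?L" by (simp add: V_lin VH)
      moreover have "2 * trace h dvd 1" using two h(2) by (simp only: padic_unit_mult_iff)
      ultimately have "V ?w \<in> ?L" using divide by blast
      then have "smul q ?w \<in> ?L" unfolding V_eq[OF tw] by simp
      then have "?w \<in> ?L" by (rule divide[OF q])
      then have "bracket H (- ?w) \<in> ?L" by (intro adH mat2.span_neg)
      then show ?thesis by (simp add: V_def flip: bracket_swap)
    qed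
    have V_Phi: "V (Phi h) \<in> ?L" if h: "h \<in> X" for h
    proof (cases "trace (red h) = 0")
      case False
      then show ?thesis using h by (intro unit_case) (simp_all add: padic_unit_iff_residue red_simps)
    next
      case True
      \<comment> \<open>If tr(h) vanishes modulo l, then tr(h g) does not, because tr(g)^2 is not 4;
        so the unit case applies to h g and has to be transferred back to h.\<close>
      have "trace (red h ** red g) \<noteq> 0" using T(3)[OF rX[OF h] rX[OF 2(1)] True] 2(3) by blast
      then have "trace (h ** g) dvd 1" by (simp add: padic_unit_iff_residue red_simps(1,4)[symmetric])
      then have k: "V (Phi (h ** g)) \<in> ?L" by (intro unit_case D h 2(1))
      let ?w = "V (Phi h)"
      have tw: "trace ?w = 0" by (simp add: V_def)
      have "V (bracket (Phi h) H) = - bracket H ?w"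
        unfolding V_def by (subst bracket_swap[of "Phi h"]) (simp add: bracket_def minus_mult_2 mult_distrib_2)
      moreover have "smul 4 (V (Phi (h ** g))) = V (smul (2 * trace h) H + smul (2 * ?\<tau>) (Phi h) + bracket (Phi h) H)"
        by (simp only: V_lin(2)[of 4, symmetric] Phi_mult H_def)
      ultimately have "smul 4 (V (Phi (h ** g))) = smul (2 * ?\<tau>) ?w - bracket H ?w"
        by (simp add: V_lin VH)
      then have z: "smul (2 * ?\<tau>) ?w - bracket H ?w \<in> ?L" using mat2.span_scale[OF k, of 4] by simp
      \<comment> \<open>On the complement of H, the operator 2 \<tau> + ad H inverts 2 \<tau> - ad H
        up to the unit 4 \<tau>^2 - q = 16.\<close>
      have "smul (2 * ?\<tau>) (smul (2 * ?\<tau>) ?w - bracket H ?w) + bracket H (smul (2 * ?\<tau>) ?w - bracket H ?w) \<in> ?L"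
        by (intro mat2.span_add mat2.span_scale adH z)
      also have "smul (2 * ?\<tau>) (smul (2 * ?\<tau>) ?w - bracket H ?w) + bracket H (smul (2 * ?\<tau>) ?w - bracket H ?w)
          = smul (4 * ?\<tau> ^ 2) ?w - V ?w"
        by (simp add: bracket_linear mat2.scale_right_diff_distrib V_def power2_eq_square algebra_simps)
      also have "V ?w = smul q ?w" unfolding V_eq[OF tw] by (simp add: V_def)
      also have "smul (4 * ?\<tau> ^ 2) ?w - smul q ?w = smul 16 ?w"
        by (simp add: q_eq mat2.scale_left_diff_distrib[symmetric])
      finally show ?thesis by (rule divide[OF sixteen])
    qed
    have V_span: "V Z \<in> ?L" if "Z \<in> mat2.span (Phi ` X)" for Z
      using that
    proof (induction rule: mat2.span_induct)
      show "mat2.subspace {Z. V Z \<in> ?L}" using sub by (auto simp: mat2.subspace_def V_lin)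
    qed (use V_Phi in auto)
    have V_big: "smul (ell ^ s) (V Z) \<in> ?L" if "trace Z = 0" for Z
      using V_span[OF big[OF that]] by (simp add: V_lin)
    define E F where "E = (mat2 0 1 0 0 :: 'p padic_int ^ 2 ^ 2)" and "F = (mat2 0 0 1 0 :: 'p padic_int ^ 2 ^ 2)"
    have trEF: "trace E = 0" "trace F = 0" by (simp_all add: E_def F_def trace_2)
    have trVV: "trace (V B ** V C) = q * (q * trace (B ** C) - 2 * trace (H ** B) * trace (H ** C))"
      if "trace B = 0" "trace C = 0" for B C
    proof -
      have "trace (V B ** V C) = q ^ 2 * trace (B ** C) - 2 * q * trace (H ** C) * trace (B ** H)
          - 2 * q * trace (H ** B) * trace (H ** C) + 2 * trace (H ** B) * trace (H ** C) * (2 * trace (H ** H))"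
        unfolding V_eq[OF that(1)] V_eq[OF that(2)]
        by (simp add: mult_distrib_2 smul_mult trace_sub trace_add trace_smul power2_eq_square algebra_simps)
      then show ?thesis unfolding trace_mul_sym[of B H] q_def[symmetric]
        by (simp add: power2_eq_square algebra_simps)
    qed
    \<comment> \<open>The trace form on the complement of H is nondegenerate modulo l. Witnesses are
      E taken twice if the lower left entry of H is a unit, and E with F otherwise.\<close>
    have "\<exists>B C. trace B = 0 \<and> trace C = 0 \<and> trace (V B ** V C) dvd 1"
    proof (cases "H$2$1 dvd 1")
      case True
      have "trace (V E ** V E) = q * (- 2 * (H$2$1 * H$2$1))"
        unfolding trVV[OF trEF(1) trEF(1)] by (simp add: E_def trace_2 mult_nth)
      moreover have "\<dots> dvd 1" using q True two by (simp add: padic_unit_mult_iff del: mult_minus_left)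
      ultimately show ?thesis using trEF by metis
    next
      case False
      have "trace (V E ** V F) = q * (q - 2 * H$2$1 * H$1$2)"
        unfolding trVV[OF trEF] by (simp add: E_def F_def trace_2 mult_nth)
      moreover have "\<dots> dvd 1" using q False by (simp add: padic_unit_iff_residue)
      ultimately show ?thesis using trEF by metis
    qed
    then obtain B C where BC: "trace B = 0" "trace C = 0" "trace (V B ** V C) dvd 1" by blast
    have tV: "trace (V Z) = 0" for Z by (simp add: V_def)
    have tHV: "trace (V Z ** H) = 0" for Z unfolding trace_mul_sym[of "V Z"] by (simp add: V_def)
    \<comment> \<open>As V B and V C are orthogonal to H, the triple product [V B, [H, V C]] is a
      multiple of H, with unit coefficient. Both entries are available only after multiplication by
      l^s, whence the exponent 2s.\<close>
    have "V (bracket H C) = bracket H (V C)" by (simp add: V_def)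
    then have "bracket (V B) (V (bracket H C)) = smul (- (2 * trace (V B ** V C))) H"
      using double_bracket[OF tV[of B] trH tV[of C]] by (simp add: tHV)
    moreover have "bracket (smul (ell ^ s) (V B)) (smul (ell ^ s) (V (bracket H C))) \<in> ?L"
      by (intro brL V_big BC) simp
    moreover have pow2: "ell ^ (2 * s) = ell ^ s * (ell ^ s :: 'p padic_int)" by (simp add: mult_2 power_add)
    ultimately have "smul (- (2 * trace (V B ** V C))) (smul (ell ^ (2 * s)) H) \<in> ?L"
      unfolding pow2 by (simp only: bracket_linear smul_smul ac_simps)
    moreover have "- (2 * trace (V B ** V C)) dvd 1" using two BC(3) by (simp add: padic_unit_mult_iff)
    ultimately have HL: "smul (ell ^ (2 * s)) H \<in> ?L" using divide by blast
    have "smul q (smul (ell ^ (2 * s)) A) =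
        smul (ell ^ s) (smul (ell ^ s) (V A)) + smul (2 * trace (H ** A)) (smul (ell ^ (2 * s)) H)"
      unfolding V_eq[OF A] pow2 by (simp add: mat2_eq_iff algebra_simps)
    moreover have "\<dots> \<in> ?L" by (intro mat2.span_add mat2.span_scale V_big A HL)
    ultimately have "smul q (smul (ell ^ (2 * s)) A) \<in> ?L" by simp
    then show ?thesis by (rule divide[OF q])
  qed
qed

section \<open>Commutators of elementary matrices\<close>

lemma mem_congruence_subgroup: "g \<in> congruence_subgroup n \<longleftrightarrow> det g = 1 \<and> mdvd (ell ^ n) (g - mat 1)"
  by (auto simp: congruence_subgroup_def SL2_def mdvd_def)

text \<open>Commutators of a diagonal matrix and transvections of level m give all transvections of
  level 2m. A matrix near 1 is a product of a lower, a diagonal and an upper factor, and a diagonal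
  one with upper left entry 1 + w^2 r, where w = l^(2m), is a product of four transvections of level
  2m. This is the reason for 4m.\<close>

lemma congruence_subgroup_derived:
  fixes G :: "('p::prime_card padic_int ^ 2 ^ 2) set"
  assumes odd: "odd CARD('p)" and G: "subgroup G GL2" and m: "m > 0" and B: "congruence_subgroup m \<subseteq> G"
  shows "congruence_subgroup (4 * m) \<subseteq> derived GL2 G"
proof
  let ?D = "derived GL2 G"
  note D = sl2_subgroupD[OF derived_sl2_subgroup(1)[OF G]]
  have comm: "x ** y ** adj x ** adj y \<in> ?D" if "x \<in> congruence_subgroup m" "y \<in> congruence_subgroup m" for x y
    using that B SL2_subset_sat1[OF G] by (intro commutator_derived[OF G]) (auto simp: mem_congruence_subgroup SL2_def)
  \<comment> \<open>Chosen so that a is 1 modulo l^m while a^2 - 1 = l^m (2 + l^m) is l^m times a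
    unit, l being odd.\<close>
  define a where "a = (1 + ell ^ m :: 'p padic_int)"
  have a: "a dvd 1" "2 + ell ^ m dvd (1 :: 'p padic_int)"
    using two_mod_ring_nonzero[OF odd] by (simp_all add: padic_unit_iff_residue a_def zero_power[OF m])
  define e where "e = padic_inverse a"
  have ae: "a * e = 1" "e * a = 1" using padic_inverse[OF a(1)] by (simp_all add: e_def)
  define f where "f = padic_inverse (2 + ell ^ m :: 'p padic_int)"
  have f: "(2 + ell ^ m) * f = 1" using padic_inverse[OF a(2)] by (simp add: f_def)
  let ?d = "mat2 a 0 0 e"
  have "e - 1 = - e * ell ^ m" using ae by (simp add: a_def algebra_simps)
  then have dB: "?d \<in> congruence_subgroup m"
    using ae by (simp add: mem_congruence_subgroup det_2 mdvd_2) (simp add: a_def)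
  have u: "upper (ell ^ m * z) \<in> congruence_subgroup m" "lower (ell ^ m * z) \<in> congruence_subgroup m" for z
    by (simp_all add: mem_congruence_subgroup det_2 mdvd_2 upper_def lower_def)
  have a2: "a * a - 1 = ell ^ m * (2 + ell ^ m)" by (simp add: a_def algebra_simps)
  have up: "upper (ell ^ (2 * m) * y) \<in> ?D" for y
  proof -
    let ?u = "upper (ell ^ m * (f * y))"
    have "?d ** ?u ** adj ?d ** adj ?u = upper ((a * a - 1) * (ell ^ m * (f * y)))"
      using ae by (simp add: upper_def mat2_simps algebra_simps)
    also have "(a * a - 1) * (ell ^ m * (f * y)) = ell ^ (2 * m) * (((2 + ell ^ m) * f) * y)"
      unfolding a2 mult_2 power_add by (simp only: ac_simps)
    finally show ?thesis using comm[OF dB u(1), of "f * y"] by (simp add: f)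
  qed
  have lo: "lower (ell ^ (2 * m) * y) \<in> ?D" for y
  proof -
    let ?u = "lower (ell ^ m * (f * y))"
    have "adj ?d ** ?u ** ?d ** adj ?u = lower ((a * a - 1) * (ell ^ m * (f * y)))"
      using ae by (simp add: lower_def mat2_simps algebra_simps)
    also have "(a * a - 1) * (ell ^ m * (f * y)) = ell ^ (2 * m) * (((2 + ell ^ m) * f) * y)"
      unfolding a2 mult_2 power_add by (simp only: ac_simps)
    finally have "lower (ell ^ (2 * m) * y) = adj ?d ** ?u ** adj (adj ?d) ** adj ?u" by (simp add: f)
    moreover have "adj ?d \<in> congruence_subgroup m"
      using dB by (simp add: mem_congruence_subgroup mdvd_2)
    ultimately show ?thesis using comm[OF _ u(2), of "adj ?d" "f * y"] by simp
  qed
  fix g :: "'p padic_int ^ 2 ^ 2" assume g: "g \<in> congruence_subgroup (4 * m)"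
  then have det: "g$1$1 * g$2$2 - g$1$2 * g$2$1 = 1"
    and dv: "ell ^ (4 * m) dvd g$1$1 - 1" "ell ^ (4 * m) dvd g$1$2" "ell ^ (4 * m) dvd g$2$1"
    by (simp_all add: mem_congruence_subgroup det_2 mdvd_2)
  obtain r s t where rst: "g$1$1 - 1 = ell ^ (4 * m) * r" "g$1$2 = ell ^ (4 * m) * s" "g$2$1 = ell ^ (4 * m) * t"
    using dv by (auto simp: dvd_def)
  define w where "w = (ell ^ (2 * m) :: 'p padic_int)"
  have w4: "ell ^ (4 * m) = w * w" by (simp add: w_def flip: power_add)
  have "ell dvd (ell ^ (4 * m) :: 'p padic_int)" using m by (intro dvd_power) simp
  then have "padic_residue (g$1$1) = 1" using padic_residue_eq_iff[of "g$1$1" 1] dvd_trans dv(1) by auto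
  then have gu: "g$1$1 dvd 1" by (simp add: padic_unit_iff_residue)
  define k where "k = padic_inverse (g$1$1)"
  have k: "g$1$1 * k = 1" using padic_inverse[OF gu] by (simp add: k_def)
  have g11: "g$1$1 = 1 + w * (w * r)" using rst(1)[unfolded w4] by (simp add: algebra_simps)
  have g22: "g$2$2 = (1 + g$1$2 * g$2$1) * k"
    using det k by (metis (no_types, opaque_lifting) add_diff_cancel_left' diff_add_cancel mult.commute mult.left_commute mult_1)
  have kz: "k * (g$1$1 * z) = z" for z using k by (simp only: mult.assoc[symmetric] mult.commute[of k] mult_1)
  have 1: "lower (g$2$1 * k) ** mat2 (g$1$1) 0 0 k ** upper (g$1$2 * k) = g"
    using k by (simp add: mat2_simps lower_def upper_def g22 algebra_simps kz)
  have kw: "k * (1 + w * (w * r)) = 1" using k by (simp add: g11 mult.commute)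
  \<comment> \<open>The inner product of \<open>upper w\<close> and \<open>lower (w * r)\<close> has
    upper left entry 1 + w (w r); the two outer factors clear the off-diagonal entries.\<close>
  have 2: "mat2 (g$1$1) 0 0 k = lower (- (w * r) * k) ** upper w ** lower (w * r) ** upper (- w * k)"
  proof -
    have "w - (1 + w * (w * r)) * w * k = w * (1 - k * (1 + w * (w * r)))" by (simp add: algebra_simps)
    then have e12: "w - (1 + w * (w * r)) * w * k = 0" unfolding kw by simp
    have "upper w ** lower (w * r) ** upper (- w * k) = mat2 (1 + w * (w * r)) (w - (1 + w * (w * r)) * w * k) (w * r) (1 - w * r * (w * k))"
      by (simp add: mat2_simps lower_def upper_def algebra_simps)
    also have "1 - w * r * (w * k) = k" using kw by (simp add: algebra_simps)
    finally have "lower (- (w * r) * k) ** (upper w ** lower (w * r) ** upper (- w * k))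
        = mat2 (1 + w * (w * r)) 0 (w * r - w * r * (k * (1 + w * (w * r)))) k"
      unfolding e12 by (simp add: mat2_simps lower_def algebra_simps)
    then show ?thesis unfolding kw by (simp add: matrix_mul_assoc g11)
  qed
  have up': "upper (w * y) \<in> ?D" and lo': "lower (w * y) \<in> ?D" for y using up lo by (simp_all add: w_def)
  have mem: "lower (w * (w * t * k)) ** (lower (w * (- r * k)) ** upper (w * 1) ** lower (w * r) ** upper (w * - k))
      ** upper (w * (w * s * k)) \<in> ?D"
    by (intro D(2) up' lo')
  have "lower (w * (w * t * k)) ** (lower (w * (- r * k)) ** upper (w * 1) ** lower (w * r) ** upper (w * - k))
      ** upper (w * (w * s * k)) = lower (g$2$1 * k) ** mat2 (g$1$1) 0 0 k ** upper (g$1$2 * k)"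
    unfolding 2 rst w4 by (simp add: mult.assoc)
  then show "g \<in> ?D" using mem unfolding 1 by (simp only:)
qed

text \<open>Approximation becomes membership as follows: B(4s) in G yields B(16s) in G', so it
  suffices to approximate g by d in G' modulo l^(16s), which leaves d^(-1) g in B(16s).\<close>

theorem congruence_subgroup_subset_derived:
  fixes G :: "('p::prime_card padic_int ^ 2 ^ 2) set"
  assumes odd: "odd CARD('p)" and G: "subgroup G GL2" and cl: "l_closed G"
    and sq: "square_determinants G" and cb: "cartan_or_borel_type G"
    and s: "s > 0" and L: "l_power_sl2 s \<subseteq> Lie G"
  shows "congruence_subgroup (4 * s) \<subseteq> derived GL2 G"
proof
  let ?X = "sat1 G" and ?D = "derived GL2 G"
  let ?U = "unip ?X"
  note X = sl2_subgroup_sat1[OF G]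
  have tg: "toral (reduction ?X)" "trace_generic (reduction ?X)"
    using cb cartan_or_borel_type_iff[OF odd G cl] by blast+
  have tl: "torus_like (reduction ?X)"
    by (rule toral_imp_torus_like[OF sl2_subgroup_reduction[OF X] tg(1) two_mod_ring_nonzero[OF odd]])
  note U = sl2_subgroup_unip[OF X tl]
  note DG = derived_sl2_subgroup[OF G]
  interpret pro_l_span ?U "?D \<inter> ?U" "2 * s"
  proof
    show "smul (ell ^ (2 * s)) A \<in> mat2.span (Phi ` ?U)" if "trace A = 0" for A
      by (rule span_unip[OF odd X minus_sat1[OF G] tl tg(2) Lie_imp_span[OF odd G sq L] that])
    show "x ** y ** adj x ** adj y \<in> ?D \<inter> ?U" if "x \<in> ?U" "y \<in> ?U" for x y
    proof
      show "x ** y ** adj x ** adj y \<in> ?U" using that by (intro sl2_subgroupD[OF U])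
      show "x ** y ** adj x ** adj y \<in> ?D" using that by (intro commutator_derived[OF G]) (auto simp: unip_def)
    qed
  qed (use odd U DG(1) sl2_subgroup_Int unip_iff in auto)
  have dense: "\<exists>d\<in>?D \<inter> ?U. mdvd (ell ^ k) (d - g)" if "g \<in> congruence_subgroup (4 * s)" for g k
    using commutators_dense[of g k] that s by (simp add: mult.assoc[symmetric])
  have "congruence_subgroup (4 * s) \<subseteq> G"
  proof
    fix g :: "'p padic_int ^ 2 ^ 2" assume g: "g \<in> congruence_subgroup (4 * s)"
    show "g \<in> G"
    proof (rule l_closed_limit[OF cl])
      show "det g dvd 1" using g by (simp add: mem_congruence_subgroup)
      show "\<exists>h\<in>G. mdvd (ell ^ n) (h - g)" for n using dense[OF g, of n] DG(2) by blast
    qed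
  qed
  then have B: "congruence_subgroup (4 * (4 * s)) \<subseteq> ?D" by (intro congruence_subgroup_derived[OF odd G]) (use s in auto)
  fix g :: "'p padic_int ^ 2 ^ 2" assume g: "g \<in> congruence_subgroup (4 * s)"
  obtain d where d: "d \<in> ?D" "mdvd (ell ^ (4 * (4 * s))) (d - g)" using dense[OF g] by blast
  have dd: "det d = 1" using sl2_subgroupD(4)[OF DG(1) d(1)] .
  have "mdvd (ell ^ (4 * (4 * s))) (adj d ** (g - d))" using d(2) mdvd_minus_commute mdvd_mult(2) by blast
  also have "adj d ** (g - d) = adj d ** g - mat 1" using dd by (simp add: mult_distrib_2 mult_adj)
  finally have "adj d ** g \<in> congruence_subgroup (4 * (4 * s))"
    using g dd by (simp add: mem_congruence_subgroup det_mul)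
  then have "adj d ** g \<in> ?D" using B by blast
  then have "d ** (adj d ** g) \<in> ?D" by (rule sl2_subgroupD(2)[OF DG(1) d(1)])
  then show "g \<in> ?D" using dd by (simp add: adj_cancel)
qed

section \<open>Subgroups with full reduction\<close>

lemma commutator_elementary:
  fixes a e :: "'a::comm_ring_1"
  assumes "a * e = 1"
  defines "d \<equiv> mat2 a 0 0 e"
  shows "d ** upper z ** adj d ** adj (upper z) = upper ((a * a - 1) * z)"
    "adj d ** lower z ** adj (adj d) ** adj (lower z) = lower ((a * a - 1) * z)"
  using assms(1) by (simp_all add: d_def upper_def lower_def mat2_simps algebra_simps)

text \<open>The commutator of diag(a, 1/a) with a transvection scales its parameter by a^2 - 1, a
  unit by assumption, so all transvections are commutators. Below a = 2 is used, and a^2 - 1 = 3 is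
  a unit for l \<ge> 5.\<close>

lemma SL2_perfect:
  fixes a e f :: "'a::comm_ring_1" and D :: "('a ^ 2 ^ 2) set"
  assumes ae: "a * e = 1" and f: "(a * a - 1) * f = 1"
    and loc: "\<And>x :: 'a ^ 2 ^ 2. det x = 1 \<Longrightarrow> x$1$1 dvd 1 \<or> x$2$1 dvd 1"
    and mult: "\<And>x y. x \<in> D \<Longrightarrow> y \<in> D \<Longrightarrow> x ** y \<in> D"
    and comm: "\<And>x y. det x = 1 \<Longrightarrow> det y = 1 \<Longrightarrow> x ** y ** adj x ** adj y \<in> D"
  shows "SL2 \<subseteq> D"
proof
  fix x :: "'a ^ 2 ^ 2" assume "x \<in> SL2"
  then have x: "det x = 1" by (simp add: SL2_def)
  let ?d = "mat2 a 0 0 e"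
  have d: "det ?d = 1" using ae by (simp add: det_2)
  have z: "(a * a - 1) * (f * z) = z" for z using f by (simp add: mult.assoc[symmetric])
  show "x \<in> D"
  proof (rule elementary_generate[OF mult _ _ x loc[OF x]])
    have det: "det (upper z) = 1" "det (lower z) = 1" for z :: 'a by (simp_all add: upper_def lower_def det_2)
    show "upper z \<in> D" for z
      using comm[OF d det(1), of "f * z"] unfolding commutator_elementary(1)[OF ae] z .
    have "det (adj ?d) = 1" using d by (simp only: det_adj)
    from comm[OF this det(2)] show "lower z \<in> D" for z
      unfolding commutator_elementary(2)[OF ae] using z by metis
  qed
qed

text \<open>Serre's lifting argument: \<open>\<ell>\<close>-th powers move elements one step down the congruence
  filtration, and \<open>\<ell> \<ge> 5\<close> is needed for the first step.\<close>

locale full_reduction =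
  fixes D :: "('p::prime_card padic_int ^ 2 ^ 2) set"
  assumes D: "sl2_subgroup D" and full: "SL2 \<subseteq> reduction D" and five: "CARD('p) \<ge> 5"
begin

text \<open>Leading coefficients of the n-th congruence layer of D; they matter only modulo
  l.\<close>

definition T :: "nat \<Rightarrow> ('p padic_int ^ 2 ^ 2) set" where
  "T n = {Y. \<exists>d\<in>D. mdvd (ell ^ Suc n) (d - (mat 1 + smul (ell ^ n) Y))}"

lemma T_cong: assumes "Y \<in> T n" "mdvd ell (Y - Z)" shows "Z \<in> T n"
proof -
  obtain d where d: "d \<in> D" "mdvd (ell ^ Suc n) (d - (mat 1 + smul (ell ^ n) Y))" using assms(1) by (auto simp: T_def)
  obtain W where "Y - Z = smul ell W" using assms(2) by (auto simp: mdvd_iff)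
  then have "mdvd (ell ^ Suc n) (smul (ell ^ n) (Y - Z))" by (simp add: mult.commute mdvd_smul)
  from mdvd_add[OF d(2) this] have "mdvd (ell ^ Suc n) (d - (mat 1 + smul (ell ^ n) Z))"
    by (simp add: mat2.scale_right_diff_distrib algebra_simps)
  then show ?thesis using d(1) by (auto simp: T_def)
qed

lemma T_add: assumes n: "n > 0" and "Y \<in> T n" "Z \<in> T n" shows "Y + Z \<in> T n"
proof -
  obtain d e where d: "d \<in> D" "mdvd (ell ^ Suc n) (d - (mat 1 + smul (ell ^ n) Y))"
      and e: "e \<in> D" "mdvd (ell ^ Suc n) (e - (mat 1 + smul (ell ^ n) Z))"
    using assms by (auto simp: T_def)
  have "mdvd (ell ^ Suc n) (d ** e - (mat 1 + smul (ell ^ n) Y) ** (mat 1 + smul (ell ^ n) Z))"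
    by (rule mdvd_cong_mult[OF d(2) e(2)])
  moreover have "mdvd (ell ^ Suc n) (smul (ell ^ (n + n)) (Y ** Z))"
    using n by (intro mdvd_smul(2) le_imp_power_dvd) simp
  ultimately have "mdvd (ell ^ Suc n) ((d ** e - (mat 1 + smul (ell ^ n) Y) ** (mat 1 + smul (ell ^ n) Z))
      + smul (ell ^ (n + n)) (Y ** Z))" by (rule mdvd_add)
  also have "(d ** e - (mat 1 + smul (ell ^ n) Y) ** (mat 1 + smul (ell ^ n) Z)) + smul (ell ^ (n + n)) (Y ** Z)
      = d ** e - (mat 1 + smul (ell ^ n) (Y + Z))"
    by (simp add: mult_distrib_2 smul_mult power_add mat2.scale_right_distrib)
  finally show ?thesis using sl2_subgroupD(2)[OF D d(1) e(1)] by (auto simp: T_def)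
qed

lemma T_smul: assumes n: "n > 0" and Y: "Y \<in> T n" shows "smul c Y \<in> T n"
proof -
  have nat: "smul (of_nat k) Y \<in> T n" for k
  proof (induction k)
    case 0
    show ?case using sl2_subgroupD(1)[OF D] by (auto simp: T_def intro!: bexI[of _ "mat 1"])
  next
    case (Suc k)
    then show ?case using T_add[OF n Y] by (simp add: mat2.scale_left_distrib)
  qed
  obtain k where "ell ^ 1 dvd c - of_nat k" using padic_approx_nat by blast
  then have "ell dvd of_nat k - c" by (metis dvd_minus_iff minus_diff_eq power_one_right)
  then have "mdvd ell (smul (of_nat k - c) Y)" by (rule mdvd_smul(2))
  then show ?thesis using T_cong[OF nat] by (simp add: mat2.scale_left_diff_distrib)
qed

text \<open>Lift 1 + Y to d in D and put M = d - 1. Since M^2 is divisible by l, M^4 is divisible by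
  l^2, hence so is M^l for l \<ge> 5, and d^l is congruent to 1 + l M, that is to 1 + l Y, modulo
  l^2. For l = 3 the term M^3 need not be divisible by l^2.\<close>

lemma T_1_nilpotent: assumes "Y ** Y = 0" "det (mat 1 + Y) = 1" shows "Y \<in> T 1"
proof -
  have "red (mat 1 + Y) \<in> SL2" using assms(2) by (simp add: SL2_def red_simps del: map_matrix_def)
  then obtain d where d: "d \<in> D" "red (mat 1 + Y) = red d" using full by (auto simp: reduction_def)
  define M where "M = d - mat 1"
  have MY: "mdvd ell (M - Y)" using red_eq_iff[of d "mat 1 + Y"] d(2) by (simp add: M_def algebra_simps)
  have MM: "mdvd ell (M ** M)" using mdvd_cong_mult[OF MY MY] assms(1) by simp
  then obtain W where W: "M ** M = smul ell W" by (auto simp: mdvd_iff)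
  have "mpow M 4 = smul (ell ^ 2) (W ** W)"
  proof -
    have "mpow M 4 = (M ** M) ** (M ** M)" by (simp add: numeral_eq_Suc matrix_mul_assoc)
    then show ?thesis by (simp add: W smul_mult power2_eq_square)
  qed
  then have "mdvd (ell ^ 2) (mpow M 4)" by (simp add: mdvd_smul(2))
  from mdvd_mpow_mono[OF this, of "CARD('p)"] have "mdvd (ell ^ 2) (mpow M CARD('p))" using five by simp
  moreover have "mdvd (ell ^ 2) (smul ell (M ** M))" unfolding W by (simp add: power2_eq_square mdvd_smul(2))
  ultimately have "mdvd (ell ^ 2) (mpow (mat 1 + M) CARD('p) - (mat 1 + smul ell M))" by (intro mdvd_mpow_ell)
  moreover have "mdvd (ell ^ 2) (smul ell (M - Y))"
    using MY by (auto simp: mdvd_iff power2_eq_square)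
  ultimately have "mdvd (ell ^ 2) ((mpow (mat 1 + M) CARD('p) - (mat 1 + smul ell M)) + smul ell (M - Y))"
    by (rule mdvd_add)
  moreover have dM: "mat 1 + M = d" by (simp add: M_def)
  have "(mpow (mat 1 + M) CARD('p) - (mat 1 + smul ell M)) + smul ell (M - Y) = mpow d CARD('p) - (mat 1 + smul (ell ^ 1) Y)"
    unfolding dM by (simp add: mat2_eq_iff algebra_simps)
  ultimately have "mdvd (ell ^ Suc 1) (mpow d CARD('p) - (mat 1 + smul (ell ^ 1) Y))"
    by (simp only: power_Suc power2_eq_square power_one_right)
  then show ?thesis using sl2_subgroup_mpow[OF D d(1)] unfolding T_def by blast
qed

text \<open>The l-th power of 1 + l^n Y has leading term l^(n+1) Y; the last binomial term is
  divisible by l^(n l), and n l \<ge> n + 2.\<close>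

lemma T_Suc: assumes n: "n > 0" and Y: "Y \<in> T n" shows "Y \<in> T (Suc n)"
proof -
  obtain d where d: "d \<in> D" "mdvd (ell ^ Suc n) (d - (mat 1 + smul (ell ^ n) Y))" using Y by (auto simp: T_def)
  then obtain Z where "d - (mat 1 + smul (ell ^ n) Y) = smul (ell ^ Suc n) Z" by (auto simp: mdvd_iff)
  then have dZ: "d = mat 1 + smul (ell ^ n) (Y + smul ell Z)"
    by (simp add: mat2.scale_right_distrib algebra_simps)
  define M where "M = smul (ell ^ n) (Y + smul ell Z)"
  have "smul ell (M ** M) = smul (ell ^ Suc (n + n)) ((Y + smul ell Z) ** (Y + smul ell Z))"
    by (simp add: M_def smul_mult power_add)
  then have 1: "mdvd (ell ^ Suc (Suc n)) (smul ell (M ** M))"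
    using n mdvd_smul(2)[OF le_imp_power_dvd, of "Suc (Suc n)" "Suc (n + n)"] by simp
  have "mpow M CARD('p) = smul (ell ^ (n * CARD('p))) (mpow (Y + smul ell Z) CARD('p))"
    by (simp add: M_def mpow_smul power_mult)
  moreover have "Suc (Suc n) \<le> n * CARD('p)"
    using mult_le_mono2[OF five, of n] n by linarith
  ultimately have 2: "mdvd (ell ^ Suc (Suc n)) (mpow M CARD('p))"
    by (metis mdvd_smul(2) le_imp_power_dvd)
  have "mdvd (ell ^ Suc (Suc n)) (smul (ell ^ Suc (Suc n)) Z)" by (simp add: mdvd_smul(2))
  from mdvd_add[OF mdvd_mpow_ell[OF 1 2] this]
  have "mdvd (ell ^ Suc (Suc n)) (mpow d CARD('p) - (mat 1 + smul (ell ^ Suc n) Y))"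
    by (simp add: M_def dZ mat2.scale_right_distrib mult.commute mult.left_commute algebra_simps)
  then show ?thesis using sl2_subgroup_mpow[OF D d(1)] unfolding T_def by blast
qed

lemma T_trace_0: assumes "trace Y = 0" shows "Y \<in> T (Suc n)"
proof (induction n)
  case 0
  \<comment> \<open>Matrices of square zero span sl_2: besides E and F, the third one has diagonal
    (1, -1).\<close>
  let ?E = "mat2 0 1 0 0 :: 'p padic_int ^ 2 ^ 2" and ?F = "mat2 0 0 1 0 :: 'p padic_int ^ 2 ^ 2"
    and ?N = "mat2 1 (-1) 1 (-1) :: 'p padic_int ^ 2 ^ 2"
  have "?E \<in> T 1" "?F \<in> T 1" "?N \<in> T 1" by (rule T_1_nilpotent; simp add: mat2_simps)+
  then have "smul (Y$1$1) ?N + smul (Y$1$1 + Y$1$2) ?E + smul (Y$2$1 - Y$1$1) ?F \<in> T 1"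
    by (intro T_add T_smul) simp_all
  also have "smul (Y$1$1) ?N + smul (Y$1$1 + Y$1$2) ?E + smul (Y$2$1 - Y$1$1) ?F = Y"
    using trace_0_nth[OF assms] by (simp add: mat2_eq_iff)
  finally show ?case by simp
qed (simp add: T_Suc)

lemma dense: assumes x: "det x = 1" shows "\<exists>d\<in>D. mdvd (ell ^ Suc n) (d - x)"
proof (induction n)
  case 0
  have "red x \<in> SL2" using x by (simp add: SL2_def red_simps)
  then obtain d where "d \<in> D" "red d = red x" using full by (auto simp: reduction_def)
  then show ?case using red_eq_iff[of d x] by auto
next
  case (Suc n)
  then obtain d where d: "d \<in> D" "mdvd (ell ^ Suc n) (d - x)" by blast
  have dd: "det d = 1" using sl2_subgroupD(4)[OF D d(1)] .
  let ?y = "adj d ** x"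
  have "mdvd (ell ^ Suc n) (adj d ** (x - d))" using d(2) mdvd_minus_commute mdvd_mult(2) by blast
  also have "adj d ** (x - d) = ?y - mat 1" using dd by (simp add: mult_distrib_2 mult_adj)
  finally obtain Y where "?y - mat 1 = smul (ell ^ Suc n) Y" by (auto simp: mdvd_iff)
  then have Y: "?y = mat 1 + smul (ell ^ Suc n) Y" by (simp add: algebra_simps)
  \<comment> \<open>Expanding the determinant of 1 + l^(n+1) Y shows that tr(Y) vanishes modulo l,
    so Y can be corrected to trace 0 without leaving its class modulo l.\<close>
  have "det ?y = 1" using dd x by (simp add: det_mul)
  then have "ell ^ Suc n * (trace Y + ell ^ Suc n * det Y) = 0"
    unfolding Y by (simp add: mat2_simps algebra_simps)
  then have "trace Y + ell ^ Suc n * det Y = 0" by (rule ell_cancel)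
  then have "trace Y = ell * (- (ell ^ n * det Y))" by (simp add: eq_neg_iff_add_eq_0 mult.assoc)
  then have tY: "ell dvd trace Y" by (metis dvd_triv_left)
  let ?Z = "Y - mat2 (trace Y) 0 0 0"
  have "?Z \<in> T (Suc n)" by (rule T_trace_0) (simp add: trace_2)
  then have "Y \<in> T (Suc n)" by (rule T_cong) (use tY in \<open>simp add: mdvd_2\<close>)
  then obtain e where e: "e \<in> D" "mdvd (ell ^ Suc (Suc n)) (e - ?y)" unfolding T_def Y by blast
  have "mdvd (ell ^ Suc (Suc n)) (d ** (e - ?y))" using e(2) by (rule mdvd_mult)
  also have "d ** (e - ?y) = d ** e - x" using dd by (simp add: mult_distrib_2 adj_cancel)
  finally show ?case using sl2_subgroupD(2)[OF D d(1) e(1)] by blast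
qed

end

text \<open>Perfectness is used twice: over the residue field, to see that G' still reduces onto
  SL_2, and over the l-adic integers, to return to the abstract derived subgroup once density and
  closedness have put SL_2 into G.\<close>

lemma derived_full:
  fixes G :: "('p::prime_card padic_int ^ 2 ^ 2) set"
  assumes G: "subgroup G GL2" and cl: "l_closed G" and full: "SL2 \<subseteq> reduction (sat1 G)" and five: "CARD('p) \<ge> 5"
  shows "derived GL2 G = SL2"
proof -
  let ?D = "derived GL2 G"
  note DG = derived_sl2_subgroup[OF G]
  have pos: "0 < k \<Longrightarrow> k < CARD('p) \<Longrightarrow> (of_nat k :: 'p mod_ring) \<noteq> 0" for k
    using of_nat_0_mod_ring_dvd dvd_imp_le by fastforce
  have nz: "(2 :: 'p mod_ring) \<noteq> 0" "(3 :: 'p mod_ring) \<noteq> 0" using pos[of 2] pos[of 3] five by simp_all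
  have "SL2 \<subseteq> reduction ?D"
  proof (rule SL2_perfect[of "2 :: 'p mod_ring" "inverse 2" "inverse 3"])
    show "x$1$1 dvd 1 \<or> x$2$1 dvd 1" if "det x = 1" for x :: "'p mod_ring ^ 2 ^ 2"
    proof -
      have "x$1$1 \<noteq> 0 \<or> x$2$1 \<noteq> 0" using that by (auto simp: det_2)
      then show ?thesis by (auto simp: dvd_field_iff)
    qed
    show "x ** y \<in> reduction ?D" if "x \<in> reduction ?D" "y \<in> reduction ?D" for x y
      by (rule sl2_subgroupD(2)[OF sl2_subgroup_reduction[OF DG(1)] that])
    fix x y :: "'p mod_ring ^ 2 ^ 2" assume "det x = 1" "det y = 1"
    then have "x \<in> reduction (sat1 G)" "y \<in> reduction (sat1 G)" using full by (auto simp: SL2_def)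
    then obtain a b where ab: "a \<in> sat1 G" "b \<in> sat1 G" "x = red a" "y = red b" by (auto simp: reduction_def)
    have "red (a ** b ** adj a ** adj b) \<in> reduction ?D"
      unfolding reduction_def by (intro imageI commutator_derived[OF G] ab)
    then show "x ** y ** adj x ** adj y \<in> reduction ?D" by (simp add: ab red_simps)
  qed (use nz in simp_all)
  then interpret full_reduction ?D using DG(1) five by unfold_locales auto
  have SG: "SL2 \<subseteq> G"
  proof
    fix x :: "'p padic_int ^ 2 ^ 2" assume "x \<in> SL2"
    then have x: "det x = 1" by (simp add: SL2_def)
    show "x \<in> G"
    proof (rule l_closed_limit[OF cl])
      fix n
      have "ell ^ n dvd (ell ^ Suc n :: 'p padic_int)" by simp
      then show "\<exists>h\<in>G. mdvd (ell ^ n) (h - x)" using dense[OF x, of n] DG(2) mdvd_trans by blast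
    qed (simp add: x)
  qed
  have unit: "(2 :: 'p padic_int) dvd 1" "(2 * 2 - 1 :: 'p padic_int) dvd 1"
    using nz by (simp_all add: padic_unit_iff_residue)
  have "SL2 \<subseteq> ?D"
  proof (rule SL2_perfect[OF padic_inverse(1)[OF unit(1)] padic_inverse(1)[OF unit(2)]])
    show "x$1$1 dvd 1 \<or> x$2$1 dvd 1" if "det x = 1" for x :: "'p padic_int ^ 2 ^ 2"
    proof (rule ccontr)
      assume "\<not> ?thesis"
      then have "padic_residue (det x) = 0" by (simp add: padic_unit_iff_residue det_2)
      then show False using that by simp
    qed
    show "x ** y \<in> ?D" if "x \<in> ?D" "y \<in> ?D" for x y by (rule sl2_subgroupD(2)[OF DG(1) that])
    fix x y :: "'p padic_int ^ 2 ^ 2" assume "det x = 1" "det y = 1"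
    then show "x ** y ** adj x ** adj y \<in> ?D"
      using SG SL2_subset_sat1[OF G] by (intro commutator_derived[OF G]) (auto simp: SL2_def)
  qed
  then show ?thesis using DG(1) by (auto simp: sl2_subgroup_def)
qed

section \<open>The subgroup of bounded index\<close>

text \<open>Determinants are squares by construction, and \<Delta> = SL_2 gives the whole
  square-determinant part of G when l is odd.\<close>

definition lift :: "('p::prime_card padic_int ^ 2 ^ 2) set \<Rightarrow> ('p mod_ring ^ 2 ^ 2) set \<Rightarrow> ('p padic_int ^ 2 ^ 2) set" where
  "lift G \<Delta> = {g \<in> G. \<exists>u x. u dvd 1 \<and> det x = 1 \<and> g = smul u x \<and> red x \<in> \<Delta>}"

lemma smul_unit_cancel:
  assumes "c dvd 1" "smul c A = smul c B" shows "A = (B :: 'a::comm_ring_1 ^ 2 ^ 2)"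
proof -
  obtain e where "1 = c * e" using assms(1) by (auto simp: dvd_def)
  then have "A = smul e (smul c A)" "B = smul e (smul c B)" by (simp_all add: mult.commute)
  then show ?thesis using assms(2) by simp
qed

lemma (in group) quotient_cancel_right:
  assumes "a \<in> carrier G" "b \<in> carrier G" "g \<in> carrier G"
  shows "(a \<otimes> g) \<otimes> inv (b \<otimes> g) = a \<otimes> inv b" "a \<otimes> inv b \<otimes> b = a"
proof -
  have "g \<otimes> (inv g \<otimes> inv b) = inv b" using assms by (simp add: m_assoc[symmetric])
  then show "(a \<otimes> g) \<otimes> inv (b \<otimes> g) = a \<otimes> inv b" using assms by (simp add: inv_mult_group m_assoc)
  show "a \<otimes> inv b \<otimes> b = a" using assms by (simp add: m_assoc)
qed

context
  fixes G :: "('p::prime_card padic_int ^ 2 ^ 2) set"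
  assumes odd: "odd CARD('p)" and G: "subgroup G GL2" and cl: "l_closed G"
begin

lemma lift_subset: "lift G \<Delta> \<subseteq> G"
  by (auto simp: lift_def)

lemma subgroup_lift:
  assumes \<Delta>: "sl2_subgroup \<Delta>" shows "subgroup (lift G \<Delta>) GL2"
proof (rule subgroup.intro)
  note D = sl2_subgroupD[OF \<Delta>]
  show "lift G \<Delta> \<subseteq> carrier GL2" using lift_subset subgroup.subset[OF G] by blast
  show "\<one>\<^bsub>GL2\<^esub> \<in> lift G \<Delta>"
    using subgroup.one_closed[OF G] D(1) by (auto simp: lift_def red_simps(3) intro!: exI[of _ 1] exI[of _ "mat 1"])
  fix g assume "g \<in> lift G \<Delta>"
  then obtain u x where g: "g \<in> G" "u dvd 1" "det x = 1" "g = smul u x" "red x \<in> \<Delta>" by (auto simp: lift_def)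
  obtain e where e: "1 = u * e" using g(2) by (auto simp: dvd_def)
  have i: "inv\<^bsub>GL2\<^esub> g = smul e (adj x)" unfolding g(4) using g(3) by (intro inv_GL2_smul[OF e]) (simp add: mult_adj)
  have "e dvd 1" unfolding e by simp
  moreover have "red (adj x) \<in> \<Delta>" using D(3)[OF g(5)] by (simp add: red_simps(2))
  moreover have "det (adj x) = 1" using g(3) by simp
  ultimately show "inv\<^bsub>GL2\<^esub> g \<in> lift G \<Delta>"
    using subgroup.m_inv_closed[OF G g(1)] i unfolding lift_def by blast
  fix h assume "h \<in> lift G \<Delta>"
  then obtain v y where h: "h \<in> G" "v dvd 1" "det y = 1" "h = smul v y" "red y \<in> \<Delta>" by (auto simp: lift_def)
  have "g ** h = smul (u * v) (x ** y)" by (simp add: g(4) h(4) smul_mult mult.commute)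
  moreover have "u * v dvd 1" using mult_dvd_mono[OF g(2) h(2)] by simp
  moreover have "det (x ** y) = 1" using g(3) h(3) by (simp add: det_mul)
  moreover have "red (x ** y) \<in> \<Delta>" using D(2)[OF g(5) h(5)] by (simp add: red_simps(1))
  moreover have "g ** h \<in> G" using subgroup.m_closed[OF G g(1) h(1)] by simp
  ultimately show "g \<otimes>\<^bsub>GL2\<^esub> h \<in> lift G \<Delta>" unfolding lift_def by auto
qed

lemma square_det_lift: "square_determinants (lift G \<Delta>)"
  by (auto simp: square_determinants_def lift_def det_smul)

lemma square_det_conv:
  assumes "g \<in> G" "\<exists>v. padic_residue (det g) = v ^ 2"
  shows "g \<in> lift G SL2"
proof -
  have "det g dvd 1" using subgroup.subset[OF G] assms(1) by auto
  from padic_square_unit_iff[OF odd this] assms(2) obtain u where u: "u dvd 1" "det g = u ^ 2" by auto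
  let ?x = "smul (padic_inverse u) g"
  have "det ?x = (u * padic_inverse u) ^ 2" by (simp add: det_smul u(2) power2_eq_square algebra_simps)
  then have x: "det ?x = 1" using padic_inverse(1)[OF u(1)] by simp
  moreover have "g = smul u ?x" using padic_inverse(1)[OF u(1)] by simp
  moreover have "red ?x \<in> SL2" using x by (simp add: SL2_def red_simps(5))
  ultimately show ?thesis using assms(1) u(1) unfolding lift_def by blast
qed

lemma l_closed_lift: "l_closed (lift G \<Delta>)"
  unfolding l_closed_def
proof (intro allI impI)
  fix g :: "'p padic_int ^ 2 ^ 2"
  assume lim: "\<forall>n. \<exists>h\<in>lift G \<Delta>. mdvd (ell ^ n) (h - g)" and dg: "det g dvd 1"
  have gG: "g \<in> G" using l_closed_limit[OF cl dg] lim lift_subset by blast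
  obtain h where "h \<in> lift G \<Delta>" and hg: "mdvd (ell ^ 1) (h - g)" using lim by blast
  then obtain u x where h: "u dvd 1" "det x = 1" "h = smul u x" "red x \<in> \<Delta>" by (auto simp: lift_def)
  have rhg: "red h = red g" using hg red_eq_iff[of h g] by simp
  then have "padic_residue (det g) = padic_residue u ^ 2"
    using h by (metis det_smul mult_1_right padic_residue_power red_simps(5))
  then obtain w0 where w0: "w0 dvd 1" "det g = w0 ^ 2" "padic_residue w0 ^ 2 = padic_residue u ^ 2"
    using padic_square_unit_iff[OF odd dg] by (metis padic_residue_power)
  \<comment> \<open>A square root of det g is determined only up to sign. The sign is chosen to
    agree with u modulo l, so that the determinant-one parts of g and h have the same
    reduction.\<close>
  define w where "w = (if padic_residue w0 = padic_residue u then w0 else - w0)"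
  have w: "w dvd 1" "det g = w ^ 2" "padic_residue w = padic_residue u"
    using w0 by (auto simp: w_def power2_eq_iff)
  let ?y = "smul (padic_inverse w) g"
  have wi: "w * padic_inverse w = 1" by (rule padic_inverse(1)[OF w(1)])
  have "det ?y = (w * padic_inverse w) ^ 2" by (simp add: det_smul w(2) power2_eq_square algebra_simps)
  then have y: "det ?y = 1" using wi by simp
  have gy: "g = smul w ?y" using wi by simp
  have "smul (padic_residue u) (red ?y) = red g" using gy w(3) by (metis red_simps(7))
  also have "\<dots> = smul (padic_residue u) (red x)" using rhg by (simp add: h(3) red_simps(7))
  finally have *: "smul (padic_residue u) (red ?y) = smul (padic_residue u) (red x)" .
  have "padic_residue u dvd 1" using h(1) by (simp add: padic_unit_iff_residue dvd_field_iff)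
  from smul_unit_cancel[OF this *] have "red ?y \<in> \<Delta>" using h(4) by (simp only:)
  then have "\<exists>u x. u dvd 1 \<and> det x = 1 \<and> g = smul u x \<and> red x \<in> \<Delta>" using gy w(1) y by blast
  then show "g \<in> lift G \<Delta>" using gG by (simp add: lift_def)
qed

lemma reduction_sat1_lift:
  assumes \<Delta>: "sl2_subgroup \<Delta>" "- mat 1 \<in> \<Delta>" "\<Delta> \<subseteq> reduction (sat1 G)"
  shows "reduction (sat1 (lift G \<Delta>)) = \<Delta>"
proof (intro equalityI subsetI)
  note s = sat1_iff[OF subgroup_lift[OF \<Delta>(1)]]
  fix z assume "z \<in> reduction (sat1 (lift G \<Delta>))"
  then obtain y where y: "z = red y" "y \<in> sat1 (lift G \<Delta>)" by (auto simp: reduction_def)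
  then obtain c where c: "det y = 1" "c dvd 1" "smul c y \<in> lift G \<Delta>" unfolding s by blast
  then obtain u x where x: "u dvd 1" "det x = 1" "smul c y = smul u x" "red x \<in> \<Delta>" by (auto simp: lift_def)
  \<comment> \<open>The scalar is determined up to sign modulo l, and the sign is absorbed by -1 in
    \<Delta>.\<close>
  have "c ^ 2 = u ^ 2" using arg_cong[OF x(3), of det] c(1) x(2) by (simp add: det_smul)
  then have "padic_residue c ^ 2 = padic_residue u ^ 2" by (metis padic_residue_power)
  then have cu: "padic_residue c = padic_residue u \<or> padic_residue c = - padic_residue u" by (simp add: power2_eq_iff)
  have eq: "smul (padic_residue c) (red y) = smul (padic_residue u) (red x)"
    using arg_cong[OF x(3), of red] by (simp add: red_simps(7))
  have ud: "padic_residue u dvd 1" using x(1) by (simp add: padic_unit_iff_residue dvd_field_iff)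
  from cu show "z \<in> \<Delta>"
  proof
    assume "padic_residue c = padic_residue u"
    then have "red y = red x" using eq smul_unit_cancel[OF ud] by simp
    then show ?thesis using y(1) x(4) by simp
  next
    assume "padic_residue c = - padic_residue u"
    then have "smul (padic_residue u) (- red y) = smul (padic_residue u) (red x)" using eq by simp
    then have "- red y = red x" by (rule smul_unit_cancel[OF ud])
    then have "red y = - red x" by (metis minus_minus)
    then show ?thesis using y(1) sl2_subgroup_minus[OF \<Delta>(1,2) x(4)] by simp
  qed
next
  fix z assume z: "z \<in> \<Delta>"
  then obtain y where y: "z = red y" "y \<in> sat1 G" using \<Delta>(3) by (auto simp: reduction_def)
  then obtain c where c: "det y = 1" "c dvd 1" "smul c y \<in> G" unfolding sat1_iff[OF G] by blast
  then have "smul c y \<in> lift G \<Delta>" using z y(1) by (auto simp: lift_def)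
  then have "y \<in> sat1 (lift G \<Delta>)" using c sat1_iff[OF subgroup_lift[OF \<Delta>(1)]] by blast
  then show "z \<in> reduction (sat1 (lift G \<Delta>))" using y(1) by (simp add: reduction_def)
qed

text \<open>Elements of G are sorted by whether their determinant is a square and by a coset of
  \<Delta> in R, those of nonsquare determinant being first multiplied by a fixed g1 of the same
  kind. There are at most 2 * 12 classes, and each lies in one coset of
  \<open>lift G \<Delta>\<close>.\<close>

lemma index_lift:
  assumes \<Delta>: "sl2_subgroup \<Delta>" "\<Delta> \<subseteq> R" and R: "R = reduction (sat1 (lift G SL2))"
    and card: "card R \<le> 12 * card \<Delta>"
  shows "finite (rcosets\<^bsub>GL2\<lparr>carrier := G\<rparr>\<^esub> (lift G \<Delta>))"
    "card (rcosets\<^bsub>GL2\<lparr>carrier := G\<rparr>\<^esub> (lift G \<Delta>)) \<le> 24"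
proof -
  let ?G = "GL2\<lparr>carrier := G\<rparr>" and ?H = "lift G \<Delta>"
  note G1 = subgroup_lift[OF sl2_subgroup_SL2]
  have Rg: "sl2_subgroup R" unfolding R by (intro sl2_subgroup_reduction sl2_subgroup_sat1 G1)
  define x where "x b = (SOME x. \<exists>u. u dvd 1 \<and> det x = 1 \<and> b = smul u x)" for b :: "'p padic_int ^ 2 ^ 2"
  have x: "\<exists>u. u dvd 1 \<and> det (x b) = 1 \<and> b = smul u (x b)" if "b \<in> lift G SL2" for b
  proof -
    have "\<exists>x u. u dvd 1 \<and> det x = 1 \<and> b = smul u x" using that by (auto simp: lift_def)
    then show ?thesis unfolding x_def by (rule someI_ex)
  qed
  let ?C = "\<lambda>y. (\<lambda>d. d ** y) ` \<Delta>"
  have xR: "red (x b) \<in> R" if b: "b \<in> lift G SL2" for b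
  proof -
    have "x b \<in> sat1 (lift G SL2)" using x[OF b] b unfolding sat1_iff[OF G1] by metis
    then show ?thesis unfolding R reduction_def by (rule imageI)
  qed
  have same: "b \<otimes>\<^bsub>GL2\<^esub> inv\<^bsub>GL2\<^esub> b' \<in> ?H" if b: "b \<in> lift G SL2" "b' \<in> lift G SL2" "?C (red (x b)) = ?C (red (x b'))" for b b'
  proof -
    obtain u v where u: "u dvd 1" "det (x b) = 1" "b = smul u (x b)" and v: "v dvd 1" "det (x b') = 1" "b' = smul v (x b')"
      using x[OF b(1)] x[OF b(2)] by blast
    obtain e where e: "1 = v * e" using v(1) by (auto simp: dvd_def)
    have i: "inv\<^bsub>GL2\<^esub> b' = smul e (adj (x b'))"
      using inv_GL2_smul[OF e, of "x b'" "adj (x b')"] v(2,3) by (simp add: mult_adj)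
    have eq: "b \<otimes>\<^bsub>GL2\<^esub> inv\<^bsub>GL2\<^esub> b' = smul (u * e) (x b ** adj (x b'))"
    proof -
      have "smul u (x b) ** smul e (adj (x b')) = smul (u * e) (x b ** adj (x b'))" by (simp add: smul_mult mult.commute)
      then show ?thesis unfolding i GL2_simps(2) using arg_cong[OF u(3), of "\<lambda>b. b ** smul e (adj (x b'))"] by (rule trans[rotated])
    qed
    have "red (x b) \<in> ?C (red (x b))" using sl2_subgroupD(1)[OF \<Delta>(1)] by (intro image_eqI[of _ _ "mat 1"]) simp_all
    then obtain d where d: "d \<in> \<Delta>" "red (x b) = d ** red (x b')" unfolding b(3) by blast
    have dv: "det (red (x b')) = 1" using v(2) by (simp add: red_simps(5))
    have "red (x b ** adj (x b')) = d" by (simp add: red_simps(1,2) d(2) adj_cancel[OF dv])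
    moreover have "u * e dvd 1" using mult_dvd_mono[OF u(1), of e 1] e by (metis dvd_triv_right mult_1)
    moreover have "det (x b ** adj (x b')) = 1" using u(2) v(2) by (simp add: det_mul)
    moreover have "b \<otimes>\<^bsub>GL2\<^esub> inv\<^bsub>GL2\<^esub> b' \<in> G"
      by (intro subgroup.m_closed[OF G] subgroup.m_inv_closed[OF G] subsetD[OF lift_subset b(1)] subsetD[OF lift_subset b(2)])
    ultimately show ?thesis using d(1) unfolding eq lift_def by blast
  qed
  \<comment> \<open>The choice is meaningful only if some determinant is a nonsquare; every fact
    about g1 is stated under that assumption.\<close>
  define g1 where "g1 = (SOME g. g \<in> G - lift G SL2)"
  have g1: "g1 \<in> G - lift G SL2" if "a \<in> G - lift G SL2" for a unfolding g1_def using that by (rule someI)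
  have ag: "a ** g1 \<in> lift G SL2" if a: "a \<in> G - lift G SL2" for a
  proof -
    have "\<nexists>v. padic_residue (det a) = v ^ 2" "\<nexists>v. padic_residue (det g1) = v ^ 2"
      using square_det_conv a g1[OF a] by blast+
    from mod_ring_nonsquare_mult[OF odd this] have "\<exists>v. padic_residue (det (a ** g1)) = v ^ 2" by (simp add: det_mul)
    moreover have "a ** g1 \<in> G" using subgroup.m_closed[OF G, of a g1] a g1[OF a] by simp
    ultimately show ?thesis by (intro square_det_conv)
  qed
  define r where "r a = (if a \<in> lift G SL2 then (True, ?C (red (x a))) else (False, ?C (red (x (a ** g1)))))" for a
  let ?K = "rcosets\<^bsub>GL2\<lparr>carrier := R\<rparr>\<^esub> \<Delta>"
  have KR: "?C y \<in> ?K" if "y \<in> R" for y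
    using that by (auto simp: RCOSETS_def r_coset_def intro!: bexI[of _ y])
  have rsub: "r ` G \<subseteq> UNIV \<times> ?K"
    using KR xR ag by (auto simp: r_def)
  have "card ?K * card \<Delta> = card R"
    using group.lagrange[OF group_sl2_subgroup[OF Rg]] subgroup_sl2_subgroup_iff[OF Rg] \<Delta> by (simp add: order_def)
  moreover have "card \<Delta> > 0" using sl2_subgroupD(1)[OF \<Delta>(1)] by (auto simp: card_gt_0_iff)
  ultimately have K: "card ?K \<le> 12" using card by (metis mult_le_cancel2)
  have fK: "finite ?K" by simp
  have fr: "finite (r ` G)" by (rule finite_subset[OF rsub]) (use fK in simp)
  have "card (r ` G) \<le> card ((UNIV :: bool set) \<times> ?K)" by (rule card_mono[OF _ rsub]) (use fK in simp)
  also have "\<dots> \<le> 24" using K by (simp add: card_cartesian_product)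
  finally have cr: "card (r ` G) \<le> 24" .
  interpret g: group ?G by (rule group.subgroup_imp_group[OF group_GL2 G])
  have Hsub: "subgroup ?H ?G"
    by (rule group.subgroup_incl[OF group_GL2 subgroup_lift[OF \<Delta>(1)] G lift_subset])
  have eq: "?H #>\<^bsub>?G\<^esub> a = ?H #>\<^bsub>?G\<^esub> a'" if a: "a \<in> G" "a' \<in> G" "r a = r a'" for a a'
  proof -
    have inv_mem: "\<And>b. b \<in> G \<Longrightarrow> b \<in> carrier GL2" using subgroup.subset[OF G] by blast
    interpret gl: group "GL2 :: ('p padic_int ^ 2 ^ 2) monoid" by (rule group_GL2)
    have aa: "a = a \<otimes>\<^bsub>GL2\<^esub> inv\<^bsub>GL2\<^esub> a' \<otimes>\<^bsub>GL2\<^esub> a'"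
      using gl.quotient_cancel_right(2)[OF inv_mem[OF a(1)] inv_mem[OF a(2)] inv_mem[OF a(1)]] by (rule sym)
    have "\<exists>h\<in>?H. a = h \<otimes>\<^bsub>GL2\<^esub> a'"
    proof (cases "a \<in> lift G SL2")
      case True
      then have "a' \<in> lift G SL2" "?C (red (x a)) = ?C (red (x a'))" using a(3) by (auto simp: r_def split: if_splits)
      then have "a \<otimes>\<^bsub>GL2\<^esub> inv\<^bsub>GL2\<^esub> a' \<in> ?H" by (intro same True)
      then show ?thesis using aa by blast
    next
      case False
      then have F: "a' \<notin> lift G SL2" "?C (red (x (a ** g1))) = ?C (red (x (a' ** g1)))" using a(3) by (auto simp: r_def split: if_splits)
      let ?b = "a \<otimes>\<^bsub>GL2\<^esub> g1" and ?b' = "a' \<otimes>\<^bsub>GL2\<^esub> g1"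
      have "?b \<otimes>\<^bsub>GL2\<^esub> inv\<^bsub>GL2\<^esub> ?b' \<in> ?H" using same[OF ag[of a] ag[of a'] F(2)] a(1,2) False F(1) by simp
      moreover have g1c: "g1 \<in> carrier GL2" using g1[of a] a(1) False inv_mem by blast
      have "?b \<otimes>\<^bsub>GL2\<^esub> inv\<^bsub>GL2\<^esub> ?b' = a \<otimes>\<^bsub>GL2\<^esub> inv\<^bsub>GL2\<^esub> a'"
        by (rule gl.quotient_cancel_right(1)[OF inv_mem[OF a(1)] inv_mem[OF a(2)] g1c])
      ultimately have "a \<otimes>\<^bsub>GL2\<^esub> inv\<^bsub>GL2\<^esub> a' \<in> ?H" by (simp only:)
      then show ?thesis using aa by blast
    qed
    then have "a \<in> ?H #>\<^bsub>?G\<^esub> a'" unfolding r_coset_def by simp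
    then have "?H #>\<^bsub>?G\<^esub> a' = ?H #>\<^bsub>?G\<^esub> a" by (rule g.repr_independence) (use Hsub a(2) in simp_all)
    then show ?thesis by (rule sym)
  qed
  have R: "rcosets\<^bsub>?G\<^esub> ?H = (\<lambda>a. ?H #>\<^bsub>?G\<^esub> a) ` G" by (auto simp: RCOSETS_def)
  show "finite (rcosets\<^bsub>?G\<^esub> ?H)" unfolding R by (rule finite_image_factor(1)[OF fr eq])
  have "card ((\<lambda>a. ?H #>\<^bsub>?G\<^esub> a) ` G) \<le> card (r ` G)" by (rule finite_image_factor(2)[OF fr eq])
  then show "card (rcosets\<^bsub>?G\<^esub> ?H) \<le> 24" unfolding R using cr by (rule le_trans)
qed

lemma lift_SL2_sat1: "reduction (sat1 (lift G SL2)) \<subseteq> reduction (sat1 G)"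
proof -
  have "sat1 (lift G SL2) \<subseteq> sat1 G"
  proof
    fix y assume "y \<in> sat1 (lift G SL2)"
    then obtain c where "det y = 1" "c dvd 1" "smul c y \<in> G"
      unfolding sat1_iff[OF subgroup_lift[OF sl2_subgroup_SL2]] using lift_subset[of SL2] by blast
    then show "y \<in> sat1 G" unfolding sat1_iff[OF G] by blast
  qed
  then show ?thesis unfolding reduction_def by (rule image_mono)
qed

theorem derived_eq_SL2_or_subgroup_of_bounded_index:
  "derived GL2 G = SL2 \<or>
    (\<exists>H. closed_subgroup H (GL2\<lparr>carrier := G\<rparr>) \<and>
       finite (rcosets\<^bsub>GL2\<lparr>carrier := G\<rparr>\<^esub> H) \<and>
       card (rcosets\<^bsub>GL2\<lparr>carrier := G\<rparr>\<^esub> H) \<le> 24 \<and>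
       square_determinants H \<and> cartan_or_borel_type H)"
proof -
  let ?R = "reduction (sat1 (lift G SL2))"
  note G1 = subgroup_lift[OF sl2_subgroup_SL2]
  note S = sl2_subgroup_sat1[OF G1]
  have "red (- mat 1) \<in> ?R" unfolding reduction_def by (intro imageI minus_sat1 G1)
  then have minus: "- mat 1 \<in> ?R" by (simp add: red_simps(3,6))
  consider "?R = SL2" "CARD('p) \<ge> 5"
    | \<Delta> where "\<Delta> \<subseteq> ?R" "sl2_subgroup \<Delta>" "- mat 1 \<in> \<Delta>" "card ?R \<le> 12 * card \<Delta>" "toral \<Delta>" "trace_generic \<Delta>"
    using subgroup_classification[OF odd sl2_subgroup_reduction[OF S] minus] by blast
  then show ?thesis
  proof cases
    case 1
    then have "SL2 \<subseteq> reduction (sat1 G)" using lift_SL2_sat1 by blast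
    then show ?thesis using derived_full[OF G cl _ 1(2)] by blast
  next
    case 2
    let ?H = "lift G \<Delta>"
    note H = subgroup_lift[OF 2(2)]
    have "\<Delta> \<subseteq> reduction (sat1 G)" using 2(1) lift_SL2_sat1 by blast
    then have "reduction (sat1 ?H) = \<Delta>" by (rule reduction_sat1_lift[OF 2(2,3)])
    then have "cartan_or_borel_type ?H"
      using cartan_or_borel_type_iff[OF odd H l_closed_lift] 2(5,6) by simp
    moreover have "closed_subgroup ?H (GL2\<lparr>carrier := G\<rparr>)"
      unfolding closed_subgroup_def closedin_mat2_iff
    proof (intro conjI ballI impI)
      show "subgroup ?H (GL2\<lparr>carrier := G\<rparr>)"
        by (rule group.subgroup_incl[OF group_GL2 H G lift_subset])
      show "?H \<subseteq> carrier (GL2\<lparr>carrier := G\<rparr>)" using lift_subset by simp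
      fix g assume "g \<in> carrier (GL2\<lparr>carrier := G\<rparr>)" "\<forall>n. \<exists>h\<in>?H. mdvd (ell ^ n) (h - g)"
      then show "g \<in> ?H" using l_closed_limit[OF l_closed_lift] subgroup.subset[OF G] by auto
    qed
    ultimately show ?thesis
      using index_lift[OF 2(2,1) refl 2(4)] square_det_lift by blast
  qed
qed

end

theorem theorem4p2:
  fixes G :: "('p::prime_card padic_int ^ 2 ^ 2) set"
  assumes "odd CARD('p)"
    and "closed_subgroup G GL2"
  shows "(square_determinants G \<and> cartan_or_borel_type G \<longrightarrow>
            (\<forall>s::nat. s > 0 \<longrightarrow> l_power_sl2 s \<subseteq> Lie G \<longrightarrow>
               congruence_subgroup (4 * s) \<subseteq> derived GL2 G)) \<and>
         (derived GL2 G = SL2 \<or>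
            (\<exists>H. closed_subgroup H (GL2\<lparr>carrier := G\<rparr>) \<and>
               finite (rcosets\<^bsub>GL2\<lparr>carrier := G\<rparr>\<^esub> H) \<and>
               card (rcosets\<^bsub>GL2\<lparr>carrier := G\<rparr>\<^esub> H) \<le> 24 \<and>
               square_determinants H \<and> cartan_or_borel_type H))"
proof -
  have G: "subgroup G GL2" "l_closed G" using assms(2) closed_subgroup_GL2_iff by blast+
  show ?thesis using congruence_subgroup_subset_derived[OF assms(1) G] derived_eq_SL2_or_subgroup_of_bounded_index[OF assms(1) G] by blast
qed

end
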